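(* Suppose that, for each $n\ge1$, $G_n$ is a (labelled or unlabelled) random graph on $n$ vertices with some distribution $\mu_n$. Suppose further that as $n\to\infty$, $G_n$ converges in distribution to some random graph limit with distribution $\mu$. Then $$\limsup_{n\to\infty}\frac{\operatorname{Ent}(G_n)}{\binom n2}\le\max_{W\in\operatorname{supp}(\mu)}\operatorname{Ent}(W),$$ where $\operatorname{supp}(\mu)\subseteq\widehat{\mathcal{U}}$ is the support of the probability measure $\mu$.
   Context: All graphs are finite and simple; $|G|$ is the number of vertices of $G$. $\mathcal{U}$ is the set of unlabelled graphs (isomorphism classes), $\mathcal{U}_n$ is the set of those with exactly $n\ge 1$ vertices, and $\mathcal{L}_n$ is the set of graphs with vertex set $[n]=\{1,\dots,n\}$. A random unlabelled [labelled] graph on $n$ vertices is any random variable with values in $\mathcal{U}_n$ [$\mathcal{L}_n$]; its distribution need not be uniform. For graphs $H,G$ with $|H|\le|G|$, $p(H;G)$ is the probability that a uniformly random injective map $\phi:V(H)\to V(G)$ satisfies $uv\in E(H)\iff\phi(u)\phi(v)\in E(G)$ for all $u\ne v$. A graphon is a symmetric measurable function $W:[0,1]^2\to[0,1]$ (functions equal a.e. are identified). For a graphon $W$ and a graph $H$, $$p(H;W):=\mathbb{E}\Big[\prod_{uv\in E(H)}W(X_u,X_v)\prod_{uv\in E(H)^c}(1-W(X_u,X_v))\Big],$$ where $(X_u)_{u\in V(H)}$ are i.i.d. uniform on $[0,1]$ and $E(H)^c=\{uv:u\ne v,\ uv\notin E(H)\}$. Two graphons are equivalent if $p(H;\cdot)$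 agrees on them for all graphs $H$; a graph limit $\Gamma$ is an equivalence class of graphons, $p(H;\Gamma):=p(H;W)$ for any representing $W$, and $\widehat{\mathcal{U}}$ is the set of all graph limits. $\overline{\mathcal{U}}=\mathcal{U}\cup\widehat{\mathcal{U}}$ is a compact metrizable space in which $\mathcal{U}$ is dense: a sequence of graphs $G_i$ converges to $\Gamma\in\widehat{\mathcal{U}}$ iff $|G_i|\to\infty$ and $p(H;G_i)\to p(H;\Gamma)$ for every graph $H$; a sequence $\Gamma_i\in\widehat{\mathcal U}$ converges to $\Gamma\in\widehat{\mathcal U}$ iff $p(H;\Gamma_i)\to p(H;\Gamma)$ for every graph $H$; points of $\mathcal{U}$ are isolated. Convergence in distribution of $G_n$ is meant as random elements of $\overline{\mathcal{U}}$ (ignoring labels if there are any); the limit is then a random element of $\overline{\mathcal{U}}$ concentrated on $\widehat{\mathcal{U}}$. For a random variable $X$ with values in a finite set $A$, $\operatorname{Ent}(X)=\sum_{a\in A}(-p_a\log_2p_a)$ with $p_a=\Pr(X=a)$ and $0\log_20=0$. With $h(x)=-x\log_2x-(1-x)\log_2(1-x)$ on $[0,1]$ ($h(0)=h(1)=0$), the entropy of a graphon is $\operatorname{Ent}(W):=\int_0^1\int_0^1h(W(x,y))\,dx\,dy$; it depends only on the graph limit represented by $W$, so it is also defined for graph limits. The statement includes that the maximum is attained. *)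

theory Defs
  imports "HOL-Probability.Probability"
begin

section \<open>Finite simple graphs\<close>

text \<open>A graph has vertex set \<open>{1..n}\<close> for some \<open>n \<ge> 1\<close>, and its edges are two-element subsets of
  the vertex set.  Every finite simple graph with at least one vertex is isomorphic to such a graph,
  so isomorphism classes of these are all the unlabelled graphs, and quantifying over them is the
  same as quantifying over all graphs \<open>H\<close> in isomorphism-invariant statements.\<close>

typedef graph =
  "{(n :: nat, E :: nat set set). n \<ge> 1 \<and> E \<subseteq> {{u, v} |u v. u \<in> {1..n} \<and> v \<in> {1..n} \<and> u \<noteq> v}}"
  by (rule exI[of _ "(1, {})"]) simp

setup_lifting type_definition_graph

lift_definition graph_order :: "graph \<Rightarrow> nat" is fst .

lift_definition edges :: "graph \<Rightarrow> nat set set" is snd .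

definition verts :: "graph \<Rightarrow> nat set" where
  "verts G = {1..graph_order G}"

definition adj :: "graph \<Rightarrow> nat \<Rightarrow> nat \<Rightarrow> bool" where
  "adj G u v \<longleftrightarrow> {u, v} \<in> edges G"

definition labelled_graphs :: "nat \<Rightarrow> graph set" where
  "labelled_graphs n = {G. graph_order G = n}"

definition graph_iso :: "graph \<Rightarrow> graph \<Rightarrow> bool" where
  "graph_iso G G' \<longleftrightarrow>
     (\<exists>f. bij_betw f (verts G) (verts G') \<and>
          (\<forall>u\<in>verts G. \<forall>v\<in>verts G. adj G u v \<longleftrightarrow> adj G' (f u) (f v)))"

lemma graph_order_pos: "graph_order G \<ge> 1"
  by transfer auto

lemma finite_verts [simp]: "finite (verts G)" and card_verts [simp]: "card (verts G) = graph_order G"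
  by (simp_all add: verts_def)

lemma edges_subset: "edges G \<subseteq> {{u, v} |u v. u \<in> verts G \<and> v \<in> verts G \<and> u \<noteq> v}"
  unfolding verts_def by transfer auto

lemma not_adj_self [simp]: "\<not> adj G u u"
  using edges_subset[of G] unfolding adj_def by (auto simp: doubleton_eq_iff)

lemma graph_eqI: "graph_order G = graph_order G' \<Longrightarrow> edges G = edges G' \<Longrightarrow> G = G'"
  by transfer auto

lemma graph_iso_order: "graph_iso G G' \<Longrightarrow> graph_order G = graph_order G'"
  unfolding graph_iso_def using bij_betw_same_card card_verts by metis

lemma graph_iso_refl: "graph_iso G G"
  unfolding graph_iso_def by (rule exI[of _ id]) auto

lemma graph_iso_sym:
  assumes "graph_iso G G'" shows "graph_iso G' G"
proof -
  obtain f where f: "bij_betw f (verts G) (verts G')"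
    and a: "\<forall>u\<in>verts G. \<forall>v\<in>verts G. adj G u v \<longleftrightarrow> adj G' (f u) (f v)"
    using assms unfolding graph_iso_def by blast
  let ?g = "inv_into (verts G) f"
  have "bij_betw ?g (verts G') (verts G)" using f by (rule bij_betw_inv_into)
  moreover have "adj G' u v \<longleftrightarrow> adj G (?g u) (?g v)" if "u \<in> verts G'" "v \<in> verts G'" for u v
    using that a f bij_betw_inv_into_right[OF f] bij_betw_apply[OF \<open>bij_betw ?g _ _\<close>] by metis
  ultimately show ?thesis unfolding graph_iso_def by blast
qed

lemma graph_iso_trans:
  assumes "graph_iso G G'" "graph_iso G' G''" shows "graph_iso G G''"
proof -
  obtain f g where f: "bij_betw f (verts G) (verts G')" and g: "bij_betw g (verts G') (verts G'')"
    and "\<forall>u\<in>verts G. \<forall>v\<in>verts G. adj G u v \<longleftrightarrow> adj G' (f u) (f v)"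
    and "\<forall>u\<in>verts G'. \<forall>v\<in>verts G'. adj G' u v \<longleftrightarrow> adj G'' (g u) (g v)"
    using assms unfolding graph_iso_def by blast
  then have "\<forall>u\<in>verts G. \<forall>v\<in>verts G. adj G u v \<longleftrightarrow> adj G'' ((g \<circ> f) u) ((g \<circ> f) v)"
    by (auto simp: bij_betw_apply)
  then show ?thesis unfolding graph_iso_def using bij_betw_trans[OF f g] by blast
qed

quotient_type ugraph = graph / graph_iso
  by (intro equivpI reflpI sympI transpI) (auto intro: graph_iso_refl graph_iso_sym graph_iso_trans)

lift_definition ugraph_order :: "ugraph \<Rightarrow> nat" is graph_order
  by (rule graph_iso_order)

definition unlabelled_graphs :: "nat \<Rightarrow> ugraph set" where
  "unlabelled_graphs n = {G. ugraph_order G = n}"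

definition unlabel :: "graph \<Rightarrow> ugraph" where
  "unlabel = abs_ugraph"


section \<open>Induced subgraph densities\<close>

definition injections :: "graph \<Rightarrow> graph \<Rightarrow> (nat \<Rightarrow> nat) set" where
  "injections H G = {\<phi> \<in> verts H \<rightarrow>\<^sub>E verts G. inj_on \<phi> (verts H)}"

definition induced_maps :: "graph \<Rightarrow> graph \<Rightarrow> (nat \<Rightarrow> nat) set" where
  "induced_maps H G =
     {\<phi>. \<forall>u\<in>verts H. \<forall>v\<in>verts H. u \<noteq> v \<longrightarrow> (adj H u v \<longleftrightarrow> adj G (\<phi> u) (\<phi> v))}"

text \<open>The density is only meaningful for \<open>|H| \<le> |G|\<close>; the value \<open>0\<close> otherwise is a convention that
  affects neither convergence to graph limits nor the topology introduced below.\<close>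

definition graph_density :: "graph \<Rightarrow> graph \<Rightarrow> real" where
  "graph_density H G =
     (if graph_order H \<le> graph_order G
      then measure_pmf.prob (pmf_of_set (injections H G)) (induced_maps H G) else 0)"

lemma finite_injections: "finite (injections H G)"
  unfolding injections_def by (rule finite_subset[OF _ finite_PiE[of "verts H" "\<lambda>_. verts G"]]) auto

lemma injections_nonempty:
  assumes "graph_order H \<le> graph_order G" shows "injections H G \<noteq> {}"
proof -
  have "restrict id (verts H) \<in> injections H G"
    using assms by (auto simp: injections_def verts_def inj_on_def)
  then show ?thesis by blast
qed

lemma graph_density_cong:
  assumes "graph_iso G G'" shows "graph_density H G = graph_density H G'"
proof (cases "graph_order H \<le> graph_order G")
  case True
  obtain f where f: "bij_betw f (verts G) (verts G')"
    and a: "\<forall>u\<in>verts G. \<forall>v\<in>verts G. adj G u v \<longleftrightarrow> adj G' (f u) (f v)"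
    using assms unfolding graph_iso_def by blast
  define F where "F \<phi> = restrict (f \<circ> \<phi>) (verts H)" for \<phi>
  define g where "g = inv_into (verts G) f"
  have g: "bij_betw g (verts G') (verts G)"
    unfolding g_def using f by (rule bij_betw_inv_into)
  have gf: "g (f x) = x" if "x \<in> verts G" for x
    using bij_betw_inv_into_left[OF f that] by (simp add: g_def)
  have fg: "f (g x) = x" if "x \<in> verts G'" for x
    using bij_betw_inv_into_right[OF f that] by (simp add: g_def)
  have bij: "bij_betw F (injections H G) (injections H G')"
  proof (rule bij_betw_byWitness[where f' = "\<lambda>\<phi>. restrict (g \<circ> \<phi>) (verts H)"])
    show "\<forall>\<phi>\<in>injections H G. restrict (g \<circ> F \<phi>) (verts H) = \<phi>"
    proof
      fix \<phi> assume "\<phi> \<in> injections H G"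
      then have \<phi>: "\<phi> \<in> verts H \<rightarrow>\<^sub>E verts G" by (simp add: injections_def)
      show "restrict (g \<circ> F \<phi>) (verts H) = \<phi>"
      proof
        fix x show "(restrict (g \<circ> F \<phi>) (verts H)) x = \<phi> x"
          using gf[OF PiE_mem[OF \<phi>, of x]] PiE_arb[OF \<phi>, of x]
          by (cases "x \<in> verts H") (simp_all add: F_def)
      qed
    qed
    show "\<forall>\<phi>\<in>injections H G'. F (restrict (g \<circ> \<phi>) (verts H)) = \<phi>"
    proof
      fix \<phi> assume "\<phi> \<in> injections H G'"
      then have \<phi>: "\<phi> \<in> verts H \<rightarrow>\<^sub>E verts G'" by (simp add: injections_def)
      show "F (restrict (g \<circ> \<phi>) (verts H)) = \<phi>"
      proof
        fix x show "(F (restrict (g \<circ> \<phi>) (verts H))) x = \<phi> x"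
          using fg[OF PiE_mem[OF \<phi>, of x]] PiE_arb[OF \<phi>, of x]
          by (cases "x \<in> verts H") (simp_all add: F_def)
      qed
    qed
    have inj: "inj_on (restrict (k \<circ> \<phi>) (verts H)) (verts H)"
      if "inj_on k B" "\<phi> \<in> verts H \<rightarrow>\<^sub>E B" "inj_on \<phi> (verts H)" for k :: "nat \<Rightarrow> nat" and \<phi> B
    proof (rule inj_onI)
      fix x y assume xy: "x \<in> verts H" "y \<in> verts H"
        and "restrict (k \<circ> \<phi>) (verts H) x = restrict (k \<circ> \<phi>) (verts H) y"
      then have "k (\<phi> x) = k (\<phi> y)" by simp
      then have "\<phi> x = \<phi> y"
        using inj_onD[OF that(1)] PiE_mem[OF that(2)] xy by blast
      then show "x = y" using inj_onD[OF that(3)] xy by blast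
    qed
    show "F ` injections H G \<subseteq> injections H G'"
      using inj[OF bij_betw_imp_inj_on[OF f]]
      by (auto simp: F_def injections_def intro!: bij_betw_apply[OF f] intro: PiE_mem)
    show "(\<lambda>\<phi>. restrict (g \<circ> \<phi>) (verts H)) ` injections H G' \<subseteq> injections H G"
      using inj[OF bij_betw_imp_inj_on[OF g]]
      by (auto simp: injections_def intro!: bij_betw_apply[OF g] intro: PiE_mem)
  qed
  have F: "F \<phi> \<in> induced_maps H G' \<longleftrightarrow> \<phi> \<in> induced_maps H G" if "\<phi> \<in> injections H G" for \<phi>
  proof -
    have "\<phi> u \<in> verts G" if "u \<in> verts H" for u
      using \<open>\<phi> \<in> _\<close> that by (auto simp: injections_def)
    then show ?thesis using a by (auto simp: induced_maps_def F_def)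
  qed
  have "pmf_of_set (injections H G') = map_pmf F (pmf_of_set (injections H G))"
    using map_pmf_of_set_bij_betw[OF bij injections_nonempty[OF True] finite_injections] by simp
  then have "measure_pmf.prob (pmf_of_set (injections H G')) (induced_maps H G')
      = measure_pmf.prob (pmf_of_set (injections H G)) (F -` induced_maps H G')"
    by simp
  also have "\<dots> = measure_pmf.prob (pmf_of_set (injections H G)) (induced_maps H G)"
    using F injections_nonempty[OF True] finite_injections
    by (intro measure_pmf.finite_measure_eq_AE) (auto simp: AE_measure_pmf_iff)
  finally show ?thesis using graph_iso_order[OF assms] by (simp add: graph_density_def)
qed (use graph_iso_order[OF assms] in \<open>simp add: graph_density_def\<close>)

lift_definition ugraph_density :: "graph \<Rightarrow> ugraph \<Rightarrow> real" is graph_density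
  by (rule graph_density_cong)


section \<open>Graphons and graph limits\<close>

text \<open>The uniform distribution on \<open>[0,1]\<close>, as a measure whose space is \<open>[0,1]\<close>.\<close>

definition unit_measure :: "real measure" where
  "unit_measure = restrict_space lborel {0..1}"

text \<open>Graphons are represented by functions on \<open>\<real> \<times> \<real>\<close> whose values outside \<open>[0,1]\<^sup>2\<close> are never used.
  Graphons that agree almost everywhere have the same densities, hence are identified in the type
  \<open>graph_limit\<close>; for the same reason it is harmless that measurability is Borel measurability.\<close>

typedef graphon =
  "{W :: real \<Rightarrow> real \<Rightarrow> real.
      (\<lambda>(x, y). W x y) \<in> borel_measurable (unit_measure \<Otimes>\<^sub>M unit_measure) \<and>
      (\<forall>x\<in>{0..1}. \<forall>y\<in>{0..1}. W x y = W y x \<and> 0 \<le> W x y \<and> W x y \<le> 1)}"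
  morphisms graphon_fun Abs_graphon
  by (rule exI[of _ "\<lambda>_ _. 0"]) simp

text \<open>By symmetry of \<open>W\<close>, unordered pairs \<open>uv\<close> are represented by pairs with \<open>u < v\<close>.\<close>

definition graphon_density :: "graph \<Rightarrow> graphon \<Rightarrow> real" where
  "graphon_density H W =
     (\<integral>X. (\<Prod>(u, v)\<in>{(u, v). u \<in> verts H \<and> v \<in> verts H \<and> u < v \<and> adj H u v}.
             graphon_fun W (X u) (X v)) *
          (\<Prod>(u, v)\<in>{(u, v). u \<in> verts H \<and> v \<in> verts H \<and> u < v \<and> \<not> adj H u v}.
             1 - graphon_fun W (X u) (X v))
      \<partial>(\<Pi>\<^sub>M u\<in>verts H. unit_measure))"

definition graphon_equiv :: "graphon \<Rightarrow> graphon \<Rightarrow> bool" where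
  "graphon_equiv W W' \<longleftrightarrow> (\<forall>H. graphon_density H W = graphon_density H W')"

quotient_type graph_limit = graphon / graphon_equiv
  by (intro equivpI reflpI sympI transpI) (auto simp: graphon_equiv_def)

lift_definition limit_density :: "graph \<Rightarrow> graph_limit \<Rightarrow> real" is graphon_density
  by (simp add: graphon_equiv_def)

lemma limit_eqI: "(\<And>H. limit_density H \<Gamma> = limit_density H \<Gamma>') \<Longrightarrow> \<Gamma> = \<Gamma>'"
  by transfer (simp add: graphon_equiv_def)


section \<open>The space of unlabelled graphs and graph limits\<close>

datatype graph_or_limit = Graph ugraph | Limit graph_limit

fun induced_density :: "graph \<Rightarrow> graph_or_limit \<Rightarrow> real" where
  "induced_density H (Graph G) = ugraph_density H G"
| "induced_density H (Limit \<Gamma>) = limit_density H \<Gamma>"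

fun inverse_order :: "graph_or_limit \<Rightarrow> real" where
  "inverse_order (Graph G) = 1 / real (ugraph_order G)"
| "inverse_order (Limit \<Gamma>) = 0"

definition embed :: "graph_or_limit \<Rightarrow> (graph \<Rightarrow> real) \<times> real" where
  "embed x = (\<lambda>H. induced_density H x, inverse_order x)"

text \<open>The topology is the one induced by the embedding into the product space of real-valued
  functions of \<open>H\<close> times the reals.  The lemmas below confirm that it has the
  characterising properties: convergence to a graph limit is convergence of all densities
  (together with \<open>|G| \<rightarrow> \<infinity>\<close> for sequences of graphs), graphs are isolated points, and the map is
  injective, so the space is metrizable, there being countably many \<open>H\<close>.\<close>

instantiation graph_or_limit :: topological_space
begin

definition open_graph_or_limit :: "graph_or_limit set \<Rightarrow> bool" where
  "open S \<longleftrightarrow> (\<exists>T. open T \<and> S = embed -` T)"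

instance
proof
  show "open (UNIV :: graph_or_limit set)"
    unfolding open_graph_or_limit_def by (rule exI[of _ UNIV]) auto
  fix S T :: "graph_or_limit set"
  assume "open S" "open T"
  then show "open (S \<inter> T)"
    unfolding open_graph_or_limit_def by (metis open_Int vimage_Int)
next
  fix K :: "graph_or_limit set set"
  assume "\<forall>S\<in>K. open S"
  then obtain t where t: "\<And>S. S \<in> K \<Longrightarrow> open (t S) \<and> S = embed -` t S"
    unfolding open_graph_or_limit_def by metis
  have "\<Union>K = embed -` (\<Union>S\<in>K. t S)" using t by blast
  moreover have "open (\<Union>S\<in>K. t S)" using t by blast
  ultimately show "open (\<Union>K)" unfolding open_graph_or_limit_def by blast
qed

end

text \<open>Graph limits carry the subspace topology.\<close>

instantiation graph_limit :: topological_space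
begin

definition open_graph_limit :: "graph_limit set \<Rightarrow> bool" where
  "open S \<longleftrightarrow> (\<exists>T. open T \<and> S = Limit -` T)"

instance
proof
  show "open (UNIV :: graph_limit set)"
    unfolding open_graph_limit_def by (rule exI[of _ UNIV]) auto
  fix S T :: "graph_limit set"
  assume "open S" "open T"
  then show "open (S \<inter> T)"
    unfolding open_graph_limit_def by (metis open_Int vimage_Int)
next
  fix K :: "graph_limit set set"
  assume "\<forall>S\<in>K. open S"
  then obtain t where t: "\<And>S. S \<in> K \<Longrightarrow> open (t S) \<and> S = Limit -` t S"
    unfolding open_graph_limit_def by metis
  have "\<Union>K = Limit -` (\<Union>S\<in>K. t S)" using t by blast
  moreover have "open (\<Union>S\<in>K. t S)" using t by blast
  ultimately show "open (\<Union>K)" unfolding open_graph_limit_def by blast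
qed

end

lemma tendsto_embed_iff:
  "(f \<longlongrightarrow> x) F \<longleftrightarrow> ((\<lambda>i. embed (f i)) \<longlongrightarrow> embed x) F"
proof
  assume "(f \<longlongrightarrow> x) F"
  moreover have "continuous_on UNIV embed"
    unfolding continuous_on_open_vimage[OF open_UNIV] by (auto simp: open_graph_or_limit_def)
  ultimately show "((\<lambda>i. embed (f i)) \<longlongrightarrow> embed x) F"
    by (auto intro: continuous_on_tendsto_compose)
next
  assume lim: "((\<lambda>i. embed (f i)) \<longlongrightarrow> embed x) F"
  show "(f \<longlongrightarrow> x) F"
  proof (rule topological_tendstoI)
    fix S :: "graph_or_limit set" assume "open S" "x \<in> S"
    then obtain T where "open T" "S = embed -` T" unfolding open_graph_or_limit_def by blast
    then show "eventually (\<lambda>i. f i \<in> S) F"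
      using topological_tendstoD[OF lim, of T] \<open>x \<in> S\<close> by auto
  qed
qed

lemma tendsto_fun_iff:
  fixes f :: "'i \<Rightarrow> 'b \<Rightarrow> 'c :: topological_space"
  shows "(f \<longlongrightarrow> l) F \<longleftrightarrow> (\<forall>x. ((\<lambda>i. f i x) \<longlongrightarrow> l x) F)"
  using limitin_componentwise[of "\<lambda>_::'b. euclidean :: 'c topology" UNIV f l F]
  by (simp add: euclidean_product_topology)

lemma tendsto_graph_or_limit_iff:
  "(f \<longlongrightarrow> x) F \<longleftrightarrow>
     (\<forall>H. ((\<lambda>i. induced_density H (f i)) \<longlongrightarrow> induced_density H x) F) \<and>
     ((\<lambda>i. inverse_order (f i)) \<longlongrightarrow> inverse_order x) F"
proof -
  have "((\<lambda>i. embed (f i)) \<longlongrightarrow> embed x) F \<longleftrightarrow>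
      ((\<lambda>i H. induced_density H (f i)) \<longlongrightarrow> (\<lambda>H. induced_density H x)) F \<and>
      ((\<lambda>i. inverse_order (f i)) \<longlongrightarrow> inverse_order x) F"
    unfolding embed_def
    by (auto intro: tendsto_Pair dest: tendsto_fst tendsto_snd)
  then show ?thesis unfolding tendsto_embed_iff[of f] by (simp add: tendsto_fun_iff)
qed

lemma ugraph_order_pos: "ugraph_order G \<ge> 1"
  by transfer (rule graph_order_pos)

lemma Graph_tendsto_Limit_iff:
  "(\<lambda>i. Graph (G i)) \<longlonglongrightarrow> Limit \<Gamma> \<longleftrightarrow>
     filterlim (\<lambda>i. ugraph_order (G i)) at_top sequentially \<and>
     (\<forall>H. (\<lambda>i. ugraph_density H (G i)) \<longlonglongrightarrow> limit_density H \<Gamma>)"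
proof -
  have "(\<lambda>i. 1 / real (ugraph_order (G i))) \<longlonglongrightarrow> 0 \<longleftrightarrow>
      filterlim (\<lambda>i. real (ugraph_order (G i))) at_top sequentially"
  proof
    assume "(\<lambda>i. 1 / real (ugraph_order (G i))) \<longlonglongrightarrow> 0"
    then have "filterlim (\<lambda>i. inverse (1 / real (ugraph_order (G i)))) at_top sequentially"
      by (rule filterlim_inverse_at_top)
        (auto intro!: always_eventually simp: Suc_le_lessD ugraph_order_pos[unfolded One_nat_def])
    then show "filterlim (\<lambda>i. real (ugraph_order (G i))) at_top sequentially" by simp
  next
    assume "filterlim (\<lambda>i. real (ugraph_order (G i))) at_top sequentially"
    then show "(\<lambda>i. 1 / real (ugraph_order (G i))) \<longlonglongrightarrow> 0"
      by (rule real_tendsto_divide_at_top[OF tendsto_const])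
  qed
  then show ?thesis
    by (auto simp: tendsto_graph_or_limit_iff filterlim_sequentially_iff_filterlim_real)
qed

lemma Limit_tendsto_Limit_iff:
  "(\<lambda>i. Limit (\<Gamma>' i)) \<longlonglongrightarrow> Limit \<Gamma> \<longleftrightarrow>
     (\<forall>H. (\<lambda>i. limit_density H (\<Gamma>' i)) \<longlonglongrightarrow> limit_density H \<Gamma>)"
  by (simp add: tendsto_graph_or_limit_iff)

lemma continuous_Limit: "continuous_on UNIV Limit"
  unfolding continuous_on_open_vimage[OF open_UNIV] by (auto simp: open_graph_limit_def)

lemma graph_density_pos_imp_iso:
  assumes "graph_order H = graph_order G" "graph_density H G > 0"
  shows "graph_iso H G"
proof -
  have "measure_pmf.prob (pmf_of_set (injections H G)) (induced_maps H G) \<noteq> 0"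
    using assms by (simp add: graph_density_def)
  then obtain \<phi> where \<phi>: "\<phi> \<in> injections H G" "\<phi> \<in> induced_maps H G"
    using injections_nonempty[of H G] finite_injections[of H G] assms(1)
    by (auto simp: measure_pmf_zero_iff)
  then have "inj_on \<phi> (verts H)" "\<phi> ` verts H \<subseteq> verts G"
    by (auto simp: injections_def)
  then have "\<phi> ` verts H = verts G"
    by (intro card_subset_eq) (simp_all add: card_image assms(1))
  then have "bij_betw \<phi> (verts H) (verts G)"
    using \<open>inj_on \<phi> (verts H)\<close> by (simp add: bij_betw_def)
  moreover have "adj H u v \<longleftrightarrow> adj G (\<phi> u) (\<phi> v)" if "u \<in> verts H" "v \<in> verts H" for u v
    using \<phi>(2) that by (cases "u = v") (auto simp: induced_maps_def)
  ultimately show ?thesis unfolding graph_iso_def by blast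
qed

lemma graph_density_self_pos: "graph_density G G > 0"
proof -
  have "restrict id (verts G) \<in> injections G G \<inter> induced_maps G G"
    by (auto simp: injections_def induced_maps_def inj_on_def)
  then have "measure_pmf.prob (pmf_of_set (injections G G)) (induced_maps G G) \<noteq> 0"
    using injections_nonempty[of G G] finite_injections[of G G] by (auto simp: measure_pmf_zero_iff)
  then show ?thesis by (simp add: graph_density_def zero_less_measure_iff)
qed

lemma open_Graph_singleton: "open {Graph G}"
proof -
  obtain H where H: "G = abs_ugraph H"
    by (metis Quotient3_abs_rep Quotient3_ugraph)
  define n where "n = ugraph_order G"
  have n: "n \<ge> 1" using ugraph_order_pos n_def by simp
  define T :: "((graph \<Rightarrow> real) \<times> real) set"
    where "T = {f. f H > 0} \<times> {1 / real (n + 1)<..<1 / (real n - 1/2)}"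
  have "open {f :: graph \<Rightarrow> real. f H > 0}"
    using open_vimage[OF open_greaterThan[of "0 :: real"] continuous_on_product_coordinates[of H]]
    by (simp add: vimage_def)
  then have "open T" unfolding T_def by (intro open_Times) auto
  moreover have "{Graph G} = embed -` T"
  proof (intro equalityI subsetI)
    fix x assume "x \<in> {Graph G}"
    moreover have "ugraph_density H G > 0"
      by (simp add: H ugraph_density.abs_eq graph_density_self_pos)
    ultimately show "x \<in> embed -` T"
      using n by (auto simp: T_def embed_def n_def[symmetric] field_simps)
  next
    fix x assume x: "x \<in> embed -` T"
    show "x \<in> {Graph G}"
    proof (cases x)
      case (Limit \<Gamma>)
      have "0 < 1 / real (n + 1)" by simp
      then show ?thesis using x Limit by (auto simp: T_def embed_def)
    next
      case (Graph K)
      define m where "m = ugraph_order K"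
      have m: "m \<ge> 1" using ugraph_order_pos m_def by simp
      have *: "1 / real (n + 1) < 1 / real m" "1 / real m < 1 / (real n - 1/2)"
        "ugraph_density H K > 0"
        using x Graph by (auto simp: T_def embed_def m_def)
      have "m < n + 1" using *(1) m by (simp add: field_simps)
      moreover have "real n - 1/2 < real m" using *(2) m n by (simp add: field_simps)
      ultimately have "m = n" by linarith
      then have "graph_order H = ugraph_order K"
        unfolding m_def n_def H by (simp add: ugraph_order.abs_eq)
      moreover obtain L where L: "K = abs_ugraph L"
        by (metis Quotient3_abs_rep Quotient3_ugraph)
      ultimately have "graph_iso H L"
        using *(3) by (simp add: ugraph_order.abs_eq ugraph_density.abs_eq graph_density_pos_imp_iso)
      then have "abs_ugraph H = K"
        unfolding L by (simp add: ugraph.abs_eq_iff)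
      then show ?thesis using Graph H by simp
    qed
  qed
  ultimately show ?thesis unfolding open_graph_or_limit_def by blast
qed

lemma inj_embed: "inj embed"
proof (rule injI)
  fix x y assume eq: "embed x = embed y"
  have Graph: "z = Graph G" if "embed z = embed (Graph G)" for z G
    using open_Graph_singleton[of G] that unfolding open_graph_or_limit_def
    by (metis singletonD singletonI vimageD vimageI2)
  show "x = y"
  proof (cases x; cases y)
    fix \<Gamma> \<Gamma>' assume xy: "x = Limit \<Gamma>" "y = Limit \<Gamma>'"
    have "limit_density H \<Gamma> = limit_density H \<Gamma>'" for H
      using eq xy by (auto simp: embed_def dest: fun_cong)
    then show ?thesis using xy limit_eqI by blast
  qed (use eq Graph in metis)+
qed


section \<open>Random graphs, convergence in distribution, support\<close>

text \<open>The distribution of a random graph that is either labelled or unlabelled.  Since there are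
  only finitely many graphs on \<open>n\<close> vertices, such distributions are probability mass functions.\<close>

datatype random_graph = Labelled "graph pmf" | Unlabelled "ugraph pmf"

fun random_graph_on :: "nat \<Rightarrow> random_graph \<Rightarrow> bool" where
  "random_graph_on n (Labelled p) \<longleftrightarrow> set_pmf p \<subseteq> labelled_graphs n"
| "random_graph_on n (Unlabelled p) \<longleftrightarrow> set_pmf p \<subseteq> unlabelled_graphs n"

fun ignore_labels :: "random_graph \<Rightarrow> ugraph pmf" where
  "ignore_labels (Labelled p) = map_pmf unlabel p"
| "ignore_labels (Unlabelled p) = p"

definition graph_distr :: "random_graph \<Rightarrow> graph_or_limit measure" where
  "graph_distr R = distr (measure_pmf (ignore_labels R)) borel Graph"

definition limit_distr :: "graph_limit measure \<Rightarrow> graph_or_limit measure" where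
  "limit_distr \<mu> = distr \<mu> borel Limit"

lemma measurable_Limit: "Limit \<in> borel \<rightarrow>\<^sub>M borel"
  by (rule borel_measurable_continuous_onI[OF continuous_Limit])

definition weakly_converges :: "(nat \<Rightarrow> 'a :: topological_space measure) \<Rightarrow> 'a measure \<Rightarrow> bool" where
  "weakly_converges M N \<longleftrightarrow>
     (\<forall>f :: 'a \<Rightarrow> real. continuous_on UNIV f \<and> bounded (range f) \<longrightarrow>
        (\<lambda>n. \<integral>x. f x \<partial>M n) \<longlonglongrightarrow> (\<integral>x. f x \<partial>N))"

definition measure_support :: "'a :: topological_space measure \<Rightarrow> 'a set" where
  "measure_support \<mu> = {x. \<forall>U. open U \<and> x \<in> U \<longrightarrow> emeasure \<mu> U > 0}"


section \<open>Entropy\<close>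

text \<open>Values outside the (finite) set of atoms contribute \<open>0\<close>.  Note that \<open>0 * log 2 0 = 0\<close>.\<close>

definition pmf_entropy :: "'a pmf \<Rightarrow> real" where
  "pmf_entropy p = (\<Sum>a\<in>set_pmf p. - pmf p a * log 2 (pmf p a))"

fun random_graph_entropy :: "random_graph \<Rightarrow> real" where
  "random_graph_entropy (Labelled p) = pmf_entropy p"
| "random_graph_entropy (Unlabelled p) = pmf_entropy p"

definition binary_entropy :: "real \<Rightarrow> real" where
  "binary_entropy x = - x * log 2 x - (1 - x) * log 2 (1 - x)"

definition graphon_entropy :: "graphon \<Rightarrow> real" where
  "graphon_entropy W =
     (\<integral>x. (\<integral>y. binary_entropy (graphon_fun W x y) \<partial>unit_measure) \<partial>unit_measure)"

text \<open>Equivalent graphons have the same entropy, so the choice of representative is immaterial.\<close>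

definition limit_entropy :: "graph_limit \<Rightarrow> real" where
  "limit_entropy \<Gamma> = graphon_entropy (rep_graph_limit \<Gamma>)"

end

theory Submission
  imports Defs "HOL-Real_Asymp.Real_Asymp"
begin

text \<open>Let \<open>E k \<Gamma>\<close> be the entropy of the random labelled graph on \<open>k\<close> vertices sampled from \<open>\<Gamma>\<close>.
  Jensen's inequality, conditionally on the positions of the sampled points, gives
  \<open>Ent \<Gamma> \<le> E k \<Gamma> / (k choose 2)\<close>; conversely, revealing only the cells of a fine partition that
  contain the sampled points shows that these quotients come arbitrarily close to \<open>Ent \<Gamma>\<close>.  Hence
  \<open>Ent\<close> is an infimum of continuous functions of the densities, so it is upper semicontinuous, and
  it attains its maximum \<open>M\<close> on the support of \<open>\<mu>\<close> because the space of graph limits is compact.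
  For compactness, take Frieze-Kannan partitions of the graphons of a sequence; along a subsequence
  their cell weights and averages converge, and the limits define a bounded martingale of step
  functions whose limit is the required graphon.

  By Shearer's inequality the normalised entropy of a random unlabelled graph on \<open>n\<close> vertices is at
  most that of its random induced subgraph on \<open>k \<le> n\<close> vertices, whose distribution is given by
  averaged densities.  Near a point \<open>\<Gamma>\<close> of the support these densities are close to those of \<open>\<Gamma>\<close>,
  so for suitable \<open>k\<close> the bound is at most \<open>M + \<delta>\<close>.  Finitely many such neighbourhoods carry almost
  all the mass of \<open>\<mu>\<close>, hence of \<open>G n\<close>; recording which of them contains \<open>G n\<close> costs only a
  bounded amount of entropy, and labels cost at most \<open>n * log 2 n\<close>.\<close>

section \<open>Entropy of finite distributions\<close>

text \<open>Entropy is not continuous for convergence of densities: the 0-1 valued graphons of large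
  uniform random graphs have entropy 0, yet they converge to the constant 1/2, of entropy 1. So only
  an upper bound can pass to the limit. The two inequalities between \<open>limit_entropy\<close>
  and \<open>sample_entropy\<close> also make the former independent of the representing graphon,
  since the latter depends on densities alone.

  The law of \<open>G n\<close> is arbitrary, so graphs near \<Gamma> cannot simply be counted.
  Shearer's inequality takes the place of counting because it holds for every law, in particular for
  \<open>G n\<close> conditioned on a neighbourhood. Neighbourhoods are boxes of densities because
  conditioning and averaging do not leave a box.

  Limits are classes of graphons with equal densities; measure-preserving maps and the cut metric do
  not appear. Compactness therefore has to build a graphon from numbers: a cell is remembered only
  by the word coding its membership in the chosen sets, so cells of different graphons can be
  compared and laid out again as intervals.\<close>

definition eta :: "real \<Rightarrow> real" where
  "eta x = - x * log 2 x"

lemma eta_0 [simp]: "eta 0 = 0" and eta_1 [simp]: "eta 1 = 0"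
  by (simp_all add: eta_def)

lemma eta_nonneg: "0 \<le> x \<Longrightarrow> x \<le> 1 \<Longrightarrow> 0 \<le> eta x"
  by (cases "x = 0") (simp_all add: eta_def mult_le_0_iff)

lemma eta_mult: "0 \<le> x \<Longrightarrow> 0 \<le> y \<Longrightarrow> eta (x * y) = x * eta y + y * eta x"
  by (cases "x = 0 \<or> y = 0") (auto simp: eta_def log_mult algebra_simps)

text \<open>By concavity the graph of \<open>eta\<close> lies below its tangent at y, which is the
  right-hand side. Summed over atoms this linear majorant yields Gibbs' inequality, integrated it
  yields Jensen's.\<close>

lemma eta_le_tangent:
  assumes "0 \<le> x" "0 < y"
  shows "eta x \<le> - x * log 2 y + (y - x) / ln 2"
proof (cases "x = 0")
  case False
  with assms have x: "x > 0" by simp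
  have "ln (y / x) \<le> y / x - 1" using x assms by (intro ln_le_minus_one) simp
  then have "x * (ln y - ln x) \<le> y - x"
    using x assms by (simp add: ln_div field_simps)
  then have "x * (ln y - ln x) / ln 2 \<le> (y - x) / ln 2"
    by (intro divide_right_mono) auto
  then show ?thesis by (simp add: eta_def log_def diff_divide_distrib right_diff_distrib)
qed (use assms in simp)

lemma continuous_on_eta: "continuous_on {0..} eta"
proof -
  have "isCont eta x" if "x > 0" for x
    unfolding eta_def using that by (intro continuous_intros) auto
  moreover have "(eta \<longlongrightarrow> 0) (at_right 0)"
    unfolding eta_def by real_asymp
  ultimately have "(eta \<longlongrightarrow> eta x) (at x within {0..})" if "x \<ge> 0" for x
    using that by (cases "x = 0")
      (auto simp: at_within_Ici_at_right intro: tendsto_within_subset[OF isContD])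
  then show ?thesis by (auto simp: continuous_on_def)
qed

text \<open>Sum of the tangents of \<open>eta\<close> at the points \<open>q a\<close>; the linear
  terms add up to (sum q - sum p) / ln 2, which is not positive. \<open>pq\<close> guards against
  \<open>log 2 0 = 0\<close>, which would make a term on the right vanish where it should be
  infinite.\<close>

lemma gibbs_inequality:
  assumes "finite A" and p: "\<And>a. a \<in> A \<Longrightarrow> 0 \<le> p a" and q: "\<And>a. a \<in> A \<Longrightarrow> 0 \<le> q a"
    and pq: "\<And>a. a \<in> A \<Longrightarrow> q a = 0 \<Longrightarrow> p a = 0" and le: "sum q A \<le> sum p A"
  shows "(\<Sum>a\<in>A. eta (p a)) \<le> (\<Sum>a\<in>A. - p a * log 2 (q a))"
proof -
  have "(\<Sum>a\<in>A. eta (p a)) \<le> (\<Sum>a\<in>A. - p a * log 2 (q a) + (q a - p a) / ln 2)"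
  proof (rule sum_mono)
    fix a assume a: "a \<in> A"
    show "eta (p a) \<le> - p a * log 2 (q a) + (q a - p a) / ln 2"
      using eta_le_tangent[of "p a" "q a"] p[OF a] q[OF a] pq[OF a] by (cases "q a = 0") auto
  qed
  also have "\<dots> = (\<Sum>a\<in>A. - p a * log 2 (q a)) + (sum q A - sum p A) / ln 2"
    by (simp add: sum.distrib sum_subtractf sum_negf diff_divide_distrib sum_divide_distrib)
  also have "(sum q A - sum p A) / ln 2 \<le> 0"
    using le by (simp add: divide_le_0_iff)
  finally show ?thesis by simp
qed

lemma pmf_entropy_eta: "pmf_entropy p = (\<Sum>a\<in>set_pmf p. eta (pmf p a))"
  by (simp add: pmf_entropy_def eta_def)

lemma pmf_entropy_eq_sum:
  assumes "finite A" "set_pmf p \<subseteq> A"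
  shows "pmf_entropy p = (\<Sum>a\<in>A. eta (pmf p a))"
  unfolding pmf_entropy_eta using assms
  by (intro sum.mono_neutral_left) (auto simp: set_pmf_iff)

lemma pmf_entropy_nonneg: "pmf_entropy p \<ge> 0"
  unfolding pmf_entropy_eta by (intro sum_nonneg eta_nonneg) (auto simp: pmf_le_1)

lemma pmf_entropy_le_log_card:
  assumes "finite A" "set_pmf p \<subseteq> A"
  shows "pmf_entropy p \<le> log 2 (card A)"
proof -
  have A: "A \<noteq> {}" using assms set_pmf_not_empty by fast
  have 1: "sum (pmf p) A = 1" using assms by (intro sum_pmf_eq_1)
  have "pmf_entropy p \<le> (\<Sum>a\<in>A. - pmf p a * log 2 (1 / card A))"
    unfolding pmf_entropy_eq_sum[OF assms] using assms(1) A 1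
    by (intro gibbs_inequality) auto
  also have "\<dots> = - sum (pmf p) A * log 2 (1 / card A)"
    by (simp add: sum_negf flip: sum_distrib_right)
  also have "\<dots> = log 2 (card A)"
    using A assms(1) 1 by (simp add: log_divide card_gt_0_iff)
  finally show ?thesis .
qed

lemma pmf_map_eq_sum:
  assumes "finite (set_pmf p)"
  shows "pmf (map_pmf f p) b = (\<Sum>a\<in>{a\<in>set_pmf p. f a = b}. pmf p a)"
proof -
  have "pmf (map_pmf f p) b = measure_pmf.prob p (f -` {b} \<inter> set_pmf p)"
    by (simp add: pmf_map measure_Int_set_pmf)
  also have "\<dots> = (\<Sum>a\<in>f -` {b} \<inter> set_pmf p. pmf p a)"
    using assms by (intro measure_measure_pmf_finite) auto
  finally show ?thesis by (simp add: vimage_def Int_def conj_commute)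
qed

lemma sum_map_pmf:
  fixes \<phi> :: "'b \<Rightarrow> real"
  assumes "finite (set_pmf p)"
  shows "(\<Sum>b\<in>f ` set_pmf p. pmf (map_pmf f p) b * \<phi> b) = (\<Sum>a\<in>set_pmf p. pmf p a * \<phi> (f a))"
proof -
  have "(\<Sum>a\<in>set_pmf p. pmf p a * \<phi> (f a))
      = (\<Sum>b\<in>f ` set_pmf p. \<Sum>a\<in>{a\<in>set_pmf p. f a = b}. pmf p a * \<phi> (f a))"
    using assms by (intro sum.group[symmetric]) auto
  also have "\<dots> = (\<Sum>b\<in>f ` set_pmf p. pmf (map_pmf f p) b * \<phi> b)"
    unfolding pmf_map_eq_sum[OF assms] sum_distrib_right by (intro sum.cong) auto
  finally show ?thesis ..
qed

lemma pmf_entropy_map: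
  assumes "finite (set_pmf p)"
  shows "pmf_entropy (map_pmf f p) = (\<Sum>a\<in>set_pmf p. - pmf p a * log 2 (pmf (map_pmf f p) (f a)))"
  using sum_map_pmf[OF assms, of f "\<lambda>b. - log 2 (pmf (map_pmf f p) b)"]
  by (simp add: pmf_entropy_def)

text \<open>\<open>eta_mult\<close> splits the mass of an atom into the mass of its fibre times its
  conditional mass. Later f is \<open>unlabel\<close>, which prices the labels, or the name of a
  neighbourhood, which glues the local bounds.\<close>

lemma pmf_entropy_chain:
  assumes fin: "finite (set_pmf p)"
  shows "pmf_entropy p = pmf_entropy (map_pmf f p) +
    (\<Sum>b\<in>f ` set_pmf p. pmf (map_pmf f p) b * pmf_entropy (cond_pmf p (f -` {b})))"
proof -
  let ?Q = "map_pmf f p"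
  have cond: "set_pmf (cond_pmf p (f -` {b})) = {a \<in> set_pmf p. f a = b}"
    "a \<in> set_pmf p \<Longrightarrow> f a = b \<Longrightarrow> pmf p a = pmf ?Q b * pmf (cond_pmf p (f -` {b})) a"
    if "b \<in> f ` set_pmf p" for a b
  proof -
    have ne: "set_pmf p \<inter> f -` {b} \<noteq> {}" using that by auto
    show "set_pmf (cond_pmf p (f -` {b})) = {a \<in> set_pmf p. f a = b}"
      using set_cond_pmf[OF ne] by auto
    have "pmf ?Q b > 0" using that by (simp add: pmf_positive_iff)
    then show "a \<in> set_pmf p \<Longrightarrow> f a = b \<Longrightarrow> pmf p a = pmf ?Q b * pmf (cond_pmf p (f -` {b})) a"
      using pmf_cond[OF ne, of a] by (simp add: pmf_map)
  qed
  have "pmf_entropy p = (\<Sum>b\<in>f ` set_pmf p. \<Sum>a\<in>{a\<in>set_pmf p. f a = b}. eta (pmf p a))"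
    unfolding pmf_entropy_eta using fin by (intro sum.group[symmetric]) auto
  also have "\<dots> = (\<Sum>b\<in>f ` set_pmf p. eta (pmf ?Q b) + pmf ?Q b * pmf_entropy (cond_pmf p (f -` {b})))"
  proof (rule sum.cong[OF refl])
    fix b assume b: "b \<in> f ` set_pmf p"
    let ?r = "cond_pmf p (f -` {b})"
    have r1: "sum (pmf ?r) (set_pmf ?r) = 1"
      using fin cond(1)[OF b] by (intro sum_pmf_eq_1) auto
    have "(\<Sum>a\<in>{a\<in>set_pmf p. f a = b}. eta (pmf p a))
        = (\<Sum>a\<in>set_pmf ?r. pmf ?Q b * eta (pmf ?r a) + pmf ?r a * eta (pmf ?Q b))"
      unfolding cond(1)[OF b] using cond(2)[OF b]
      by (intro sum.cong) (auto simp: eta_mult)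
    also have "\<dots> = eta (pmf ?Q b) + pmf ?Q b * pmf_entropy ?r"
      by (simp add: sum.distrib r1 pmf_entropy_eta flip: sum_distrib_left sum_distrib_right)
    finally show "(\<Sum>a\<in>{a\<in>set_pmf p. f a = b}. eta (pmf p a))
        = eta (pmf ?Q b) + pmf ?Q b * pmf_entropy ?r" .
  qed
  also have "\<dots> = pmf_entropy ?Q + (\<Sum>b\<in>f ` set_pmf p. pmf ?Q b * pmf_entropy (cond_pmf p (f -` {b})))"
    by (simp add: sum.distrib pmf_entropy_eta)
  finally show ?thesis .
qed

lemma pmf_entropy_map_le:
  assumes "finite (set_pmf p)"
  shows "pmf_entropy (map_pmf f p) \<le> pmf_entropy p"
  unfolding pmf_entropy_chain[OF assms, of f]
  by (simp add: sum_nonneg pmf_entropy_nonneg)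

section \<open>Submodularity of entropy and Shearer's inequality\<close>

text \<open>Nonnegativity of the mutual information of f and g conditioned on their common function
  h. The quotient F G / (K H) compares the law in which f and g are conditionally independent given
  h with the true joint law K; its mean is at most 1, and ln t \<le> t - 1 finishes.\<close>

lemma pmf_entropy_submodular:
  assumes fin: "finite (set_pmf p)" and h: "\<And>a. h a = h1 (f a)" "\<And>a. h a = h2 (g a)"
  shows "pmf_entropy (map_pmf (\<lambda>a. (f a, g a)) p) + pmf_entropy (map_pmf h p)
       \<le> pmf_entropy (map_pmf f p) + pmf_entropy (map_pmf g p)"
proof -
  let ?A = "set_pmf p"
  let ?k = "\<lambda>a. (f a, g a)"
  define F where "F = pmf (map_pmf f p)"
  define G where "G = pmf (map_pmf g p)"
  define H where "H = pmf (map_pmf h p)"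
  define K where "K = pmf (map_pmf ?k p)"
  have pos: "F (f a) > 0" "G (g a) > 0" "H (h a) > 0" "K (?k a) > 0" if "a \<in> ?A" for a
    using that by (auto simp: F_def G_def H_def K_def pmf_positive_iff)
  have g_marg: "(\<Sum>y\<in>{y\<in>g ` ?A. h2 y = z}. G y) = H z" for z
  proof -
    have "H z = pmf (map_pmf h2 (map_pmf g p)) z"
      unfolding H_def map_pmf_comp by (simp flip: h(2))
    also have "\<dots> = (\<Sum>y\<in>{y\<in>g ` ?A. h2 y = z}. G y)"
      using fin by (subst pmf_map_eq_sum) (auto simp: G_def)
    finally show ?thesis ..
  qed
  have "(\<Sum>a\<in>?A. pmf p a * (F (f a) * G (g a) / (K (?k a) * H (h a))))
      = (\<Sum>b\<in>?k ` ?A. K b * (F (fst b) * G (snd b) / (K b * H (h1 (fst b)))))"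
    unfolding K_def by (subst sum_map_pmf[OF fin]) (simp add: h(1))
  also have "\<dots> = (\<Sum>b\<in>?k ` ?A. F (fst b) * (G (snd b) / H (h1 (fst b))))"
    using pos(4) by (intro sum.cong) force+
  \<comment> \<open>K has cancelled, so the sum may be extended from the joint support to all pairs
    that agree on h; there \<open>g_marg\<close> sums out G.\<close>
  also have "\<dots> \<le> (\<Sum>b\<in>Sigma (f ` ?A) (\<lambda>x. {y\<in>g ` ?A. h2 y = h1 x}). F (fst b) * (G (snd b) / H (h1 (fst b))))"
    using fin h(1) h(2) by (intro sum_mono2) (auto simp: F_def G_def H_def)
  also have "\<dots> = (\<Sum>x\<in>f ` ?A. \<Sum>y\<in>{y\<in>g ` ?A. h2 y = h1 x}. F x * (G y / H (h1 x)))"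
    using fin by (subst sum.Sigma) (auto simp: case_prod_beta)
  also have "\<dots> = (\<Sum>x\<in>f ` ?A. F x)"
  proof (rule sum.cong[OF refl])
    fix x assume "x \<in> f ` ?A"
    then have "H (h1 x) > 0" using pos(3) h(1) by auto
    then show "(\<Sum>y\<in>{y\<in>g ` ?A. h2 y = h1 x}. F x * (G y / H (h1 x))) = F x"
      by (simp add: g_marg flip: sum_distrib_left sum_divide_distrib)
  qed
  also have "\<dots> = 1" using fin unfolding F_def by (intro sum_pmf_eq_1) auto
  finally have le1: "(\<Sum>a\<in>?A. pmf p a * (F (f a) * G (g a) / (K (?k a) * H (h a)))) \<le> 1" .
  have "(\<Sum>a\<in>?A. pmf p a * (ln (F (f a)) + ln (G (g a)) - ln (K (?k a)) - ln (H (h a))))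
      \<le> (\<Sum>a\<in>?A. pmf p a * (F (f a) * G (g a) / (K (?k a) * H (h a)) - 1))"
  proof (intro sum_mono mult_left_mono)
    fix a assume a: "a \<in> ?A"
    have "ln (F (f a)) + ln (G (g a)) - ln (K (?k a)) - ln (H (h a))
        = ln (F (f a) * G (g a) / (K (?k a) * H (h a)))"
      using pos[OF a] by (simp add: ln_div ln_mult)
    also have "\<dots> \<le> F (f a) * G (g a) / (K (?k a) * H (h a)) - 1"
      using pos[OF a] by (intro ln_le_minus_one) simp
    finally show "ln (F (f a)) + ln (G (g a)) - ln (K (?k a)) - ln (H (h a))
      \<le> F (f a) * G (g a) / (K (?k a) * H (h a)) - 1" .
  qed simp
  also have "\<dots> \<le> 0"
    using le1 sum_pmf_eq_1[OF fin order_refl] by (simp add: right_diff_distrib sum_subtractf)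
  finally have "(\<Sum>a\<in>?A. pmf p a * (ln (F (f a)) + ln (G (g a)) - ln (K (?k a)) - ln (H (h a)))) / ln 2 \<le> 0"
    by (simp add: divide_le_0_iff)
  also have "(\<Sum>a\<in>?A. pmf p a * (ln (F (f a)) + ln (G (g a)) - ln (K (?k a)) - ln (H (h a)))) / ln 2
     = pmf_entropy (map_pmf ?k p) + pmf_entropy (map_pmf h p) - pmf_entropy (map_pmf f p) - pmf_entropy (map_pmf g p)"
    unfolding pmf_entropy_map[OF fin] F_def[symmetric] G_def[symmetric] H_def[symmetric] K_def[symmetric]
    by (simp add: sum_divide_distrib log_def flip: sum.distrib sum_subtractf)
       (intro sum.cong refl, simp add: field_simps)
  finally show ?thesis by simp
qed

text \<open>The trace on the union is a function of the two traces, and the trace on the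
  intersection is a function of each of them.\<close>

lemma pmf_entropy_restrict_submodular:
  assumes "finite (set_pmf p)"
  shows "pmf_entropy (map_pmf (\<lambda>E. E \<inter> (S \<union> T)) p) + pmf_entropy (map_pmf (\<lambda>E. E \<inter> (S \<inter> T)) p)
       \<le> pmf_entropy (map_pmf (\<lambda>E. E \<inter> S) p) + pmf_entropy (map_pmf (\<lambda>E. E \<inter> T) p)"
proof -
  have "map_pmf (\<lambda>E. E \<inter> (S \<union> T)) p = map_pmf (\<lambda>(X, Y). X \<union> Y) (map_pmf (\<lambda>E. (E \<inter> S, E \<inter> T)) p)"
    by (simp add: map_pmf_comp Int_Un_distrib)
  then have "pmf_entropy (map_pmf (\<lambda>E. E \<inter> (S \<union> T)) p) \<le> pmf_entropy (map_pmf (\<lambda>E. (E \<inter> S, E \<inter> T)) p)"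
    using assms by (simp add: pmf_entropy_map_le)
  moreover have "pmf_entropy (map_pmf (\<lambda>E. (E \<inter> S, E \<inter> T)) p) + pmf_entropy (map_pmf (\<lambda>E. E \<inter> (S \<inter> T)) p)
       \<le> pmf_entropy (map_pmf (\<lambda>E. E \<inter> S) p) + pmf_entropy (map_pmf (\<lambda>E. E \<inter> T) p)"
    using assms by (rule pmf_entropy_submodular[where ?h1.0 = "\<lambda>X. X \<inter> T" and ?h2.0 = "\<lambda>Y. Y \<inter> S"]) auto
  ultimately show ?thesis by linarith
qed

text \<open>Induction adding one element e to Q: submodularity for
  \<open>B i \<inter> insert e Q\<close> and \<open>Q\<close> says that e adds at least as much to
  the trace on \<open>B i\<close> as to Q, and exactly r of the sets contain e.\<close>

lemma shearer_submodular:
  fixes f :: "'a set \<Rightarrow> real"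
  assumes "finite Q" "finite I" and f0: "f {} = 0"
    and sub: "\<And>S T. f (S \<union> T) + f (S \<inter> T) \<le> f S + f T"
    and cover: "\<And>e. e \<in> Q \<Longrightarrow> card {i\<in>I. e \<in> B i} = r"
  shows "real r * f Q \<le> (\<Sum>i\<in>I. f (B i \<inter> Q))"
  using assms(1) cover
proof (induction Q rule: finite_induct)
  case (insert e Q)
  have "f (B i \<inter> Q) + (if e \<in> B i then f (insert e Q) - f Q else 0) \<le> f (B i \<inter> insert e Q)" for i
  proof (cases "e \<in> B i")
    case True
    then have "(B i \<inter> insert e Q) \<union> Q = insert e Q" "(B i \<inter> insert e Q) \<inter> Q = B i \<inter> Q"
      using insert(2) by auto
    then show ?thesis using sub[of "B i \<inter> insert e Q" Q] True by simp
  qed simp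
  then have "(\<Sum>i\<in>I. f (B i \<inter> Q)) + (\<Sum>i\<in>I. if e \<in> B i then f (insert e Q) - f Q else 0)
      \<le> (\<Sum>i\<in>I. f (B i \<inter> insert e Q))"
    by (simp add: sum_mono flip: sum.distrib)
  moreover have "(\<Sum>i\<in>I. if e \<in> B i then f (insert e Q) - f Q else 0) = real r * (f (insert e Q) - f Q)"
    using insert.prems[of e] \<open>finite I\<close> by (simp add: sum.If_cases Int_def)
  moreover have "real r * f Q \<le> (\<Sum>i\<in>I. f (B i \<inter> Q))" using insert by simp
  ultimately show ?case by (simp add: algebra_simps)
qed (simp add: f0)

lemma pmf_entropy_shearer:
  fixes p :: "'a set pmf"
  assumes "finite Q" "set_pmf p \<subseteq> Pow Q" "finite I"
    and "\<And>e. e \<in> Q \<Longrightarrow> card {i\<in>I. e \<in> B i} = r"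
  shows "real r * pmf_entropy p \<le> (\<Sum>i\<in>I. pmf_entropy (map_pmf (\<lambda>E. E \<inter> B i) p))"
proof -
  have fin: "finite (set_pmf p)" using assms(1,2) finite_subset by blast
  let ?f = "\<lambda>S. pmf_entropy (map_pmf (\<lambda>E. E \<inter> S) p)"
  have *: "map_pmf (\<lambda>E. E \<inter> S) p = map_pmf (\<lambda>E. E \<inter> (S \<inter> Q)) p" for S
    using assms(2) by (intro map_pmf_cong) auto
  have "map_pmf (\<lambda>E. E \<inter> Q) p = map_pmf id p"
    using assms(2) by (intro map_pmf_cong) auto
  then have "?f Q = pmf_entropy p" by simp
  moreover have "real r * ?f Q \<le> (\<Sum>i\<in>I. ?f (B i \<inter> Q))"
    using assms(1,3,4)
    by (intro shearer_submodular pmf_entropy_restrict_submodular[OF fin]) (auto simp: pmf_entropy_eta)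
  ultimately show ?thesis unfolding *[symmetric] by simp
qed

section \<open>Sampling induced subgraphs\<close>

text \<open>Increasing pairs stand for unordered ones. Labelled graphs of order k are then exactly
  the subsets of \<open>pairs_on {1..k}\<close>, the form in which Shearer's inequality and product
  formulas apply to them.\<close>

definition pairs_on :: "nat set \<Rightarrow> (nat \<times> nat) set" where
  "pairs_on A = {(u, v). u \<in> A \<and> v \<in> A \<and> u < v}"

definition edge_pairs :: "graph \<Rightarrow> (nat \<times> nat) set" where
  "edge_pairs H = {(u, v) \<in> pairs_on (verts H). adj H u v}"

lemma finite_pairs_on [simp]: "finite A \<Longrightarrow> finite (pairs_on A)"
  unfolding pairs_on_def by (rule finite_subset[of _ "A \<times> A"]) auto

lemma card_pairs_on:
  assumes "finite A" shows "card (pairs_on A) = card A choose 2"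
proof -
  have "bij_betw (\<lambda>(u, v). {u, v}) (pairs_on A) {B. B \<subseteq> A \<and> card B = 2}"
  proof (rule bij_betwI')
    fix x y assume "x \<in> pairs_on A" "y \<in> pairs_on A"
    then show "((case x of (u, v) \<Rightarrow> {u, v}) = (case y of (u, v) \<Rightarrow> {u, v})) = (x = y)"
      by (cases x; cases y) (force simp: pairs_on_def doubleton_eq_iff)
  next
    fix x assume "x \<in> pairs_on A"
    then show "(case x of (u, v) \<Rightarrow> {u, v}) \<in> {B. B \<subseteq> A \<and> card B = 2}"
      by (auto simp: pairs_on_def)
  next
    fix y assume "y \<in> {B. B \<subseteq> A \<and> card B = 2}"
    then obtain u v where "y = {u, v}" "u \<noteq> v" "u \<in> A" "v \<in> A" by (auto simp: card_2_iff)
    then have "(min u v, max u v) \<in> pairs_on A" "y = (case (min u v, max u v) of (u, v) \<Rightarrow> {u, v})"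
      by (auto simp: pairs_on_def min_def max_def)
    then show "\<exists>x\<in>pairs_on A. y = (case x of (u, v) \<Rightarrow> {u, v})" by (rule bexI[rotated])
  qed
  then show ?thesis using n_subsets[OF assms, of 2] bij_betw_same_card by fastforce
qed

lemma adj_commute: "adj G u v \<longleftrightarrow> adj G v u"
  by (simp add: adj_def insert_commute)

lemma edge_pairs_inj:
  assumes "graph_order G = graph_order H" "edge_pairs G = edge_pairs H"
  shows "G = H"
proof -
  have "edges G \<subseteq> edges H" if "graph_order G = graph_order H" "edge_pairs G = edge_pairs H" for G H
  proof
    fix e assume e: "e \<in> edges G"
    then obtain a b where ab: "e = {a, b}" "a \<in> verts G" "b \<in> verts G" "a \<noteq> b"
      using edges_subset[of G] by blast
    define u v where "u = min a b" and "v = max a b"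
    have uv: "e = {u, v}" "u \<in> verts G" "v \<in> verts G" "u < v"
      using ab by (auto simp: u_def v_def min_def max_def)
    then have "(u, v) \<in> edge_pairs H"
      using e that(2)[symmetric] by (auto simp: edge_pairs_def pairs_on_def adj_def)
    then show "e \<in> edges H" using uv by (auto simp: edge_pairs_def adj_def)
  qed
  from this[of G H] this[of H G] show ?thesis using assms graph_eqI by simp
qed

lemma bij_betw_edge_pairs:
  assumes "k \<ge> 1"
  shows "bij_betw edge_pairs (labelled_graphs k) (Pow (pairs_on {1..k}))"
  unfolding bij_betw_def
proof (intro conjI equalityI subsetI)
  show "inj_on edge_pairs (labelled_graphs k)"
    by (auto simp: inj_on_def labelled_graphs_def intro: edge_pairs_inj)
next
  fix E assume "E \<in> edge_pairs ` labelled_graphs k"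
  then show "E \<in> Pow (pairs_on {1..k})"
    by (auto simp: edge_pairs_def verts_def labelled_graphs_def)
next
  fix E assume E: "E \<in> Pow (pairs_on {1..k})"
  define H where "H = Abs_graph (k, (\<lambda>(u, v). {u, v}) ` E)"
  have "Rep_graph H = (k, (\<lambda>(u, v). {u, v}) ` E)"
    unfolding H_def
  proof (rule Abs_graph_inverse)
    have "(\<lambda>(u, v). {u, v}) ` E \<subseteq> {{u, v} |u v. u \<in> {1..k} \<and> v \<in> {1..k} \<and> u \<noteq> v}"
    proof safe
      fix u v assume "(u, v) \<in> E"
      then have "u \<in> {1..k} \<and> v \<in> {1..k} \<and> u \<noteq> v" using E by (auto simp: pairs_on_def)
      then show "\<exists>u' v'. {u, v} = {u', v'} \<and> u' \<in> {1..k} \<and> v' \<in> {1..k} \<and> u' \<noteq> v'" by blast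
    qed
    then show "(k, (\<lambda>(u, v). {u, v}) ` E) \<in> {(n, E). 1 \<le> n \<and>
        E \<subseteq> {{u, v} |u v. u \<in> {1..n} \<and> v \<in> {1..n} \<and> u \<noteq> v}}"
      using assms by blast
  qed
  then have H: "graph_order H = k" "edges H = (\<lambda>(u, v). {u, v}) ` E"
    by (simp_all add: graph_order.rep_eq edges.rep_eq)
  have "edge_pairs H = E"
  proof (intro equalityI subsetI)
    fix e assume "e \<in> edge_pairs H"
    then obtain u v a b where "e = (u, v)" "u < v" "{u, v} = {a, b}" "(a, b) \<in> E"
      by (auto simp: edge_pairs_def adj_def H pairs_on_def)
    moreover have "a < b" using \<open>(a, b) \<in> E\<close> E by (auto simp: pairs_on_def)
    ultimately show "e \<in> E" by (auto simp: doubleton_eq_iff)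
  next
    fix e assume "e \<in> E"
    then show "e \<in> edge_pairs H"
      using E by (cases e) (auto simp: edge_pairs_def adj_def verts_def H)
  qed
  then show "E \<in> edge_pairs ` labelled_graphs k"
    using H by (auto simp: labelled_graphs_def)
qed

lemma finite_labelled_graphs: "finite (labelled_graphs k)"
proof (cases "k \<ge> 1")
  case True
  then show ?thesis using bij_betw_finite[OF bij_betw_edge_pairs] by simp
next
  case False
  then have "labelled_graphs k = {}"
    using graph_order_pos by (auto simp: labelled_graphs_def)
  then show ?thesis by simp
qed

lemma abs_rep_ugraph [simp]: "abs_ugraph (rep_ugraph g) = g"
  by (rule Quotient3_abs_rep[OF Quotient3_ugraph])

lemma finite_unlabelled_graphs: "finite (unlabelled_graphs n)"
proof (rule finite_subset)
  show "unlabelled_graphs n \<subseteq> abs_ugraph ` labelled_graphs n"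
  proof
    fix g assume "g \<in> unlabelled_graphs n"
    then have "rep_ugraph g \<in> labelled_graphs n"
      by (simp add: unlabelled_graphs_def labelled_graphs_def ugraph_order.rep_eq)
    then show "g \<in> abs_ugraph ` labelled_graphs n" by (metis abs_rep_ugraph imageI)
  qed
qed (simp add: finite_labelled_graphs)

section \<open>Uniform injections and the induced subgraph on k random vertices\<close>

definition injs :: "nat \<Rightarrow> nat set \<Rightarrow> (nat \<Rightarrow> nat) set" where
  "injs k A = {\<phi> \<in> {1..k} \<rightarrow>\<^sub>E A. inj_on \<phi> {1..k}}"

lemma injections_eq_injs: "injections H G = injs (graph_order H) (verts G)"
  by (simp add: injections_def injs_def verts_def)

lemma finite_injs: "finite A \<Longrightarrow> finite (injs k A)"
  unfolding injs_def by (rule finite_subset[OF _ finite_PiE[of "{1..k}" "\<lambda>_. A"]]) auto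

lemma injs_nonempty: "k \<le> n \<Longrightarrow> injs k {1..n} \<noteq> {}"
proof -
  assume "k \<le> n"
  then have "restrict id {1..k} \<in> injs k {1..n}" by (auto simp: injs_def inj_on_def)
  then show ?thesis by blast
qed

definition pullback :: "nat \<Rightarrow> (nat \<Rightarrow> nat) \<Rightarrow> graph \<Rightarrow> (nat \<times> nat) set" where
  "pullback k \<phi> G = {(u, v) \<in> pairs_on {1..k}. adj G (\<phi> u) (\<phi> v)}"

lemma induced_maps_iff_pullback:
  "\<phi> \<in> induced_maps H G \<longleftrightarrow> pullback (graph_order H) \<phi> G = edge_pairs H"
proof
  assume "\<phi> \<in> induced_maps H G"
  then show "pullback (graph_order H) \<phi> G = edge_pairs H"
    by (auto simp: induced_maps_def pullback_def edge_pairs_def pairs_on_def verts_def)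
next
  assume eq: "pullback (graph_order H) \<phi> G = edge_pairs H"
  have lt: "adj H u v \<longleftrightarrow> adj G (\<phi> u) (\<phi> v)" if "u \<in> verts H" "v \<in> verts H" "u < v" for u v
  proof -
    have "(u, v) \<in> pullback (graph_order H) \<phi> G \<longleftrightarrow> (u, v) \<in> edge_pairs H" using eq by simp
    then show ?thesis using that by (simp add: pullback_def edge_pairs_def pairs_on_def verts_def)
  qed
  have "adj H u v \<longleftrightarrow> adj G (\<phi> u) (\<phi> v)" if "u \<in> verts H" "v \<in> verts H" "u \<noteq> v" for u v
    using that lt[of u v] lt[of v u] adj_commute by (metis nat_neq_iff)
  then show "\<phi> \<in> induced_maps H G" by (auto simp: induced_maps_def)
qed

text \<open>\<open>rep_ugraph\<close> picks some labelling of the graph drawn from R; the uniform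
  injection makes the resulting law independent of that choice. The outcome is kept as an edge set
  so that its traces are again of the same type.\<close>

definition sampled :: "nat \<Rightarrow> ugraph pmf \<Rightarrow> (nat \<times> nat) set pmf" where
  "sampled k R = bind_pmf (map_pmf rep_ugraph R)
     (\<lambda>G. map_pmf (\<lambda>\<phi>. pullback k \<phi> G) (pmf_of_set (injs k (verts G))))"

lemma set_sampled: "set_pmf (sampled k R) \<subseteq> Pow (pairs_on {1..k})"
  by (auto simp: sampled_def pullback_def)

lemma finite_set_sampled [simp]: "finite (set_pmf (sampled k R))"
  using finite_subset[OF set_sampled] by simp

lemma pmf_sampled:
  assumes R: "set_pmf R \<subseteq> unlabelled_graphs n" and k: "graph_order H \<le> n"
  shows "pmf (sampled (graph_order H) R) (edge_pairs H)
    = measure_pmf.expectation R (\<lambda>g. ugraph_density H g)"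
proof -
  let ?k = "graph_order H"
  have "pmf (sampled ?k R) (edge_pairs H) = measure_pmf.expectation R (\<lambda>g.
     pmf (map_pmf (\<lambda>\<phi>. pullback ?k \<phi> (rep_ugraph g)) (pmf_of_set (injs ?k (verts (rep_ugraph g))))) (edge_pairs H))"
    by (simp add: sampled_def pmf_bind)
  also have "\<dots> = measure_pmf.expectation R (\<lambda>g. ugraph_density H g)"
  proof (intro integral_cong_AE)
    show "AE g in measure_pmf R. pmf (map_pmf (\<lambda>\<phi>. pullback ?k \<phi> (rep_ugraph g))
        (pmf_of_set (injs ?k (verts (rep_ugraph g))))) (edge_pairs H) = ugraph_density H g"
    proof (rule AE_pmfI)
      fix g assume "g \<in> set_pmf R"
      then have "graph_order (rep_ugraph g) = n"
        using R by (auto simp: unlabelled_graphs_def ugraph_order.rep_eq)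
      moreover have "(\<lambda>\<phi>. pullback ?k \<phi> (rep_ugraph g)) -` {edge_pairs H} = induced_maps H (rep_ugraph g)"
        by (intro set_eqI) (simp add: induced_maps_iff_pullback)
      ultimately show "pmf (map_pmf (\<lambda>\<phi>. pullback ?k \<phi> (rep_ugraph g))
        (pmf_of_set (injs ?k (verts (rep_ugraph g))))) (edge_pairs H) = ugraph_density H g"
        using k by (simp add: pmf_map ugraph_density.rep_eq graph_density_def injections_eq_injs)
    qed
  qed auto
  finally show ?thesis .
qed

text \<open>Permutations of A act transitively on the injections into A, because the complements of
  two images have the same size. This symmetry is the source of uniformity below.\<close>

lemma extend_injs_to_bij:
  assumes "finite A" "\<psi> \<in> injs k A" "\<psi>' \<in> injs k A"
  obtains \<pi> where "bij_betw \<pi> A A" "\<And>i. i \<in> {1..k} \<Longrightarrow> \<pi> (\<psi> i) = \<psi>' i"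
proof -
  let ?I = "{1..k}"
  have inj: "inj_on \<psi> ?I" "inj_on \<psi>' ?I" and sub: "\<psi> ` ?I \<subseteq> A" "\<psi>' ` ?I \<subseteq> A"
    using assms by (auto simp: injs_def)
  have b1: "bij_betw (\<psi>' \<circ> inv_into ?I \<psi>) (\<psi> ` ?I) (\<psi>' ` ?I)"
    using inj by (intro bij_betw_trans[OF bij_betw_inv_into]) (auto simp: bij_betw_def)
  have "card (A - \<psi> ` ?I) = card (A - \<psi>' ` ?I)"
    using assms(1) sub inj by (simp add: card_Diff_subset card_image)
  then obtain h where h: "bij_betw h (A - \<psi> ` ?I) (A - \<psi>' ` ?I)"
    using finite_same_card_bij assms(1) by (metis finite_Diff)
  define \<pi> where "\<pi> x = (if x \<in> \<psi> ` ?I then (\<psi>' \<circ> inv_into ?I \<psi>) x else h x)" for x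
  have "bij_betw \<pi> (\<psi> ` ?I) (\<psi>' ` ?I)"
    using b1 by (rule bij_betw_cong[THEN iffD1, rotated]) (simp add: \<pi>_def)
  moreover have "bij_betw \<pi> (A - \<psi> ` ?I) (A - \<psi>' ` ?I)"
    using h by (rule bij_betw_cong[THEN iffD1, rotated]) (simp add: \<pi>_def)
  ultimately have "bij_betw \<pi> (\<psi> ` ?I \<union> (A - \<psi> ` ?I)) (\<psi>' ` ?I \<union> (A - \<psi>' ` ?I))"
    by (rule bij_betw_combine) auto
  moreover have "\<psi> ` ?I \<union> (A - \<psi> ` ?I) = A" "\<psi>' ` ?I \<union> (A - \<psi>' ` ?I) = A"
    using sub by auto
  ultimately have "bij_betw \<pi> A A" by metis
  moreover have "\<pi> (\<psi> i) = \<psi>' i" if "i \<in> ?I" for i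
    using that inj by (simp add: \<pi>_def)
  ultimately show ?thesis using that by blast
qed

lemma pmf_eq_pmf_of_setI:
  assumes "finite T" "set_pmf q \<subseteq> T" and const: "\<And>x y. x \<in> T \<Longrightarrow> y \<in> T \<Longrightarrow> pmf q x \<le> pmf q y"
  shows "q = pmf_of_set T"
proof -
  have T: "T \<noteq> {}" using assms(2) set_pmf_not_empty by fast
  then obtain x0 where x0: "x0 \<in> T" by blast
  have eq: "pmf q x = pmf q x0" if "x \<in> T" for x
    using const that x0 by (meson order_antisym)
  have "1 = sum (pmf q) T" using assms by (simp add: sum_pmf_eq_1)
  also have "\<dots> = card T * pmf q x0" using eq by simp
  finally have "pmf q x0 = 1 / card T"
    using T assms(1) by (simp add: field_simps)
  then show ?thesis
    using eq T assms by (intro pmf_eqI) (auto simp: indicator_def set_pmf_iff subset_iff)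
qed

text \<open>A permutation that carries \<psi> to \<psi>' maps the injections restricting to \<psi>
  injectively to those restricting to \<psi>', so all fibres have equal size.\<close>

lemma restrict_uniform_injs:
  assumes j: "j \<in> injs k {1..n}"
  shows "map_pmf (\<lambda>\<phi>. restrict (\<phi> \<circ> j) {1..k}) (pmf_of_set (injs n {1..n})) = pmf_of_set (injs k {1..n})"
proof -
  let ?S = "injs n {1..n}" and ?F = "\<lambda>\<phi>. restrict (\<phi> \<circ> j) {1..k}"
  have S: "finite ?S" "?S \<noteq> {}" by (simp_all add: finite_injs injs_nonempty del: One_nat_def)
  have jj: "j ` {1..k} \<subseteq> {1..n}" "inj_on j {1..k}" using j by (auto simp: injs_def)
  show ?thesis
  proof (rule pmf_eq_pmf_of_setI)
    show "set_pmf (map_pmf ?F (pmf_of_set ?S)) \<subseteq> injs k {1..n}"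
    proof -
      have "?F \<phi> \<in> injs k {1..n}" if "\<phi> \<in> ?S" for \<phi>
      proof -
        have "inj_on (\<phi> \<circ> j) {1..k}"
          using jj inj_on_subset[of \<phi> "{1..n}" "j ` {1..k}"] that by (intro comp_inj_on) (simp_all add: injs_def)
        moreover have "\<phi> (j i) \<in> {1..n}" if "i \<in> {1..k}" for i
          using that \<open>\<phi> \<in> ?S\<close> jj unfolding injs_def by blast
        ultimately show ?thesis by (simp add: injs_def inj_on_restrict_eq)
      qed
      then show ?thesis using S by auto
    qed
    fix \<psi> \<psi>' assume "\<psi> \<in> injs k {1..n}" "\<psi>' \<in> injs k {1..n}"
    then obtain \<pi> where \<pi>: "bij_betw \<pi> {1..n} {1..n}" "\<And>i. i \<in> {1..k} \<Longrightarrow> \<pi> (\<psi> i) = \<psi>' i"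
      using extend_injs_to_bij[of "{1..n}"] by blast
    let ?P = "\<lambda>\<phi>. restrict (\<pi> \<circ> \<phi>) {1..n}"
    have inj\<pi>: "inj_on \<pi> {1..n}" using \<pi> by (simp add: bij_betw_def)
    have ran: "\<phi> i \<in> {1..n}" if "\<phi> \<in> ?S" "i \<in> {1..n}" for \<phi> i
      using that unfolding injs_def by blast
    have "card (?S \<inter> ?F -` {\<psi>}) \<le> card (?S \<inter> ?F -` {\<psi>'})"
    proof (rule card_inj_on_le[of ?P])
      show "inj_on ?P (?S \<inter> ?F -` {\<psi>})"
      proof (rule inj_onI)
        fix x y assume xy: "x \<in> ?S \<inter> ?F -` {\<psi>}" "y \<in> ?S \<inter> ?F -` {\<psi>}" "?P x = ?P y"
        show "x = y"
        proof (rule PiE_ext[of _ "{1..n}" "\<lambda>_. {1..n}"])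
          show "x \<in> {1..n} \<rightarrow>\<^sub>E {1..n}" "y \<in> {1..n} \<rightarrow>\<^sub>E {1..n}" using xy by (auto simp: injs_def)
          fix i assume i: "i \<in> {1..n}"
          have "\<pi> (x i) = \<pi> (y i)" using fun_cong[OF xy(3), of i] i by simp
          then show "x i = y i" using inj_onD[OF inj\<pi>] ran xy i by blast
        qed
      qed
      show "?P ` (?S \<inter> ?F -` {\<psi>}) \<subseteq> ?S \<inter> ?F -` {\<psi>'}"
      proof (rule image_subsetI)
        fix \<phi> assume "\<phi> \<in> ?S \<inter> ?F -` {\<psi>}"
        then have \<phi>: "\<phi> \<in> ?S" "?F \<phi> = \<psi>" by auto
        have "inj_on (\<pi> \<circ> \<phi>) {1..n}"
          using \<phi>(1) ran[OF \<phi>(1)] inj_on_subset[OF inj\<pi>, of "\<phi> ` {1..n}"]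
          by (intro comp_inj_on) (simp_all add: injs_def image_subset_iff del: atLeastAtMost_iff)
        moreover have "\<pi> (\<phi> i) \<in> {1..n}" if "i \<in> {1..n}" for i
          using bij_betw_apply[OF \<pi>(1)] ran[OF \<phi>(1) that] by blast
        ultimately have "?P \<phi> \<in> ?S" by (simp add: injs_def inj_on_restrict_eq)
        moreover have "?F (?P \<phi>) = \<psi>'"
        proof
          fix i
          show "?F (?P \<phi>) i = \<psi>' i"
          proof (cases "i \<in> {1..k}")
            case True
            then have "j i \<in> {1..n}" using jj by blast
            then show ?thesis using True \<pi>(2)[OF True] fun_cong[OF \<phi>(2), of i] by simp
          next
            case False
            have "\<psi>' \<in> {1..k} \<rightarrow>\<^sub>E {1..n}" using \<open>\<psi>' \<in> _\<close> by (simp add: injs_def)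
            then have "\<psi>' i = undefined" using False by (rule PiE_arb)
            then show ?thesis using False by (simp only: restrict_apply if_False)
          qed
        qed
        ultimately show "?P \<phi> \<in> ?S \<inter> ?F -` {\<psi>'}" by simp
      qed
    qed (use S in auto)
    then show "pmf (map_pmf ?F (pmf_of_set ?S)) \<psi> \<le> pmf (map_pmf ?F (pmf_of_set ?S)) \<psi>'"
      using S by (simp add: pmf_map measure_pmf_of_set divide_right_mono)
  qed (simp add: finite_injs)
qed

text \<open>Seen through the increasing enumeration j of A, the trace on A of the n-vertex sample is
  a relabelled k-vertex sample, since a uniform injection composed with j is uniform.\<close>

lemma pmf_entropy_sampled_restrict:
  assumes R: "set_pmf R \<subseteq> unlabelled_graphs n" and A: "A \<subseteq> {1..n}" "card A = k"
  shows "pmf_entropy (map_pmf (\<lambda>E. E \<inter> pairs_on A) (sampled n R)) \<le> pmf_entropy (sampled k R)"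
proof -
  have finA: "finite A" using A finite_subset by blast
  define xs where "xs = sorted_list_of_set A"
  have xs: "sorted_wrt (<) xs" "set xs = A" "length xs = k" "distinct xs"
    using finA A(2) by (auto simp: xs_def)
  \<comment> \<open>Vertices start at 1 and list positions at 0. Since j increases, it keeps the
    order within pairs, so \<open>J\<close> turns pairs u < v into such pairs again.\<close>
  define j where "j = restrict (\<lambda>i. xs ! (i - 1)) {1..k}"
  have mono: "j u < j v" if "u \<in> {1..k}" "v \<in> {1..k}" "u < v" for u v
    using that xs sorted_wrt_nth_less[OF xs(1), of "u - 1" "v - 1"] by (auto simp: j_def)
  have im: "j ` {1..k} = A"
  proof -
    have "j ` {1..k} = (!) xs ` {..<k}"
    proof (intro equalityI subsetI)
      fix x assume "x \<in> j ` {1..k}"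
      then show "x \<in> (!) xs ` {..<k}" by (auto simp: j_def)
    next
      fix x assume "x \<in> (!) xs ` {..<k}"
      then obtain i where "i < k" "x = xs ! i" by auto
      then show "x \<in> j ` {1..k}" by (auto simp: j_def intro!: image_eqI[of _ _ "Suc i"])
    qed
    then show ?thesis using xs by (auto simp: set_conv_nth)
  qed
  have inj: "inj_on j {1..k}" using mono by (metis inj_onI nat_neq_iff less_irrefl)
  then have j: "j \<in> injs k {1..n}" using im A by (auto simp: injs_def j_def)
  define J where "J = (\<lambda>E. (\<lambda>(u, v). (j u, j v)) ` E)"
  have pb: "pullback n \<phi> G \<inter> pairs_on A = J (pullback k (restrict (\<phi> \<circ> j) {1..k}) G)" for \<phi> G
  proof (intro equalityI subsetI)
    fix e assume e: "e \<in> pullback n \<phi> G \<inter> pairs_on A"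
    obtain a b where ab: "e = (a, b)" by (cases e)
    then have "a \<in> A" "b \<in> A" "a < b" "adj G (\<phi> a) (\<phi> b)"
      using e by (auto simp: pullback_def pairs_on_def)
    moreover obtain u v where uv: "u \<in> {1..k}" "v \<in> {1..k}" "a = j u" "b = j v"
      using \<open>a \<in> A\<close> \<open>b \<in> A\<close> im by blast
    moreover have "u < v" using mono[of v u] uv \<open>a < b\<close>
      by (metis less_asym less_irrefl nat_neq_iff)
    ultimately have "(u, v) \<in> pullback k (restrict (\<phi> \<circ> j) {1..k}) G"
      by (auto simp: pullback_def pairs_on_def)
    then show "e \<in> J (pullback k (restrict (\<phi> \<circ> j) {1..k}) G)"
      using ab uv by (force simp: J_def)
  next
    fix e assume "e \<in> J (pullback k (restrict (\<phi> \<circ> j) {1..k}) G)"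
    then obtain u v where uv: "e = (j u, j v)" "u \<in> {1..k}" "v \<in> {1..k}" "u < v" "adj G (\<phi> (j u)) (\<phi> (j v))"
      by (auto simp: J_def pullback_def pairs_on_def)
    moreover have "j u \<in> A" "j v \<in> A" using im uv by auto
    ultimately show "e \<in> pullback n \<phi> G \<inter> pairs_on A"
      using mono A by (auto simp: pullback_def pairs_on_def)
  qed
  have "map_pmf (\<lambda>E. E \<inter> pairs_on A) (sampled n R) = map_pmf J (sampled k R)"
    unfolding sampled_def map_bind_pmf
  proof (rule bind_pmf_cong[OF refl])
    fix G assume "G \<in> set_pmf (map_pmf rep_ugraph R)"
    then have V: "verts G = {1..n}"
      using R by (auto simp: unlabelled_graphs_def ugraph_order.rep_eq verts_def)
    show "map_pmf (\<lambda>E. E \<inter> pairs_on A) (map_pmf (\<lambda>\<phi>. pullback n \<phi> G) (pmf_of_set (injs n (verts G)))) =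
      map_pmf J (map_pmf (\<lambda>\<phi>. pullback k \<phi> G) (pmf_of_set (injs k (verts G))))"
      unfolding V restrict_uniform_injs[OF j, symmetric] map_pmf_comp pb ..
  qed
  then show ?thesis by (simp add: pmf_entropy_map_le)
qed

text \<open>Sampling all n vertices merely shuffles the labels, so the isomorphism class is
  recovered. It follows that R has no more entropy than its full sample, to which Shearer's
  inequality applies.\<close>

lemma map_sampled_full:
  assumes R: "set_pmf R \<subseteq> unlabelled_graphs n" and "n \<ge> 1"
  shows "map_pmf (\<lambda>E. abs_ugraph (inv_into (labelled_graphs n) edge_pairs E)) (sampled n R) = R"
proof -
  have "map_pmf (\<lambda>E. abs_ugraph (inv_into (labelled_graphs n) edge_pairs E)) (sampled n R)
      = bind_pmf (map_pmf rep_ugraph R) (\<lambda>G. return_pmf (abs_ugraph G))"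
    unfolding sampled_def map_bind_pmf
  proof (rule bind_pmf_cong[OF refl])
    fix G assume "G \<in> set_pmf (map_pmf rep_ugraph R)"
    then have n: "graph_order G = n"
      using R by (auto simp: unlabelled_graphs_def ugraph_order.rep_eq)
    let ?p = "pmf_of_set (injs n (verts G))"
    have "abs_ugraph (inv_into (labelled_graphs n) edge_pairs (pullback n \<phi> G)) = abs_ugraph G"
      if "\<phi> \<in> set_pmf ?p" for \<phi>
    proof -
      define H where "H = inv_into (labelled_graphs n) edge_pairs (pullback n \<phi> G)"
      have "pullback n \<phi> G \<in> edge_pairs ` labelled_graphs n"
        using bij_betw_imp_surj_on[OF bij_betw_edge_pairs[OF assms(2)]] by (auto simp: pullback_def)
      then have H: "graph_order H = n" "edge_pairs H = pullback n \<phi> G"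
        using inv_into_into[of "pullback n \<phi> G" edge_pairs "labelled_graphs n"]
          f_inv_into_f[of "pullback n \<phi> G" edge_pairs "labelled_graphs n"]
        by (simp_all add: H_def) (simp add: labelled_graphs_def)
      \<comment> \<open>\<phi> itself witnesses that H has positive density in G, and between graphs
        of equal order this forces isomorphism.\<close>
      have "\<phi> \<in> induced_maps H G" "\<phi> \<in> injections H G"
        using H that n injs_nonempty[of n n]
        by (auto simp: induced_maps_iff_pullback injections_eq_injs finite_injs verts_def)
      then have "measure_pmf.prob (pmf_of_set (injections H G)) (induced_maps H G) \<noteq> 0"
        using finite_injections[of H G] by (subst measure_pmf_zero_iff) (subst set_pmf_of_set, auto)
      then have "graph_density H G > 0" using H n by (simp add: graph_density_def zero_less_measure_iff)
      then have "graph_iso H G" using H n by (intro graph_density_pos_imp_iso) auto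
      then show ?thesis unfolding H_def[symmetric] by (simp add: ugraph.abs_eq_iff)
    qed
    then have "map_pmf (\<lambda>\<phi>. abs_ugraph (inv_into (labelled_graphs n) edge_pairs (pullback n \<phi> G))) ?p
      = map_pmf (\<lambda>_. abs_ugraph G) ?p"
      by (intro map_pmf_cong) auto
    then show "map_pmf (\<lambda>E. abs_ugraph (inv_into (labelled_graphs n) edge_pairs E))
       (map_pmf (\<lambda>\<phi>. pullback n \<phi> G) ?p) = return_pmf (abs_ugraph G)"
      by (simp add: map_pmf_comp)
  qed
  also have "\<dots> = R" by (simp add: bind_map_pmf bind_return_pmf')
  finally show ?thesis .
qed

text \<open>The multiplicity r with which the k-subsets cover a pair in Shearer's
  inequality.\<close>

lemma card_subsets_containing_pair:
  assumes "finite S" "u \<in> S" "v \<in> S" "u \<noteq> v" "2 \<le> k"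
  shows "card {A. A \<subseteq> S \<and> card A = k \<and> u \<in> A \<and> v \<in> A} = (card S - 2) choose (k - 2)"
proof -
  have "bij_betw (\<lambda>B. insert u (insert v B)) {B. B \<subseteq> S - {u, v} \<and> card B = k - 2}
     {A. A \<subseteq> S \<and> card A = k \<and> u \<in> A \<and> v \<in> A}"
  proof (rule bij_betw_byWitness[where f' = "\<lambda>A. A - {u, v}"])
    show "(\<lambda>B. insert u (insert v B)) ` {B. B \<subseteq> S - {u, v} \<and> card B = k - 2}
      \<subseteq> {A. A \<subseteq> S \<and> card A = k \<and> u \<in> A \<and> v \<in> A}"
    proof safe
      fix B assume B: "B \<subseteq> S - {u, v}" "card B = k - 2"
      then have "finite B" "u \<notin> B" "v \<notin> B" using assms(1) finite_subset by blast+
      then show "card (insert u (insert v B)) = k" using B assms by simp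
    qed (use assms in auto)
    show "(\<lambda>A. A - {u, v}) ` {A. A \<subseteq> S \<and> card A = k \<and> u \<in> A \<and> v \<in> A}
       \<subseteq> {B. B \<subseteq> S - {u, v} \<and> card B = k - 2}"
    proof safe
      fix A assume A: "A \<subseteq> S" "u \<in> A" "v \<in> A"
      then have "finite A" using assms(1) finite_subset by blast
      then show "card (A - {u, v}) = card A - 2"
        using A assms by (subst card_Diff_subset) auto
    qed auto
    show "\<forall>B\<in>{B. B \<subseteq> S - {u, v} \<and> card B = k - 2}. insert u (insert v B) - {u, v} = B"
      by blast
    show "\<forall>A\<in>{A. A \<subseteq> S \<and> card A = k \<and> u \<in> A \<and> v \<in> A}. insert u (insert v (A - {u, v})) = A"
      by blast
  qed
  then have "card {A. A \<subseteq> S \<and> card A = k \<and> u \<in> A \<and> v \<in> A} = card {B. B \<subseteq> S - {u, v} \<and> card B = k - 2}"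
    using bij_betw_same_card by fastforce
  also have "\<dots> = (card S - 2) choose (k - 2)"
    using assms by (simp add: n_subsets card_Diff_subset flip: numeral_2_eq_2)
  finally show ?thesis .
qed

text \<open>Shearer's inequality for the cover of all pairs by the k-subsets of {1..n}, each trace
  having at most the entropy of the k-vertex sample. The identity (n choose k)(k choose 2) = (n
  choose 2)(n-2 choose k-2) turns the counts into normalisations.\<close>

lemma pmf_entropy_le_sampled:
  assumes R: "set_pmf R \<subseteq> unlabelled_graphs n" and k: "2 \<le> k" "k \<le> n"
  shows "pmf_entropy R / (n choose 2) \<le> pmf_entropy (sampled k R) / (k choose 2)"
proof -
  let ?I = "{A. A \<subseteq> {1..n} \<and> card A = k}"
  let ?r = "(n - 2) choose (k - 2)"
  have "real ?r * pmf_entropy (sampled n R) \<le>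
      (\<Sum>A\<in>?I. pmf_entropy (map_pmf (\<lambda>E. E \<inter> pairs_on A) (sampled n R)))"
  proof (rule pmf_entropy_shearer[OF _ set_sampled])
    fix e assume "e \<in> pairs_on {1..n}"
    then obtain u v where e: "e = (u, v)" "u \<in> {1..n}" "v \<in> {1..n}" "u < v"
      by (auto simp: pairs_on_def)
    have "{A \<in> ?I. e \<in> pairs_on A} = {A. A \<subseteq> {1..n} \<and> card A = k \<and> u \<in> A \<and> v \<in> A}"
      using e by (auto simp: pairs_on_def)
    then show "card {A \<in> ?I. e \<in> pairs_on A} = ?r"
      using card_subsets_containing_pair[of "{1..n}" u v k] e k by simp
  qed auto
  also have "\<dots> \<le> (\<Sum>A\<in>?I. pmf_entropy (sampled k R))"
    by (intro sum_mono pmf_entropy_sampled_restrict[OF R]) auto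
  also have "\<dots> = real (n choose k) * pmf_entropy (sampled k R)"
    using n_subsets[of "{1..n}" k] by simp
  finally have 1: "real ?r * pmf_entropy (sampled n R) \<le> real (n choose k) * pmf_entropy (sampled k R)" .
  have 2: "pmf_entropy R \<le> pmf_entropy (sampled n R)"
    using pmf_entropy_map_le[OF finite_set_sampled, of "\<lambda>E. abs_ugraph (inv_into (labelled_graphs n) edge_pairs E)" n R]
      map_sampled_full[OF R] k by simp
  have 3: "real (n choose k) * real (k choose 2) = real (n choose 2) * real ?r"
    using choose_mult[of 2 k n] k by (metis of_nat_mult)
  have pos: "?r > 0" "n choose 2 > 0" "k choose 2 > 0" using k by (auto intro: zero_less_binomial)
  have "real ?r * pmf_entropy R * real (k choose 2) \<le> real (n choose k) * pmf_entropy (sampled k R) * real (k choose 2)"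
    using 1 mult_left_mono[OF 2, of "real ?r"] by (intro mult_right_mono) auto
  also have "\<dots> = real ?r * (real (n choose 2) * pmf_entropy (sampled k R))"
    using 3 by (simp add: mult_ac)
  finally have "pmf_entropy R * real (k choose 2) \<le> real (n choose 2) * pmf_entropy (sampled k R)"
    using pos(1) by (simp add: mult.assoc)
  then show ?thesis using pos by (simp add: field_simps)
qed

text \<open>The case k = 2, where the sample is a single bit. This is the fallback for graphs
  outside all chosen neighbourhoods.\<close>

lemma pmf_entropy_le_choose_2:
  assumes R: "set_pmf R \<subseteq> unlabelled_graphs n" and "2 \<le> n"
  shows "pmf_entropy R \<le> n choose 2"
proof -
  have "pmf_entropy (sampled 2 R) \<le> log 2 (card (Pow (pairs_on {1..2})))"
    using set_sampled by (intro pmf_entropy_le_log_card) auto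
  also have "\<dots> = 1" by (simp add: card_Pow card_pairs_on)
  finally have *: "pmf_entropy (sampled 2 R) \<le> 1" .
  have "pmf_entropy R / (n choose 2) \<le> pmf_entropy (sampled 2 R)"
    using pmf_entropy_le_sampled[OF R, of 2] assms(2) by simp
  also note *
  finally have "pmf_entropy R / (n choose 2) \<le> 1" .
  moreover have "real (n choose 2) > 0" using assms(2) by (simp add: zero_less_binomial)
  ultimately show ?thesis by (simp only: pos_divide_le_eq mult_1)
qed

section \<open>The entropy of the labels\<close>

lemma card_isomorphic_labellings_le: "card {G \<in> labelled_graphs n. unlabel G = g} \<le> n ^ n"
proof (cases "{G \<in> labelled_graphs n. unlabel G = g} = {}")
  case False
  then obtain G0 where G0: "G0 \<in> labelled_graphs n" "unlabel G0 = g" by auto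
  have n: "n \<ge> 1" using graph_order_pos[of G0] G0 by (simp add: labelled_graphs_def)
  have inj: "inj_on edge_pairs (labelled_graphs n)"
    using bij_betw_edge_pairs[OF n] by (simp add: bij_betw_def)
  \<comment> \<open>Every labelling of g is the pullback of the fixed \<open>G0\<close> along a map
    of {1..n} to itself. Counting all maps and not only permutations is harmless, as n log n is
    still o(n^2).\<close>
  have "edge_pairs ` {G \<in> labelled_graphs n. unlabel G = g} \<subseteq> (\<lambda>\<phi>. pullback n \<phi> G0) ` ({1..n} \<rightarrow>\<^sub>E {1..n})"
  proof safe
    fix G assume G: "G \<in> labelled_graphs n" "g = unlabel G"
    then have "graph_iso G G0" using G0 graph_iso_sym by (simp add: unlabel_def ugraph.abs_eq_iff)
    then obtain f where f: "bij_betw f (verts G) (verts G0)"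
      "\<forall>u\<in>verts G. \<forall>v\<in>verts G. adj G u v \<longleftrightarrow> adj G0 (f u) (f v)"
      unfolding graph_iso_def by blast
    have V: "verts G = {1..n}" "verts G0 = {1..n}" using G G0 by (auto simp: labelled_graphs_def verts_def)
    have "edge_pairs G = pullback n (restrict f {1..n}) G0"
      using f V by (auto simp: edge_pairs_def pullback_def pairs_on_def)
    moreover have "restrict f {1..n} \<in> {1..n} \<rightarrow>\<^sub>E {1..n}"
      using f(1) V by (auto dest: bij_betw_apply)
    ultimately show "edge_pairs G \<in> (\<lambda>\<phi>. pullback n \<phi> G0) ` ({1..n} \<rightarrow>\<^sub>E {1..n})" by blast
  qed
  then have "card (edge_pairs ` {G \<in> labelled_graphs n. unlabel G = g}) \<le> card ({1..n} \<rightarrow>\<^sub>E {1..n})"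
    by (intro surj_card_le finite_PiE) auto
  also have "\<dots> = n ^ n" by (simp add: card_PiE)
  finally show ?thesis
    using card_image[OF inj_on_subset[OF inj, of "{G \<in> labelled_graphs n. unlabel G = g}"]] by auto
next
  case True
  then show ?thesis by (metis card.empty zero_le)
qed

lemma pmf_entropy_labelled_le:
  assumes p: "set_pmf p \<subseteq> labelled_graphs n"
  shows "pmf_entropy p \<le> pmf_entropy (map_pmf unlabel p) + n * log 2 n"
proof -
  have fin: "finite (set_pmf p)" using p finite_labelled_graphs finite_subset by blast
  obtain G where "G \<in> set_pmf p" using set_pmf_not_empty by fast
  then have n: "n \<ge> 1" using p graph_order_pos[of G] by (auto simp: labelled_graphs_def)
  have "pmf_entropy (cond_pmf p (unlabel -` {b})) \<le> n * log 2 n" if "b \<in> unlabel ` set_pmf p" for b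
  proof -
    let ?B = "{G \<in> labelled_graphs n. unlabel G = b}"
    have ne: "set_pmf p \<inter> unlabel -` {b} \<noteq> {}" using that by auto
    have fB: "finite ?B" using finite_labelled_graphs by simp
    have sub: "set_pmf (cond_pmf p (unlabel -` {b})) \<subseteq> ?B" using set_cond_pmf[OF ne] p by auto
    then have "?B \<noteq> {}" using set_pmf_not_empty by fast
    then have c: "card ?B > 0" using fB by (simp add: card_gt_0_iff)
    have "pmf_entropy (cond_pmf p (unlabel -` {b})) \<le> log 2 (card ?B)"
      by (rule pmf_entropy_le_log_card[OF fB sub])
    also have "\<dots> \<le> log 2 (real n ^ n)"
    proof -
      have "real (card ?B) \<le> real n ^ n"
        using card_isomorphic_labellings_le[of n b] by (metis of_nat_le_iff of_nat_power)
      then show ?thesis using c n by (subst log_le_cancel_iff) auto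
    qed
    also have "\<dots> = n * log 2 n" using n by (simp add: log_nat_power)
    finally show ?thesis .
  qed
  then have "(\<Sum>b\<in>unlabel ` set_pmf p. pmf (map_pmf unlabel p) b * pmf_entropy (cond_pmf p (unlabel -` {b})))
     \<le> (\<Sum>b\<in>unlabel ` set_pmf p. pmf (map_pmf unlabel p) b * (n * log 2 n))"
    by (intro sum_mono mult_left_mono) auto
  also have "\<dots> = n * log 2 n"
    using sum_pmf_eq_1[of "unlabel ` set_pmf p" "map_pmf unlabel p"] fin
    by (simp flip: sum_distrib_right)
  finally show ?thesis unfolding pmf_entropy_chain[OF fin, of unlabel] by simp
qed

section \<open>Subgraph densities of kernels\<close>

lemma space_unit_measure [simp]: "space unit_measure = {0..1}"
  by (simp add: unit_measure_def space_restrict_space)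

interpretation unit: prob_space unit_measure
proof
  show "emeasure unit_measure (space unit_measure) = 1"
    by (simp add: unit_measure_def space_restrict_space emeasure_restrict_space)
qed

abbreviation unit_square :: "(real \<times> real) measure" where
  "unit_square \<equiv> unit_measure \<Otimes>\<^sub>M unit_measure"

interpretation unit2: pair_prob_space unit_measure unit_measure ..

interpretation unitP: product_prob_space "\<lambda>_. unit_measure" I for I :: "nat set" ..

lemma space_unit_square: "space unit_square = {0..1} \<times> {0..1}"
  by (simp add: space_pair_measure)

text \<open>A graphon without the symmetry. Densities only evaluate pairs u < v, so they still make
  sense, and the step functions that approximate a graphon for the entropy bound need not be
  symmetric.\<close>

definition kernel :: "(real \<Rightarrow> real \<Rightarrow> real) \<Rightarrow> bool" where
  "kernel F \<longleftrightarrow> case_prod F \<in> borel_measurable unit_square \<and>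
     (\<forall>x\<in>{0..1}. \<forall>y\<in>{0..1}. 0 \<le> F x y \<and> F x y \<le> 1)"

lemma kernelD:
  assumes "kernel F"
  shows "case_prod F \<in> borel_measurable unit_square"
    "x \<in> {0..1} \<Longrightarrow> y \<in> {0..1} \<Longrightarrow> 0 \<le> F x y" "x \<in> {0..1} \<Longrightarrow> y \<in> {0..1} \<Longrightarrow> F x y \<le> 1"
  using assms by (auto simp: kernel_def)

lemma kernel_graphon_fun: "kernel (graphon_fun W)"
  using graphon_fun[of W] by (simp add: kernel_def)

lemma kernel_compl: "kernel F \<Longrightarrow> kernel (\<lambda>x y. 1 - F x y)"
  by (auto simp: kernel_def case_prod_beta')

lemma (in prob_space) integrable_bounded_real:
  fixes f :: "'a \<Rightarrow> real"
  assumes "f \<in> borel_measurable M" "\<And>x. x \<in> space M \<Longrightarrow> \<bar>f x\<bar> \<le> B"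
  shows "integrable M f"
  using assms by (intro integrable_const_bound[of _ B]) auto

lemma (in prob_space) abs_integral_le:
  fixes f :: "'a \<Rightarrow> real"
  assumes "\<And>x. x \<in> space M \<Longrightarrow> \<bar>f x\<bar> \<le> B" "0 \<le> B"
  shows "\<bar>integral\<^sup>L M f\<bar> \<le> B"
proof (cases "integrable M f")
  case True
  have "AE x in M. f x \<le> B" "AE x in M. - B \<le> f x" using assms(1) by (auto simp: abs_le_iff minus_le_iff)
  then show ?thesis using integral_le_const[OF True, of B] integral_ge_const[OF True, of "-B"] by auto
qed (simp add: not_integrable_integral_eq assms)

lemma abs_mult_unit_le:
  fixes a b :: real
  assumes "0 \<le> a \<and> a \<le> 1" "0 \<le> b \<and> b \<le> 1"
  shows "\<bar>a * b\<bar> \<le> 1"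
  using assms by (simp add: abs_mult mult_le_one)

lemma measurable_component_pair:
  assumes "u \<in> I" "v \<in> I" "g \<in> borel_measurable unit_square"
  shows "(\<lambda>X. g (X u, X v)) \<in> borel_measurable (\<Pi>\<^sub>M i\<in>I. unit_measure)"
proof -
  have "(\<lambda>X. (X u, X v)) \<in> (\<Pi>\<^sub>M i\<in>I. unit_measure) \<rightarrow>\<^sub>M unit_square"
    using assms by measurable
  from measurable_compose[OF this assms(3)] show ?thesis .
qed

lemma component_in_unit: "X \<in> space (\<Pi>\<^sub>M i\<in>I. unit_measure) \<Longrightarrow> u \<in> I \<Longrightarrow> X u \<in> {0..1}"
  by (auto simp: space_PiM PiE_def Pi_def)

lemma distr_component_pair:
  fixes I :: "nat set"
  assumes "u \<in> I" "v \<in> I" "u \<noteq> v"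
  shows "distr (\<Pi>\<^sub>M i\<in>I. unit_measure) unit_square (\<lambda>X. (X u, X v)) = unit_square"
proof (rule pair_measure_eqI[symmetric])
  fix A B assume AB: "A \<in> sets unit_measure" "B \<in> sets unit_measure"
  let ?P = "\<Pi>\<^sub>M i\<in>I. unit_measure"
  have m: "(\<lambda>X. (X u, X v)) \<in> ?P \<rightarrow>\<^sub>M unit_square" using assms by measurable
  have "emeasure (distr ?P unit_square (\<lambda>X. (X u, X v))) (A \<times> B)
      = emeasure ?P ((\<lambda>X. (X u, X v)) -` (A \<times> B) \<inter> space ?P)"
    using AB m by (intro emeasure_distr) auto
  also have "(\<lambda>X. (X u, X v)) -` (A \<times> B) \<inter> space ?P
      = {X \<in> space ?P. \<forall>i\<in>{u, v}. X i \<in> (if i = u then A else B)}"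
    using assms by auto
  also have "emeasure ?P \<dots> = emeasure unit_measure A * emeasure unit_measure B"
    using assms AB unitP.emeasure_PiM_Collect[of "{u, v}" I "\<lambda>i. if i = u then A else B"] by simp
  finally show "emeasure unit_measure A * emeasure unit_measure B
      = emeasure (distr ?P unit_square (\<lambda>X. (X u, X v))) (A \<times> B)" ..
qed (auto intro: unit.sigma_finite_measure_axioms)

lemma integral_component_pair:
  fixes I :: "nat set" and g :: "real \<times> real \<Rightarrow> real"
  assumes "u \<in> I" "v \<in> I" "u \<noteq> v" "g \<in> borel_measurable unit_square"
  shows "(\<integral>X. g (X u, X v) \<partial>(\<Pi>\<^sub>M i\<in>I. unit_measure)) = (\<integral>z. g z \<partial>unit_square)"
proof -
  have m: "(\<lambda>X. (X u, X v)) \<in> (\<Pi>\<^sub>M i\<in>I. unit_measure) \<rightarrow>\<^sub>M unit_square" using assms by measurable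
  show ?thesis
    using integral_distr[OF m assms(4)] by (simp add: distr_component_pair[OF assms(1-3)])
qed

section \<open>Independent edges and densities\<close>

text \<open>For E \<subseteq> P, the probability that a random subset of P containing each e
  independently with probability \<open>w e\<close> equals E.\<close>

definition bern :: "'e set \<Rightarrow> 'e set \<Rightarrow> ('e \<Rightarrow> real) \<Rightarrow> real" where
  "bern E P w = (\<Prod>e\<in>P. if e \<in> E then w e else 1 - w e)"

lemma bern_bounds:
  assumes "\<And>e. e \<in> P \<Longrightarrow> 0 \<le> w e \<and> w e \<le> 1"
  shows "0 \<le> bern E P w" "bern E P w \<le> 1"
  using assms by (auto simp: bern_def intro!: prod_nonneg prod_le_1)

lemma sum_Pow_insert:
  fixes f :: "'e set \<Rightarrow> real"
  assumes "finite P" "a \<notin> P"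
  shows "(\<Sum>E\<in>Pow (insert a P). f E) = (\<Sum>E\<in>Pow P. f E) + (\<Sum>E\<in>Pow P. f (insert a E))"
proof -
  have "inj_on (insert a) (Pow P)" using assms(2) by (auto simp: inj_on_def)
  then show ?thesis using assms unfolding Pow_insert
    by (subst sum.union_disjoint) (auto simp: sum.reindex)
qed

lemma bern_insert:
  assumes "finite P" "a \<notin> P" "E \<subseteq> P"
  shows "bern E (insert a P) w = (1 - w a) * bern E P w"
    "bern (insert a E) (insert a P) w = w a * bern E P w"
proof -
  show "bern E (insert a P) w = (1 - w a) * bern E P w"
    using assms by (auto simp: bern_def)
  have "(\<Prod>e\<in>P. if e \<in> insert a E then w e else 1 - w e) = (\<Prod>e\<in>P. if e \<in> E then w e else 1 - w e)"
    using assms by (intro prod.cong) auto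
  then show "bern (insert a E) (insert a P) w = w a * bern E P w"
    using assms by (simp add: bern_def)
qed

lemma sum_bern:
  assumes "finite P"
  shows "(\<Sum>E\<in>Pow P. bern E P w) = 1"
  using assms
proof (induction P rule: finite_induct)
  case (insert a P)
  then have "(\<Sum>E\<in>Pow (insert a P). bern E (insert a P) w)
      = (\<Sum>E\<in>Pow P. (1 - w a) * bern E P w) + (\<Sum>E\<in>Pow P. w a * bern E P w)"
    unfolding sum_Pow_insert[OF insert(1,2)]
    by (intro arg_cong2[of _ _ _ _ "(+)"] sum.cong) (auto simp: bern_insert)
  then show ?case using insert(3) by (simp flip: sum_distrib_left)
qed (simp add: bern_def)

text \<open>Linearity of expectation: an additive functional of the random set sees only the
  marginals. With logarithms as summands it evaluates entropies and cross entropies of independent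
  edges.\<close>

lemma sum_bern_times:
  assumes "finite P"
  shows "(\<Sum>E\<in>Pow P. bern E P w * (\<Sum>e\<in>P. g e (e \<in> E)))
    = (\<Sum>e\<in>P. w e * g e True + (1 - w e) * g e False)"
  using assms
proof (induction P rule: finite_induct)
  case (insert a P)
  define S where "S E = (\<Sum>e\<in>P. g e (e \<in> E))" for E
  have eq: "(\<Sum>e\<in>P. g e (e \<in> insert a E)) = (\<Sum>e\<in>P. g e (e \<in> E))" for E
  proof (rule sum.cong[OF refl])
    fix e assume "e \<in> P"
    then have "e \<noteq> a" using insert(2) by auto
    then show "g e (e \<in> insert a E) = g e (e \<in> E)" by simp
  qed
  have "(\<Sum>E\<in>Pow (insert a P). bern E (insert a P) w * (\<Sum>e\<in>insert a P. g e (e \<in> E)))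
      = (\<Sum>E\<in>Pow P. (1 - w a) * bern E P w * (g a False + S E))
       + (\<Sum>E\<in>Pow P. w a * bern E P w * (g a True + S E))"
    unfolding sum_Pow_insert[OF insert(1,2)]
  proof (intro arg_cong2[of _ _ _ _ "(+)"] sum.cong refl)
    fix E assume E: "E \<in> Pow P"
    then have "a \<notin> E" using insert(2) by auto
    then show "bern E (insert a P) w * (\<Sum>e\<in>insert a P. g e (e \<in> E))
        = (1 - w a) * bern E P w * (g a False + S E)"
      using insert(1,2) E by (simp add: bern_insert S_def)
    show "bern (insert a E) (insert a P) w * (\<Sum>e\<in>insert a P. g e (e \<in> insert a E))
        = w a * bern E P w * (g a True + S E)"
      using insert(1,2) E eq[of E] by (simp add: bern_insert S_def)
  qed
  also have "\<dots> = (\<Sum>E\<in>Pow P. (w a * g a True + (1 - w a) * g a False) * bern E P w + bern E P w * S E)"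
    unfolding sum.distrib[symmetric] by (intro sum.cong) (auto simp: algebra_simps)
  also have "\<dots> = w a * g a True + (1 - w a) * g a False + (\<Sum>e\<in>P. w e * g e True + (1 - w e) * g e False)"
    using insert(3) sum_bern[OF insert(1), of w] by (simp add: sum.distrib S_def flip: sum_distrib_left)
  finally show ?case using insert by simp
qed (simp add: bern_def)

definition edge_weights :: "(real \<Rightarrow> real \<Rightarrow> real) \<Rightarrow> (nat \<Rightarrow> real) \<Rightarrow> nat \<times> nat \<Rightarrow> real" where
  "edge_weights F X = (\<lambda>(u, v). F (X u) (X v))"

definition kernel_density :: "graph \<Rightarrow> (real \<Rightarrow> real \<Rightarrow> real) \<Rightarrow> real" where
  "kernel_density H F = (\<integral>X. bern (edge_pairs H) (pairs_on (verts H)) (edge_weights F X)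
     \<partial>(\<Pi>\<^sub>M u\<in>verts H. unit_measure))"

lemma graphon_density_eq: "graphon_density H W = kernel_density H (graphon_fun W)"
proof -
  let ?P = "pairs_on (verts H)" and ?W = "graphon_fun W"
  have "(\<Prod>(u, v)\<in>{(u, v). u \<in> verts H \<and> v \<in> verts H \<and> u < v \<and> adj H u v}. ?W (X u) (X v)) *
        (\<Prod>(u, v)\<in>{(u, v). u \<in> verts H \<and> v \<in> verts H \<and> u < v \<and> \<not> adj H u v}. 1 - ?W (X u) (X v))
      = bern (edge_pairs H) ?P (edge_weights ?W X)" for X
  proof -
    have 1: "{(u, v). u \<in> verts H \<and> v \<in> verts H \<and> u < v \<and> adj H u v} = ?P \<inter> edge_pairs H"
      "{(u, v). u \<in> verts H \<and> v \<in> verts H \<and> u < v \<and> \<not> adj H u v} = ?P \<inter> - edge_pairs H"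
      by (auto simp: pairs_on_def edge_pairs_def)
    show ?thesis unfolding 1 bern_def edge_weights_def
      by (subst prod.If_cases) (auto simp: case_prod_beta)
  qed
  then show ?thesis by (simp add: graphon_density_def kernel_density_def)
qed

lemma edge_weights_bounds:
  assumes "kernel F" "X \<in> space (\<Pi>\<^sub>M i\<in>I. unit_measure)" "e \<in> pairs_on I"
  shows "0 \<le> edge_weights F X e \<and> edge_weights F X e \<le> 1"
  using assms kernelD[OF assms(1)] component_in_unit[OF assms(2)]
  by (auto simp: edge_weights_def pairs_on_def)

lemma measurable_edge_weights:
  assumes "case_prod F \<in> borel_measurable unit_square" "e \<in> pairs_on I"
  shows "(\<lambda>X. edge_weights F X e) \<in> borel_measurable (\<Pi>\<^sub>M i\<in>I. unit_measure)"
  using assms measurable_component_pair[of "fst e" I "snd e" "case_prod F"]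
  by (auto simp: edge_weights_def pairs_on_def)

lemma measurable_bern_edge_weights:
  assumes "kernel F" "P \<subseteq> pairs_on I"
  shows "(\<lambda>X. bern E P (edge_weights F X)) \<in> borel_measurable (\<Pi>\<^sub>M i\<in>I. unit_measure)"
proof -
  have "(\<lambda>X. edge_weights F X e) \<in> borel_measurable (\<Pi>\<^sub>M i\<in>I. unit_measure)" if "e \<in> P" for e
    using measurable_edge_weights[OF kernelD(1)[OF assms(1)]] assms(2) that by blast
  then show ?thesis unfolding bern_def by (intro borel_measurable_prod) auto
qed

lemma integrable_bern_edge_weights:
  assumes "kernel F" "P \<subseteq> pairs_on I"
  shows "integrable (\<Pi>\<^sub>M i\<in>I. unit_measure) (\<lambda>X. bern E P (edge_weights F X))"
proof (rule unitP.P.integrable_bounded_real[OF measurable_bern_edge_weights[OF assms]])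
  fix X assume "X \<in> space (\<Pi>\<^sub>M i\<in>I. unit_measure)"
  then have "\<And>e. e \<in> P \<Longrightarrow> 0 \<le> edge_weights F X e \<and> edge_weights F X e \<le> 1"
    using edge_weights_bounds[OF assms(1)] assms(2) by blast
  then show "\<bar>bern E P (edge_weights F X)\<bar> \<le> 1" using bern_bounds[of P "edge_weights F X" E] by simp
qed

section \<open>Cut norm and the counting lemma\<close>

text \<open>The cut norm, tested by functions into [0,1] and not only by sets, because functions are
  what is left of a density once all vertices but two are fixed. \<open>cut_bound_setsI\<close>
  passes from sets to functions.\<close>

definition cut_bound :: "real \<Rightarrow> (real \<times> real \<Rightarrow> real) \<Rightarrow> bool" where
  "cut_bound \<epsilon> D \<longleftrightarrow> (\<forall>f g. f \<in> borel_measurable unit_measure \<longrightarrow> g \<in> borel_measurable unit_measure \<longrightarrow>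
     (\<forall>x\<in>{0..1}. 0 \<le> f x \<and> f x \<le> 1) \<longrightarrow> (\<forall>x\<in>{0..1}. 0 \<le> g x \<and> g x \<le> 1) \<longrightarrow>
     \<bar>\<integral>z. D z * (f (fst z) * g (snd z)) \<partial>unit_square\<bar> \<le> \<epsilon>)"

lemma cut_boundD:
  assumes "cut_bound \<epsilon> D" "f \<in> borel_measurable unit_measure" "g \<in> borel_measurable unit_measure"
    "\<And>x. x \<in> {0..1} \<Longrightarrow> 0 \<le> f x \<and> f x \<le> 1" "\<And>x. x \<in> {0..1} \<Longrightarrow> 0 \<le> g x \<and> g x \<le> 1"
  shows "\<bar>\<integral>z. D z * (f (fst z) * g (snd z)) \<partial>unit_square\<bar> \<le> \<epsilon>"
  using assms unfolding cut_bound_def by blast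

lemma cut_bound_uminus: "cut_bound \<epsilon> D \<Longrightarrow> cut_bound \<epsilon> (\<lambda>z. - D z)"
  by (simp add: cut_bound_def)

lemma cut_bound_L1:
  assumes "D \<in> borel_measurable unit_square" "\<And>z. z \<in> space unit_square \<Longrightarrow> \<bar>D z\<bar> \<le> B"
    and le: "(\<integral>z. \<bar>D z\<bar> \<partial>unit_square) \<le> \<epsilon>"
  shows "cut_bound \<epsilon> D"
  unfolding cut_bound_def
proof (intro allI impI)
  fix f g :: "real \<Rightarrow> real"
  assume [measurable]: "f \<in> borel_measurable unit_measure" "g \<in> borel_measurable unit_measure"
    and f: "\<forall>x\<in>{0..1}. 0 \<le> f x \<and> f x \<le> 1" and g: "\<forall>x\<in>{0..1}. 0 \<le> g x \<and> g x \<le> 1"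
  note [measurable] = assms(1)
  have pt: "\<bar>D z * (f (fst z) * g (snd z))\<bar> \<le> \<bar>D z\<bar>" if "z \<in> space unit_square" for z
  proof -
    have "\<bar>f (fst z) * g (snd z)\<bar> \<le> 1"
      using that f g by (intro abs_mult_unit_le) (auto simp: space_unit_square)
    then show ?thesis by (simp add: abs_mult mult_left_le)
  qed
  have iD: "integrable unit_square (\<lambda>z. \<bar>D z\<bar>)"
    using assms(2) by (intro unit2.P.integrable_bounded_real[of _ B]) auto
  have "\<bar>\<integral>z. D z * (f (fst z) * g (snd z)) \<partial>unit_square\<bar>
      \<le> (\<integral>z. \<bar>D z * (f (fst z) * g (snd z))\<bar> \<partial>unit_square)"
    by (rule integral_abs_bound)
  also have "\<dots> \<le> (\<integral>z. \<bar>D z\<bar> \<partial>unit_square)"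
  proof (intro integral_mono iD)
    show "integrable unit_square (\<lambda>z. \<bar>D z * (f (fst z) * g (snd z))\<bar>)"
      by (rule unit2.P.integrable_bounded_real[of _ B]) (auto intro: order_trans[OF pt assms(2)])
  qed (use pt in auto)
  also note le
  finally show "\<bar>\<integral>z. D z * (f (fst z) * g (snd z)) \<partial>unit_square\<bar> \<le> \<epsilon>" .
qed

text \<open>For fixed \<open>g\<close> the integral is linear in \<open>f\<close>, so it is extremal at an indicator function,
  namely that of the set where the inner integral is positive.\<close>

lemma cut_bound_setsI:
  assumes D[measurable]: "D \<in> borel_measurable unit_square"
    and B: "\<And>z. z \<in> space unit_square \<Longrightarrow> \<bar>D z\<bar> \<le> B"
    and sets: "\<And>S T. S \<in> sets unit_measure \<Longrightarrow> T \<in> sets unit_measure \<Longrightarrow>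
      \<bar>\<integral>z. D z * (indicator S (fst z) * indicator T (snd z)) \<partial>unit_square\<bar> \<le> \<epsilon>"
  shows "cut_bound \<epsilon> D"
proof -
  have int: "integrable unit_square (\<lambda>z. K z * (f (fst z) * g (snd z)))"
    if [measurable]: "K \<in> borel_measurable unit_square" "f \<in> borel_measurable unit_measure" "g \<in> borel_measurable unit_measure"
      and "\<And>z. z \<in> space unit_square \<Longrightarrow> \<bar>K z\<bar> \<le> B"
      "\<And>x. x \<in> {0..1} \<Longrightarrow> 0 \<le> f x \<and> f x \<le> 1" "\<And>x. x \<in> {0..1} \<Longrightarrow> 0 \<le> g x \<and> g x \<le> 1"
    for K :: "real \<times> real \<Rightarrow> real" and f g :: "real \<Rightarrow> real"
  proof (rule unit2.P.integrable_bounded_real[of _ B])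
    fix z assume z: "z \<in> space unit_square"
    have "\<bar>f (fst z) * g (snd z)\<bar> \<le> 1"
      using z by (intro abs_mult_unit_le that(5,6)) (auto simp: space_unit_square)
    then have "\<bar>K z * (f (fst z) * g (snd z))\<bar> \<le> \<bar>K z\<bar>" by (simp add: abs_mult mult_left_le)
    then show "\<bar>K z * (f (fst z) * g (snd z))\<bar> \<le> B" using that(4)[OF z] by linarith
  qed measurable
  have left: "\<exists>S\<in>sets unit_measure. (\<integral>z. K z * (f (fst z) * g (snd z)) \<partial>unit_square)
      \<le> (\<integral>z. K z * (indicator S (fst z) * g (snd z)) \<partial>unit_square)"
    if [measurable]: "K \<in> borel_measurable unit_square" "f \<in> borel_measurable unit_measure" "g \<in> borel_measurable unit_measure"
      and KB: "\<And>z. z \<in> space unit_square \<Longrightarrow> \<bar>K z\<bar> \<le> B"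
      and f: "\<And>x. x \<in> {0..1} \<Longrightarrow> 0 \<le> f x \<and> f x \<le> 1" and g: "\<And>x. x \<in> {0..1} \<Longrightarrow> 0 \<le> g x \<and> g x \<le> 1"
    for K :: "real \<times> real \<Rightarrow> real" and f g :: "real \<Rightarrow> real"
  proof -
    define k where "k x = (\<integral>y. K (x, y) * g y \<partial>unit_measure)" for x
    have [measurable]: "k \<in> borel_measurable unit_measure" unfolding k_def by measurable
    define S where "S = {x \<in> space unit_measure. k x > 0}"
    have S[measurable]: "S \<in> sets unit_measure" unfolding S_def by measurable
    have eq: "(\<integral>z. K z * (h (fst z) * g (snd z)) \<partial>unit_square) = (\<integral>x. k x * h x \<partial>unit_measure)"
      if [measurable]: "h \<in> borel_measurable unit_measure" and h: "\<And>x. x \<in> {0..1} \<Longrightarrow> 0 \<le> h x \<and> h x \<le> 1"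
      for h :: "real \<Rightarrow> real"
    proof -
      have "(\<integral>z. K z * (h (fst z) * g (snd z)) \<partial>unit_square)
          = (\<integral>x. \<integral>y. K (x, y) * (h x * g y) \<partial>unit_measure \<partial>unit_measure)"
        by (subst unit2.integral_fst'[OF int, symmetric]) (use KB g h in auto)
      also have "\<dots> = (\<integral>x. k x * h x \<partial>unit_measure)"
      proof (rule Bochner_Integration.integral_cong[OF refl])
        fix x
        have "(\<integral>y. K (x, y) * (h x * g y) \<partial>unit_measure) = (\<integral>y. (K (x, y) * g y) * h x \<partial>unit_measure)"
          by (simp add: mult_ac)
        also have "\<dots> = k x * h x" unfolding k_def by (rule integral_mult_left_zero)
        finally show "(\<integral>y. K (x, y) * (h x * g y) \<partial>unit_measure) = k x * h x" .
      qed
      finally show ?thesis .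
    qed
    have kB: "\<bar>k x\<bar> \<le> max B 0" if "x \<in> {0..1}" for x
      unfolding k_def
    proof (rule unit.abs_integral_le)
      fix y assume y: "y \<in> space unit_measure"
      have "\<bar>K (x, y) * g y\<bar> \<le> \<bar>K (x, y)\<bar>" using g[of y] y by (auto simp: abs_mult intro: mult_left_le)
      also have "\<dots> \<le> B" using KB[of "(x, y)"] y that by (simp add: space_unit_square)
      finally show "\<bar>K (x, y) * g y\<bar> \<le> max B 0" by simp
    qed simp
    have intk: "integrable unit_measure (\<lambda>x. k x * h x)"
      if [measurable]: "h \<in> borel_measurable unit_measure" and h: "\<And>x. x \<in> {0..1} \<Longrightarrow> 0 \<le> h x \<and> h x \<le> 1"
      for h :: "real \<Rightarrow> real"
    proof (rule unit.integrable_bounded_real[of _ "max B 0"])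
      fix x assume "x \<in> space unit_measure"
      then have "\<bar>k x * h x\<bar> \<le> \<bar>k x\<bar>" "\<bar>k x\<bar> \<le> max B 0"
        using h[of x] kB[of x] by (auto simp: abs_mult intro: mult_left_le)
      then show "\<bar>k x * h x\<bar> \<le> max B 0" by linarith
    qed measurable
    have "(\<integral>x. k x * f x \<partial>unit_measure) \<le> (\<integral>x. k x * indicator S x \<partial>unit_measure)"
    proof (rule integral_mono)
      fix x assume x: "x \<in> space unit_measure"
      show "k x * f x \<le> k x * indicator S x"
        using f[of x] x by (cases "k x > 0") (auto simp: S_def mult_nonpos_nonneg)
    qed (auto intro!: intk f simp: indicator_def)
    then have "(\<integral>z. K z * (f (fst z) * g (snd z)) \<partial>unit_square)
        \<le> (\<integral>z. K z * (indicator S (fst z) * g (snd z)) \<partial>unit_square)"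
      by (subst (1 2) eq) (simp_all add: f indicator_le_1)
    then show ?thesis using S by blast
  qed
  have le: "(\<integral>z. K z * (f (fst z) * g (snd z)) \<partial>unit_square) \<le> \<epsilon>"
    if [measurable]: "K \<in> borel_measurable unit_square" "f \<in> borel_measurable unit_measure" "g \<in> borel_measurable unit_measure"
      and KB: "\<And>z. z \<in> space unit_square \<Longrightarrow> \<bar>K z\<bar> \<le> B"
      and f: "\<And>x. x \<in> {0..1} \<Longrightarrow> 0 \<le> f x \<and> f x \<le> 1" and g: "\<And>x. x \<in> {0..1} \<Longrightarrow> 0 \<le> g x \<and> g x \<le> 1"
      and sK: "\<And>S T. S \<in> sets unit_measure \<Longrightarrow> T \<in> sets unit_measure \<Longrightarrow>
       (\<integral>z. K z * (indicator S (fst z) * indicator T (snd z)) \<partial>unit_square) \<le> \<epsilon>"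
    for K :: "real \<times> real \<Rightarrow> real" and f g :: "real \<Rightarrow> real"
  proof -
    note meas = that(1-3)
    obtain S where S[measurable]: "S \<in> sets unit_measure"
      and 1: "(\<integral>z. K z * (f (fst z) * g (snd z)) \<partial>unit_square)
      \<le> (\<integral>z. K z * (indicator S (fst z) * g (snd z)) \<partial>unit_square)"
      using left[OF meas KB f g] by blast
    \<comment> \<open>With the coordinates exchanged, \<open>left\<close> also replaces the second
      test function by an indicator.\<close>
    let ?K = "\<lambda>z. K (snd z, fst z)"
    have swap: "(\<integral>z. K z * (a (fst z) * b (snd z)) \<partial>unit_square) = (\<integral>z. ?K z * (b (fst z) * a (snd z)) \<partial>unit_square)"
      if [measurable]: "a \<in> borel_measurable unit_measure" "b \<in> borel_measurable unit_measure" for a b :: "real \<Rightarrow> real"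
      using unit2.integral_product_swap[of "\<lambda>z. K z * (a (fst z) * b (snd z))"]
      by (simp add: case_prod_beta' mult_ac)
    have mK: "?K \<in> borel_measurable unit_square" by measurable
    obtain T where T[measurable]: "T \<in> sets unit_measure"
      and 2: "(\<integral>z. ?K z * (g (fst z) * indicator S (snd z)) \<partial>unit_square)
      \<le> (\<integral>z. ?K z * (indicator T (fst z) * indicator S (snd z)) \<partial>unit_square)"
      using left[OF mK, of g "indicator S"] KB g by (auto simp: space_unit_square indicator_def)
    have "(\<integral>z. K z * (indicator S (fst z) * g (snd z)) \<partial>unit_square)
       \<le> (\<integral>z. K z * (indicator S (fst z) * indicator T (snd z)) \<partial>unit_square)"
      using 2 by (subst (1 2) swap) auto
    then show ?thesis using 1 sK[OF S T] by linarith
  qed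
  show ?thesis
    unfolding cut_bound_def
  proof (intro allI impI)
    fix f g :: "real \<Rightarrow> real"
    assume fg: "f \<in> borel_measurable unit_measure" "g \<in> borel_measurable unit_measure"
      "\<forall>x\<in>{0..1}. 0 \<le> f x \<and> f x \<le> 1" "\<forall>x\<in>{0..1}. 0 \<le> g x \<and> g x \<le> 1"
    have D1: "(\<integral>z. D z * (f (fst z) * g (snd z)) \<partial>unit_square) \<le> \<epsilon>"
    proof (rule le[OF D fg(1,2) B])
      fix S T assume "S \<in> sets unit_measure" "T \<in> sets unit_measure"
      from sets[OF this] show "(\<integral>z. D z * (indicator S (fst z) * indicator T (snd z)) \<partial>unit_square) \<le> \<epsilon>"
        by (rule abs_le_D1)
    qed (use fg(3,4) in auto)
    have D2: "(\<integral>z. - D z * (f (fst z) * g (snd z)) \<partial>unit_square) \<le> \<epsilon>"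
    proof (rule le[OF borel_measurable_uminus[OF D] fg(1,2)])
      fix S T assume "S \<in> sets unit_measure" "T \<in> sets unit_measure"
      from abs_le_D2[OF sets[OF this]]
      show "(\<integral>z. - D z * (indicator S (fst z) * indicator T (snd z)) \<partial>unit_square) \<le> \<epsilon>"
        by simp
    qed (use fg(3,4) B in auto)
    show "\<bar>\<integral>z. D z * (f (fst z) * g (snd z)) \<partial>unit_square\<bar> \<le> \<epsilon>"
      using D1 D2 by (intro abs_leI) simp_all
  qed
qed

text \<open>Integrating out \<open>X u\<close> and \<open>X v\<close> first, the remaining factors are test functions of one variable each.\<close>

lemma cut_bound_integral_component_pair:
  fixes I :: "nat set"
  assumes I: "finite I" "u \<in> I" "v \<in> I" "u \<noteq> v"
    and D: "D \<in> borel_measurable unit_square" "\<And>z. z \<in> space unit_square \<Longrightarrow> \<bar>D z\<bar> \<le> 1" "cut_bound \<epsilon> D" "0 \<le> \<epsilon>"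
    and \<Phi>: "\<Phi> \<in> borel_measurable (\<Pi>\<^sub>M i\<in>I. unit_measure)"
      "\<And>X. X \<in> space (\<Pi>\<^sub>M i\<in>I. unit_measure) \<Longrightarrow> 0 \<le> \<Phi> X \<and> \<Phi> X \<le> 1" "\<And>X y. \<Phi> (X(v := y)) = \<Phi> X"
    and \<Psi>: "\<Psi> \<in> borel_measurable (\<Pi>\<^sub>M i\<in>I. unit_measure)"
      "\<And>X. X \<in> space (\<Pi>\<^sub>M i\<in>I. unit_measure) \<Longrightarrow> 0 \<le> \<Psi> X \<and> \<Psi> X \<le> 1" "\<And>X y. \<Psi> (X(u := y)) = \<Psi> X"
  shows "\<bar>\<integral>X. D (X u, X v) * (\<Phi> X * \<Psi> X) \<partial>(\<Pi>\<^sub>M i\<in>I. unit_measure)\<bar> \<le> \<epsilon>"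
proof -
  define J where "J = I - {u, v}"
  have J: "finite J" "u \<notin> insert v J" "v \<notin> J" "I = insert u (insert v J)"
    using I by (auto simp: J_def)
  let ?P = "\<lambda>I::nat set. \<Pi>\<^sub>M i\<in>I. unit_measure"
  define h where "h X = D (X u, X v) * (\<Phi> X * \<Psi> X)" for X
  note [measurable] = D(1) \<Phi>(1) \<Psi>(1)
  have hm: "h \<in> borel_measurable (?P I)"
    unfolding h_def using measurable_component_pair[OF I(2,3) D(1)] by measurable
  have hB: "\<bar>h X\<bar> \<le> 1" if X: "X \<in> space (?P I)" for X
  proof -
    have "(X u, X v) \<in> space unit_square"
      using component_in_unit[OF X] I by (simp add: space_unit_square)
    then have "\<bar>D (X u, X v)\<bar> \<le> 1" by (rule D(2))
    moreover have "\<bar>\<Phi> X * \<Psi> X\<bar> \<le> 1"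
      by (intro abs_mult_unit_le \<Phi>(2) \<Psi>(2) X)
    ultimately show ?thesis unfolding h_def abs_mult[of "D _"] by (intro mult_le_one) auto
  qed
  have spc: "Z(i := x) \<in> space (?P (insert i K))" if "Z \<in> space (?P K)" "x \<in> {0..1}" for Z i x K
    using that by (auto simp: space_PiM PiE_def extensional_def Pi_def)
  define h1 where "h1 Z = (\<integral>x. h (Z(u := x)) \<partial>unit_measure)" for Z
  have hm1: "h1 \<in> borel_measurable (?P (insert v J))"
  proof -
    have "(\<lambda>(f, y). f(u := y)) \<in> ?P (insert v J) \<Otimes>\<^sub>M unit_measure \<rightarrow>\<^sub>M ?P I"
      unfolding J(4) by (rule measurable_add_dim)
    from measurable_compose[OF this hm]
    have "(\<lambda>p. h ((fst p)(u := snd p))) \<in> borel_measurable (?P (insert v J) \<Otimes>\<^sub>M unit_measure)"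
      by (simp add: case_prod_beta)
    then show ?thesis unfolding h1_def
      by (intro unit.borel_measurable_lebesgue_integral) (simp add: case_prod_beta')
  qed
  have "\<bar>h1 Z\<bar> \<le> 1" if "Z \<in> space (?P (insert v J))" for Z
    unfolding h1_def using spc[OF that] hB J(4) by (intro unit.abs_integral_le) auto
  then have i1: "integrable (?P (insert v J)) h1"
    using hm1 by (intro unitP.P.integrable_bounded_real) auto
  have "(\<integral>X. h X \<partial>?P I) = (\<integral>Z. h1 Z \<partial>?P (insert v J))"
    unfolding J(4) h1_def
    using hm hB J by (intro unitP.product_integral_insert unitP.P.integrable_bounded_real[of _ _ 1]) auto
  also have "\<dots> = (\<integral>Z. \<integral>y. h1 (Z(v := y)) \<partial>unit_measure \<partial>?P J)"
    using J i1 by (intro unitP.product_integral_insert) auto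
  finally have eq: "(\<integral>X. h X \<partial>?P I) = (\<integral>Z. \<integral>y. h1 (Z(v := y)) \<partial>unit_measure \<partial>?P J)" .
  have "\<bar>\<integral>y. h1 (Z(v := y)) \<partial>unit_measure\<bar> \<le> \<epsilon>" if Z: "Z \<in> space (?P J)" for Z
  proof -
    \<comment> \<open>The placeholder 0 only has to lie in [0,1]: \<Phi> ignores coordinate v, and
      likewise \<Psi> ignores u.\<close>
    define f where "f x = \<Phi> (Z(v := 0, u := x))" for x
    define g where "g y = \<Psi> (Z(v := y, u := 0))" for y
    have fm[measurable]: "f \<in> borel_measurable unit_measure"
      unfolding f_def
      by (rule measurable_compose[OF measurable_component_update \<Phi>(1)[unfolded J(4)]]) (use J spc Z in auto)
    have gm[measurable]: "g \<in> borel_measurable unit_measure"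
    proof -
      have "(\<lambda>y. (Z(u := 0))(v := y)) \<in> unit_measure \<rightarrow>\<^sub>M ?P (insert v (insert u J))"
        using J spc[OF Z, of 0 u] by (intro measurable_component_update) (auto simp del: fun_upd_apply)
      moreover have "insert v (insert u J) = I" using J by auto
      moreover have "(Z(u := 0))(v := y) = Z(v := y, u := 0)" for y using I(4) by (simp add: fun_upd_twist)
      ultimately show ?thesis unfolding g_def using measurable_compose[OF _ \<Psi>(1)] by simp
    qed
    have sp: "Z(v := y, u := x) \<in> space (?P I)" if "x \<in> {0..1}" "y \<in> {0..1}" for x y
      unfolding J(4) by (intro spc Z that)
    have fb: "0 \<le> f x \<and> f x \<le> 1" if "x \<in> {0..1}" for x unfolding f_def using that by (intro \<Phi>(2) sp) auto
    have gb: "0 \<le> g x \<and> g x \<le> 1" if "x \<in> {0..1}" for x unfolding g_def using that by (intro \<Psi>(2) sp) auto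
    have h: "h (Z(v := y, u := x)) = D (x, y) * (f x * g y)" for x y
    proof -
      have 1: "\<Phi> (Z(v := y, u := x)) = \<Phi> (Z(u := x))" for y
        using \<Phi>(3)[of "Z(u := x)" y] I(4) by (simp add: fun_upd_twist)
      have 2: "\<Psi> (Z(v := y, u := x)) = \<Psi> (Z(v := y))" for x by (rule \<Psi>(3))
      show ?thesis unfolding h_def f_def g_def 1 2 using I(4) by simp
    qed
    have int: "integrable unit_square (\<lambda>(x, y). D (x, y) * (f x * g y))"
    proof (rule unit2.P.integrable_bounded_real[of _ 1])
      fix z assume z: "z \<in> space unit_square"
      then have "\<bar>D z\<bar> \<le> 1" by (rule D(2))
      moreover have "\<bar>f (fst z) * g (snd z)\<bar> \<le> 1"
        using z by (intro abs_mult_unit_le fb gb) (auto simp: space_unit_square)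
      ultimately have "\<bar>D z\<bar> * \<bar>f (fst z) * g (snd z)\<bar> \<le> 1" by (intro mult_le_one) auto
      then show "\<bar>case z of (x, y) \<Rightarrow> D (x, y) * (f x * g y)\<bar> \<le> 1"
        by (simp add: case_prod_beta abs_mult)
    qed measurable
    have "(\<integral>y. h1 (Z(v := y)) \<partial>unit_measure) = (\<integral>y. \<integral>x. D (x, y) * (f x * g y) \<partial>unit_measure \<partial>unit_measure)"
      unfolding h1_def h ..
    also have "\<dots> = (\<integral>(x, y). D (x, y) * (f x * g y) \<partial>unit_square)"
      by (rule unit2.integral_snd[OF int])
    also have "\<dots> = (\<integral>z. D z * (f (fst z) * g (snd z)) \<partial>unit_square)"
      by (simp add: case_prod_beta')
    finally show ?thesis using cut_boundD[OF D(3) fm gm fb gb] by simp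
  qed
  then have "\<bar>\<integral>X. h X \<partial>?P I\<bar> \<le> \<epsilon>"
    unfolding eq using D(4) by (intro unitP.P.abs_integral_le)
  then show ?thesis by (simp add: h_def)
qed

text \<open>No other edge contains both ends of a = (u, v), so the remaining product splits into a
  factor independent of v and one independent of u. With the other vertices fixed this is a cut norm
  test of F - F'.\<close>

lemma kernel_product_swap_one:
  assumes I: "finite I" and P: "P \<subseteq> pairs_on I" and a: "a \<in> P"
    and K: "\<And>e. e \<in> P \<Longrightarrow> kernel (K e)" and F: "kernel F" "kernel F'"
    and cut: "cut_bound \<epsilon> (\<lambda>(x, y). F x y - F' x y)" "0 \<le> \<epsilon>"
  shows "\<bar>\<integral>X. (edge_weights F X a - edge_weights F' X a) * (\<Prod>e\<in>P - {a}. edge_weights (K e) X e)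
      \<partial>(\<Pi>\<^sub>M i\<in>I. unit_measure)\<bar> \<le> \<epsilon>"
proof -
  obtain u v where uv: "a = (u, v)" "u \<in> I" "v \<in> I" "u < v" using a P by (auto simp: pairs_on_def)
  have finP: "finite P" using P I finite_subset finite_pairs_on by blast
  \<comment> \<open>A collects the other edges at v; everything else, including edges that touch
    neither end, goes to \<open>A'\<close>.\<close>
  define A where "A = {e \<in> P - {a}. fst e = v \<or> snd e = v}"
  define A' where "A' = P - {a} - A"
  define \<Phi> where "\<Phi> X = (\<Prod>e\<in>A'. edge_weights (K e) X e)" for X
  define \<Psi> where "\<Psi> X = (\<Prod>e\<in>A. edge_weights (K e) X e)" for X
  have sub: "A \<subseteq> P" "A' \<subseteq> P" by (auto simp: A_def A'_def)
  have meas: "(\<lambda>X. \<Prod>e\<in>Q. edge_weights (K e) X e) \<in> borel_measurable (\<Pi>\<^sub>M i\<in>I. unit_measure)" if "Q \<subseteq> P" for Q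
    using that K P by (intro borel_measurable_prod measurable_edge_weights kernelD(1)) auto
  have bnd: "0 \<le> (\<Prod>e\<in>Q. edge_weights (K e) X e) \<and> (\<Prod>e\<in>Q. edge_weights (K e) X e) \<le> 1"
    if "Q \<subseteq> P" "X \<in> space (\<Pi>\<^sub>M i\<in>I. unit_measure)" for Q X
  proof -
    have "0 \<le> edge_weights (K e) X e \<and> edge_weights (K e) X e \<le> 1" if "e \<in> Q" for e
      using edge_weights_bounds[OF K \<open>X \<in> _\<close>] P \<open>Q \<subseteq> P\<close> that by blast
    then show ?thesis by (auto intro: prod_nonneg prod_le_1)
  qed
  have noA: "fst e \<noteq> u \<and> snd e \<noteq> u" if "e \<in> A" for e
  proof -
    have "fst e < snd e" using that P by (auto simp: A_def pairs_on_def)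
    moreover have "e \<noteq> (u, v)" "fst e = v \<or> snd e = v" using that uv by (auto simp: A_def)
    ultimately show ?thesis using uv(4) by (cases e) auto
  qed
  have noA': "fst e \<noteq> v \<and> snd e \<noteq> v" if "e \<in> A'" for e
    using that by (auto simp: A_def A'_def)
  have upd: "edge_weights G (X(w := y)) e = edge_weights G X e" if "fst e \<noteq> w \<and> snd e \<noteq> w" for G X w y e
    using that by (auto simp: edge_weights_def case_prod_beta)
  have \<Phi>v: "\<Phi> (X(v := y)) = \<Phi> X" for X y
    unfolding \<Phi>_def by (intro prod.cong refl upd noA')
  have \<Psi>u: "\<Psi> (X(u := y)) = \<Psi> X" for X y
    unfolding \<Psi>_def by (intro prod.cong refl upd noA)
  let ?D = "\<lambda>(x, y). F x y - F' x y"
  have Dm: "?D \<in> borel_measurable unit_square"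
    using borel_measurable_diff[OF kernelD(1)[OF F(1)] kernelD(1)[OF F(2)]] by (simp add: case_prod_beta')
  have Db: "\<bar>?D z\<bar> \<le> 1" if "z \<in> space unit_square" for z
    using that kernelD(2,3)[OF F(1), of "fst z" "snd z"] kernelD(2,3)[OF F(2), of "fst z" "snd z"]
    by (auto simp: space_unit_square abs_le_iff case_prod_beta)
  have split: "(\<Prod>e\<in>P - {a}. edge_weights (K e) X e) = \<Phi> X * \<Psi> X" for X
  proof -
    have "P - {a} = A' \<union> A" "A' \<inter> A = {}" by (auto simp: A_def A'_def)
    then show ?thesis unfolding \<Phi>_def \<Psi>_def
      using finite_subset[OF sub(1) finP] finite_subset[OF sub(2) finP] by (simp add: prod.union_disjoint)
  qed
  have "\<bar>\<integral>X. ?D (X u, X v) * (\<Phi> X * \<Psi> X) \<partial>(\<Pi>\<^sub>M i\<in>I. unit_measure)\<bar> \<le> \<epsilon>"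
  proof (rule cut_bound_integral_component_pair[OF I uv(2,3) less_imp_neq[OF uv(4)] Dm Db cut])
    show "\<Phi> \<in> borel_measurable (\<Pi>\<^sub>M i\<in>I. unit_measure)" "\<Psi> \<in> borel_measurable (\<Pi>\<^sub>M i\<in>I. unit_measure)"
      unfolding \<Phi>_def[abs_def] \<Psi>_def[abs_def] using meas sub by auto
  qed (use bnd sub \<Phi>v \<Psi>u in \<open>auto simp: \<Phi>_def \<Psi>_def\<close>)
  then show ?thesis unfolding split by (simp add: edge_weights_def uv)
qed

text \<open>Telescoping over the edges, A being the set of those already replaced; each replacement
  costs at most \<epsilon>. The kernel may vary with the edge because non-edges of a graph carry 1 -
  F.\<close>

lemma kernel_product_counting:
  assumes I: "finite I" and P: "P \<subseteq> pairs_on I"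
    and K: "\<And>e. e \<in> P \<Longrightarrow> kernel (K e)" "\<And>e. e \<in> P \<Longrightarrow> kernel (K' e)"
    and cut: "\<And>e. e \<in> P \<Longrightarrow> cut_bound \<epsilon> (\<lambda>(x, y). K e x y - K' e x y)" "0 \<le> \<epsilon>"
  shows "\<bar>(\<integral>X. (\<Prod>e\<in>P. edge_weights (K e) X e) \<partial>(\<Pi>\<^sub>M i\<in>I. unit_measure))
     - (\<integral>X. (\<Prod>e\<in>P. edge_weights (K' e) X e) \<partial>(\<Pi>\<^sub>M i\<in>I. unit_measure))\<bar> \<le> real (card P) * \<epsilon>"
proof -
  let ?P = "\<Pi>\<^sub>M i\<in>I. unit_measure"
  have finP: "finite P" using P I finite_subset finite_pairs_on by blast
  let ?mix = "\<lambda>A e. if e \<in> A then K' e else K e"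
  have int: "integrable ?P (\<lambda>X. (\<Prod>e\<in>P. edge_weights (L e) X e))"
    if L: "\<And>e. e \<in> P \<Longrightarrow> kernel (L e)" for L
  proof (rule unitP.P.integrable_bounded_real[of _ _ 1])
    show "(\<lambda>X. \<Prod>e\<in>P. edge_weights (L e) X e) \<in> borel_measurable ?P"
      using L P by (intro borel_measurable_prod measurable_edge_weights kernelD(1)) auto
    fix X assume "X \<in> space ?P"
    then have "0 \<le> edge_weights (L e) X e \<and> edge_weights (L e) X e \<le> 1" if "e \<in> P" for e
      using edge_weights_bounds[OF L, of e X I e] P that by blast
    then show "\<bar>\<Prod>e\<in>P. edge_weights (L e) X e\<bar> \<le> 1"
      by (auto simp: abs_prod intro!: prod_le_1)
  qed
  have "\<bar>(\<integral>X. (\<Prod>e\<in>P. edge_weights (K e) X e) \<partial>?P) - (\<integral>X. (\<Prod>e\<in>P. edge_weights (?mix A e) X e) \<partial>?P)\<bar>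
      \<le> real (card A) * \<epsilon>" if "A \<subseteq> P" for A
    using finite_subset[OF that finP] that
  proof (induction A rule: finite_induct)
    case (insert a A)
    have a: "a \<in> P" using insert by auto
    have mixk: "kernel (?mix A e)" "kernel (?mix (insert a A) e)" if "e \<in> P" for e A using that K by auto
    have pr: "(\<Prod>e\<in>P. edge_weights (?mix A e) X e) - (\<Prod>e\<in>P. edge_weights (?mix (insert a A) e) X e)
       = (edge_weights (K a) X a - edge_weights (K' a) X a) * (\<Prod>e\<in>P - {a}. edge_weights (?mix A e) X e)" for X
    proof -
      have "(\<Prod>e\<in>P - {a}. edge_weights (?mix (insert a A) e) X e) = (\<Prod>e\<in>P - {a}. edge_weights (?mix A e) X e)"
        by (intro prod.cong) auto
      then show ?thesis
        unfolding prod.remove[OF finP a] using insert(2) by (simp add: algebra_simps)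
    qed
    have "(\<integral>X. (\<Prod>e\<in>P. edge_weights (?mix A e) X e) \<partial>?P)
        - (\<integral>X. (\<Prod>e\<in>P. edge_weights (?mix (insert a A) e) X e) \<partial>?P)
       = (\<integral>X. (edge_weights (K a) X a - edge_weights (K' a) X a) * (\<Prod>e\<in>P - {a}. edge_weights (?mix A e) X e) \<partial>?P)"
      unfolding pr[symmetric] by (intro Bochner_Integration.integral_diff[symmetric] int mixk)
    then have "\<bar>(\<integral>X. (\<Prod>e\<in>P. edge_weights (?mix A e) X e) \<partial>?P)
        - (\<integral>X. (\<Prod>e\<in>P. edge_weights (?mix (insert a A) e) X e) \<partial>?P)\<bar> \<le> \<epsilon>"
      using kernel_product_swap_one[OF I P a mixk(1) K(1)[OF a] K(2)[OF a] cut(1)[OF a] cut(2)] by simp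
    moreover have "\<bar>(\<integral>X. (\<Prod>e\<in>P. edge_weights (K e) X e) \<partial>?P) - (\<integral>X. (\<Prod>e\<in>P. edge_weights (?mix A e) X e) \<partial>?P)\<bar>
      \<le> real (card A) * \<epsilon>" using insert by auto
    ultimately show ?case using insert(1,2) by (simp add: algebra_simps)
  qed simp
  from this[of P] have "\<bar>(\<integral>X. (\<Prod>e\<in>P. edge_weights (K e) X e) \<partial>?P) - (\<integral>X. (\<Prod>e\<in>P. edge_weights (?mix P e) X e) \<partial>?P)\<bar>
      \<le> real (card P) * \<epsilon>" by simp
  moreover have "(\<Prod>e\<in>P. edge_weights (?mix P e) X e) = (\<Prod>e\<in>P. edge_weights (K' e) X e)" for X
    by (intro prod.cong) auto
  ultimately show ?thesis by simp
qed

text \<open>Counting lemma. At a non-edge the difference of the factors is -(F - F'), which passes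
  the same cut norm tests.\<close>

lemma kernel_density_counting:
  assumes F: "kernel F" "kernel F'" and cut: "cut_bound \<epsilon> (\<lambda>(x, y). F x y - F' x y)" "0 \<le> \<epsilon>"
  shows "\<bar>kernel_density H F - kernel_density H F'\<bar> \<le> real (card (pairs_on (verts H))) * \<epsilon>"
proof -
  let ?K = "\<lambda>F e. if e \<in> edge_pairs H then F else (\<lambda>x y. 1 - F x y :: real)"
  have eq: "kernel_density H F = (\<integral>X. (\<Prod>e\<in>pairs_on (verts H). edge_weights (?K F e) X e) \<partial>(\<Pi>\<^sub>M i\<in>verts H. unit_measure))" for F
    unfolding kernel_density_def bern_def
    by (intro Bochner_Integration.integral_cong prod.cong) (auto simp: edge_weights_def case_prod_beta)
  have "cut_bound \<epsilon> (\<lambda>(x, y). (1 - F x y) - (1 - F' x y))"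
    using cut_bound_uminus[OF cut(1)] by (simp add: case_prod_beta')
  then show ?thesis unfolding eq using F cut
    by (intro kernel_product_counting) (auto intro: kernel_compl)
qed

section \<open>Entropy of kernels and of sampled graphs\<close>

lemma binary_entropy_eta: "binary_entropy x = eta x + eta (1 - x)"
  by (simp add: binary_entropy_def eta_def algebra_simps)

lemma binary_entropy_bounds:
  assumes "0 \<le> x" "x \<le> 1"
  shows "0 \<le> binary_entropy x" "binary_entropy x \<le> 1"
proof -
  show "0 \<le> binary_entropy x"
    using assms eta_nonneg[of x] eta_nonneg[of "1 - x"] by (simp add: binary_entropy_eta)
  have "eta x \<le> x + (1/2 - x) / ln 2"
    using eta_le_tangent[of x "1/2"] assms by (simp add: log_divide)
  moreover have "eta (1 - x) \<le> (1 - x) + (1/2 - (1 - x)) / ln 2"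
    using eta_le_tangent[of "1 - x" "1/2"] assms by (simp add: log_divide)
  ultimately show "binary_entropy x \<le> 1"
    unfolding binary_entropy_eta by (simp add: diff_divide_distrib add_divide_distrib)
qed

lemma eta_le_1: "0 \<le> x \<Longrightarrow> x \<le> 1 \<Longrightarrow> eta x \<le> 1"
  using binary_entropy_bounds[of x] eta_nonneg[of "1 - x"] by (simp add: binary_entropy_eta)

lemma measurable_eta [measurable]: "eta \<in> borel_measurable borel"
  unfolding eta_def[abs_def] by measurable

lemma measurable_binary_entropy [measurable]: "binary_entropy \<in> borel_measurable borel"
  unfolding binary_entropy_def[abs_def] by measurable

text \<open>Jensen's inequality by integrating the tangent at the mean p. At p = 0 there is no
  tangent, but then f vanishes almost everywhere.\<close>

lemma (in prob_space) expectation_eta_le: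
  fixes f :: "'a \<Rightarrow> real"
  assumes f: "f \<in> borel_measurable M" "\<And>x. x \<in> space M \<Longrightarrow> 0 \<le> f x \<and> f x \<le> 1"
  shows "expectation (\<lambda>x. eta (f x)) \<le> eta (expectation f)"
proof -
  note [measurable] = f(1)
  have int: "integrable M f" "integrable M (\<lambda>x. eta (f x))"
    using f(2) by (auto intro!: integrable_bounded_real[of _ 1] simp: abs_of_nonneg eta_nonneg eta_le_1)
  define p where "p = expectation f"
  have p: "0 \<le> p" unfolding p_def using f(2) by (intro integral_nonneg_AE) auto
  show ?thesis
  proof (cases "p = 0")
    case True
    then have "AE x in M. f x = 0"
      using integral_nonneg_eq_0_iff_AE[OF int(1)] f(2) by (auto simp: p_def)
    then have "expectation (\<lambda>x. eta (f x)) = expectation (\<lambda>x. 0)"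
      by (intro integral_cong_AE) auto
    then show ?thesis using True by (simp add: p_def)
  next
    case False
    then have "p > 0" using p by simp
    have "expectation (\<lambda>x. eta (f x)) \<le> expectation (\<lambda>x. - f x * log 2 p + (p - f x) / ln 2)"
    proof (rule integral_mono)
      fix x assume "x \<in> space M"
      then show "eta (f x) \<le> - f x * log 2 p + (p - f x) / ln 2"
        using f(2) \<open>p > 0\<close> by (intro eta_le_tangent) auto
    qed (use int in auto)
    also have "\<dots> = - p * log 2 p"
      using int by (simp add: p_def prob_space)
    finally show ?thesis by (simp add: eta_def p_def)
  qed
qed

lemma log_bern:
  assumes "finite P" "bern E P w \<noteq> 0"
  shows "log 2 (bern E P w) = (\<Sum>e\<in>P. log 2 (if e \<in> E then w e else 1 - w e))"
  using assms by (simp add: bern_def log_def ln_prod sum_divide_distrib)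

text \<open>Entropies of independent bits add up. Patterns of probability 0 contribute nothing on
  either side, so the logarithm of the product may be expanded throughout.\<close>

lemma sum_eta_bern:
  assumes "finite P"
  shows "(\<Sum>E\<in>Pow P. eta (bern E P w)) = (\<Sum>e\<in>P. binary_entropy (w e))"
proof -
  have "eta (bern E P w) = bern E P w * (\<Sum>e\<in>P. - log 2 (if e \<in> E then w e else 1 - w e))" for E
    by (cases "bern E P w = 0") (simp_all add: eta_def log_bern[OF assms] sum_negf)
  then have "(\<Sum>E\<in>Pow P. eta (bern E P w))
      = (\<Sum>E\<in>Pow P. bern E P w * (\<Sum>e\<in>P. - log 2 (if e \<in> E then w e else 1 - w e)))" by simp
  also have "\<dots> = (\<Sum>e\<in>P. w e * (- log 2 (w e)) + (1 - w e) * (- log 2 (1 - w e)))"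
    using sum_bern_times[OF assms, of w "\<lambda>e b. - log 2 (if b then w e else 1 - w e)"] by simp
  finally show ?thesis by (simp add: binary_entropy_def)
qed

definition kernel_entropy :: "(real \<Rightarrow> real \<Rightarrow> real) \<Rightarrow> real" where
  "kernel_entropy F = (\<integral>z. binary_entropy (case_prod F z) \<partial>unit_square)"

lemma integrable_binary_entropy_kernel:
  assumes "kernel F"
  shows "integrable unit_square (\<lambda>z. binary_entropy (case_prod F z))"
proof (rule unit2.P.integrable_bounded_real[of _ 1])
  show "(\<lambda>z. binary_entropy (case_prod F z)) \<in> borel_measurable unit_square"
    using measurable_compose[OF kernelD(1)[OF assms] measurable_binary_entropy] by simp
  fix z assume "z \<in> space unit_square"
  then have "0 \<le> case_prod F z" "case_prod F z \<le> 1"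
    using kernelD[OF assms] by (auto simp: space_unit_square)
  from binary_entropy_bounds[OF this] show "\<bar>binary_entropy (case_prod F z)\<bar> \<le> 1" by simp
qed

lemma graphon_entropy_eq: "graphon_entropy W = kernel_entropy (graphon_fun W)"
  unfolding graphon_entropy_def kernel_entropy_def
  using unit2.integral_fst'[OF integrable_binary_entropy_kernel[OF kernel_graphon_fun[of W]]] by simp

lemma kernel_entropy_bounds:
  assumes "kernel F" shows "0 \<le> kernel_entropy F" "kernel_entropy F \<le> 1"
proof -
  have *: "0 \<le> case_prod F z \<and> case_prod F z \<le> 1" if "z \<in> space unit_square" for z
    using kernelD[OF assms] that by (auto simp: space_unit_square)
  show "0 \<le> kernel_entropy F" unfolding kernel_entropy_def
    using * by (intro integral_nonneg_AE AE_I2 binary_entropy_bounds) auto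
  have "kernel_entropy F \<le> (\<integral>z. 1 \<partial>unit_square)"
    unfolding kernel_entropy_def using *
    by (intro integral_mono integrable_binary_entropy_kernel assms binary_entropy_bounds) auto
  then show "kernel_entropy F \<le> 1" by (simp add: unit2.P.prob_space)
qed

lemma integral_sum_edges:
  assumes I: "finite I" and g: "integrable unit_square g"
  shows "(\<integral>X. (\<Sum>e\<in>pairs_on I. g (X (fst e), X (snd e))) \<partial>(\<Pi>\<^sub>M i\<in>I. unit_measure))
     = card (pairs_on I) * (\<integral>z. g z \<partial>unit_square)"
    and "integrable (\<Pi>\<^sub>M i\<in>I. unit_measure) (\<lambda>X. \<Sum>e\<in>pairs_on I. g (X (fst e), X (snd e)) :: real)"
proof -
  let ?P = "\<Pi>\<^sub>M i\<in>I. unit_measure"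
  have e: "integrable ?P (\<lambda>X. g (X (fst e), X (snd e)))"
    "(\<integral>X. g (X (fst e), X (snd e)) \<partial>?P) = (\<integral>z. g z \<partial>unit_square)" if "e \<in> pairs_on I" for e
  proof -
    have uv: "fst e \<in> I" "snd e \<in> I" "fst e \<noteq> snd e" using that by (auto simp: pairs_on_def)
    have m: "(\<lambda>X. (X (fst e), X (snd e))) \<in> ?P \<rightarrow>\<^sub>M unit_square" using uv by measurable
    show "integrable ?P (\<lambda>X. g (X (fst e), X (snd e)))"
      using integrable_distr[OF m, of g] g by (simp add: distr_component_pair[OF uv])
    show "(\<integral>X. g (X (fst e), X (snd e)) \<partial>?P) = (\<integral>z. g z \<partial>unit_square)"
      using integral_component_pair[OF uv] g by auto
  qed
  show "integrable ?P (\<lambda>X. \<Sum>e\<in>pairs_on I. g (X (fst e), X (snd e)))"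
    using e(1) by (intro Bochner_Integration.integrable_sum)
  have "(\<integral>X. (\<Sum>e\<in>pairs_on I. g (X (fst e), X (snd e))) \<partial>?P)
      = (\<Sum>e\<in>pairs_on I. \<integral>X. g (X (fst e), X (snd e)) \<partial>?P)"
    using e(1) by (intro Bochner_Integration.integral_sum)
  then show "(\<integral>X. (\<Sum>e\<in>pairs_on I. g (X (fst e), X (snd e))) \<partial>?P)
     = card (pairs_on I) * (\<integral>z. g z \<partial>unit_square)"
    using e(2) by simp
qed

text \<open>\<open>kernel_density\<close> with the graph replaced by an index set and an edge set,
  so that sums over all patterns run over a \<open>Pow\<close>.\<close>

definition pattern_density :: "nat set \<Rightarrow> (real \<Rightarrow> real \<Rightarrow> real) \<Rightarrow> (nat \<times> nat) set \<Rightarrow> real" where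
  "pattern_density I F E = (\<integral>X. bern E (pairs_on I) (edge_weights F X) \<partial>(\<Pi>\<^sub>M i\<in>I. unit_measure))"

lemma sum_labelled_graphs_density:
  assumes "1 \<le> k"
  shows "(\<Sum>H\<in>labelled_graphs k. \<phi> (kernel_density H F))
    = (\<Sum>E\<in>Pow (pairs_on {1..k}). \<phi> (pattern_density {1..k} F E))"
proof -
  have "(\<Sum>H\<in>labelled_graphs k. \<phi> (kernel_density H F))
     = (\<Sum>H\<in>labelled_graphs k. \<phi> (pattern_density {1..k} F (edge_pairs H)))"
    by (intro sum.cong) (auto simp: labelled_graphs_def kernel_density_def pattern_density_def verts_def)
  also have "\<dots> = (\<Sum>E\<in>Pow (pairs_on {1..k}). \<phi> (pattern_density {1..k} F E))"
    by (rule sum.reindex_bij_betw[OF bij_betw_edge_pairs[OF assms]])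
  finally show ?thesis .
qed

lemma sum_pattern_density:
  assumes "finite I" "kernel F"
  shows "(\<Sum>E\<in>Pow (pairs_on I). pattern_density I F E) = 1"
proof -
  have "(\<Sum>E\<in>Pow (pairs_on I). pattern_density I F E)
     = (\<integral>X. (\<Sum>E\<in>Pow (pairs_on I). bern E (pairs_on I) (edge_weights F X)) \<partial>(\<Pi>\<^sub>M i\<in>I. unit_measure))"
    unfolding pattern_density_def
    by (intro Bochner_Integration.integral_sum[symmetric] integrable_bern_edge_weights assms order_refl)
  then show ?thesis using assms by (simp add: sum_bern unitP.P.prob_space)
qed

lemma bern_edge_weights_bounds:
  assumes "kernel F" "X \<in> space (\<Pi>\<^sub>M i\<in>I. unit_measure)"
  shows "0 \<le> bern E (pairs_on I) (edge_weights F X) \<and> bern E (pairs_on I) (edge_weights F X) \<le> 1"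
  using bern_bounds[of "pairs_on I" "edge_weights F X"] edge_weights_bounds[OF assms] by blast

lemma pattern_density_nonneg: "kernel F \<Longrightarrow> 0 \<le> pattern_density I F E"
  unfolding pattern_density_def using bern_edge_weights_bounds by (intro integral_nonneg_AE AE_I2) blast

text \<open>Given X the edges are independent, so the conditional entropy is a sum of
  \<open>binary_entropy\<close> over pairs, and every pair of coordinates is uniform on the square.
  Jensen is applied to each pattern separately.\<close>

lemma kernel_entropy_le_sample_entropy:
  assumes F: "kernel F" and k: "1 \<le> k"
  shows "(k choose 2) * kernel_entropy F \<le> (\<Sum>H\<in>labelled_graphs k. eta (kernel_density H F))"
proof -
  let ?I = "{1..k}" let ?P = "\<Pi>\<^sub>M i\<in>?I. unit_measure" and ?Q = "pairs_on ?I"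
  have fin: "finite ?Q" by simp
  have bm: "(\<lambda>X. bern E ?Q (edge_weights F X)) \<in> borel_measurable ?P" for E
    by (rule measurable_bern_edge_weights[OF F order_refl])
  have ie: "integrable ?P (\<lambda>X. eta (bern E ?Q (edge_weights F X)))" for E
  proof (rule unitP.P.integrable_bounded_real[of _ _ 1])
    show "(\<lambda>X. eta (bern E ?Q (edge_weights F X))) \<in> borel_measurable ?P"
      by (rule measurable_compose[OF bm measurable_eta])
    fix X assume "X \<in> space ?P"
    from bern_edge_weights_bounds[OF F this] show "\<bar>eta (bern E ?Q (edge_weights F X))\<bar> \<le> 1"
      by (simp add: abs_of_nonneg eta_nonneg eta_le_1)
  qed
  have "(k choose 2) * kernel_entropy F
      = (\<integral>X. (\<Sum>e\<in>?Q. binary_entropy (case_prod F (X (fst e), X (snd e)))) \<partial>?P)"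
    using integral_sum_edges(1)[OF _ integrable_binary_entropy_kernel[OF F], of ?I]
    by (simp add: card_pairs_on kernel_entropy_def)
  also have "\<dots> = (\<integral>X. (\<Sum>E\<in>Pow ?Q. eta (bern E ?Q (edge_weights F X))) \<partial>?P)"
    unfolding sum_eta_bern[OF fin] by (simp add: edge_weights_def case_prod_beta)
  also have "\<dots> = (\<Sum>E\<in>Pow ?Q. \<integral>X. eta (bern E ?Q (edge_weights F X)) \<partial>?P)"
    by (rule Bochner_Integration.integral_sum[OF ie])
  also have "\<dots> \<le> (\<Sum>E\<in>Pow ?Q. eta (pattern_density ?I F E))"
    unfolding pattern_density_def using bern_edge_weights_bounds[OF F]
    by (intro sum_mono unitP.P.expectation_eta_le bm)
  also have "\<dots> = (\<Sum>H\<in>labelled_graphs k. eta (kernel_density H F))"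
    by (rule sum_labelled_graphs_density[OF k, symmetric])
  finally show ?thesis .
qed

section \<open>Cross entropy relative to step functions\<close>

text \<open>Mean code length of a bit that is 1 with probability a, in the code optimal for
  probability b.\<close>

definition cross_entropy :: "real \<Rightarrow> real \<Rightarrow> real" where
  "cross_entropy a b = - a * log 2 b - (1 - a) * log 2 (1 - b)"

lemma measurable_cross_entropy:
  assumes "kernel F" "kernel V"
  shows "(\<lambda>z. cross_entropy (case_prod F z) (case_prod V z)) \<in> borel_measurable unit_square"
proof -
  note [measurable] = kernelD(1)[OF assms(1)] kernelD(1)[OF assms(2)]
  show ?thesis unfolding cross_entropy_def by measurable
qed

lemma integrable_cross_entropy:
  assumes F: "kernel F" and V: "kernel V"
    and b: "0 < \<epsilon>" "\<And>z. z \<in> space unit_square \<Longrightarrow> \<epsilon> \<le> case_prod V z \<and> case_prod V z \<le> 1 - \<epsilon>"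
  shows "integrable unit_square (\<lambda>z. cross_entropy (case_prod F z) (case_prod V z))"
proof (rule unit2.P.integrable_bounded_real[OF measurable_cross_entropy[OF F V], of "2 * - log 2 \<epsilon>"])
  fix z assume z: "z \<in> space unit_square"
  let ?a = "case_prod F z" and ?v = "case_prod V z"
  have a: "0 \<le> ?a" "?a \<le> 1" using kernelD[OF F] z by (auto simp: space_unit_square)
  have v: "\<epsilon> \<le> ?v" "?v \<le> 1 - \<epsilon>" using b(2)[OF z] by auto
  have l: "log 2 \<epsilon> \<le> log 2 ?v" "log 2 \<epsilon> \<le> log 2 (1 - ?v)" "log 2 ?v \<le> 0" "log 2 (1 - ?v) \<le> 0"
    using v b(1) by auto
  have "0 \<le> ?a * (- log 2 ?v)" "?a * (- log 2 ?v) \<le> - log 2 \<epsilon>"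
    using a l mult_mono[of ?a 1 "- log 2 ?v" "- log 2 \<epsilon>"] by (auto simp: mult_le_0_iff)
  moreover have "0 \<le> (1 - ?a) * (- log 2 (1 - ?v))" "(1 - ?a) * (- log 2 (1 - ?v)) \<le> - log 2 \<epsilon>"
    using a l mult_mono[of "1 - ?a" 1 "- log 2 (1 - ?v)" "- log 2 \<epsilon>"] by (auto simp: mult_le_0_iff)
  ultimately show "\<bar>cross_entropy ?a ?v\<bar> \<le> 2 * - log 2 \<epsilon>" by (simp add: cross_entropy_def)
qed

text \<open>The cross entropy is taken relative to the mixture, over all \<open>card C ^ k\<close> assignments of labels
  to the vertices, of the product measures with edge probabilities \<open>v\<close>.  Keeping only the component
  of the true labels costs \<open>k * log 2 (card C)\<close>.\<close>

lemma sample_entropy_le_cross_entropy: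
  fixes c :: "real \<Rightarrow> 'c"
  assumes F: "kernel F" and k: "1 \<le> k" and V: "kernel (\<lambda>x y. v (c x) (c y))"
    and C: "finite C" "c ` {0..1} \<subseteq> C"
    and b: "0 < \<epsilon>" "\<And>p q. \<epsilon> \<le> v p q \<and> v p q \<le> 1 - \<epsilon>"
  shows "(\<Sum>H\<in>labelled_graphs k. eta (kernel_density H F))
    \<le> k * log 2 (card C) + (k choose 2) * (\<integral>z. cross_entropy (case_prod F z) (case_prod (\<lambda>x y. v (c x) (c y)) z) \<partial>unit_square)"
proof -
  let ?I = "{1..k}" let ?P = "\<Pi>\<^sub>M i\<in>?I. unit_measure" and ?Q = "pairs_on ?I"
  let ?V = "\<lambda>x y. v (c x) (c y)"
  let ?K = "?I \<rightarrow>\<^sub>E C"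
  let ?cr = "\<lambda>z. cross_entropy (case_prod F z) (case_prod ?V z)"
  have fin: "finite ?Q" "finite (Pow ?Q)" "finite ?K" using C by (auto intro: finite_PiE)
  have C0: "C \<noteq> {}" using C(2) by auto
  define m where "m = real (card C)"
  have m: "m > 0" using C(1) C0 by (simp add: m_def card_gt_0_iff)
  have cardK: "real (card ?K) = m ^ k" by (simp add: card_PiE m_def)
  define vw where "vw w = (\<lambda>(i, j). v (w i) (w j))" for w :: "nat \<Rightarrow> 'c"
  have vw: "\<epsilon> \<le> vw w e" "vw w e \<le> 1 - \<epsilon>" for w e
    using b(2) by (auto simp: vw_def case_prod_beta)
  have bpos: "0 < bern E ?Q (vw w)" for E w
    unfolding bern_def using vw[of w] b(1) by (intro prod_pos) (smt (verit))
  define q where "q E = (\<Sum>w\<in>?K. bern E ?Q (vw w)) / m ^ k" for E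
  have Kne: "?K \<noteq> {}" using C0 by (simp add: PiE_eq_empty_iff)
  have qpos: "q E > 0" for E
    unfolding q_def using bpos m fin(3) Kne by (intro divide_pos_pos sum_pos) auto
  have sumq: "(\<Sum>E\<in>Pow ?Q. q E) = 1"
  proof -
    have "(\<Sum>E\<in>Pow ?Q. q E) = (\<Sum>w\<in>?K. \<Sum>E\<in>Pow ?Q. bern E ?Q (vw w)) / m ^ k"
      unfolding q_def sum_divide_distrib[symmetric] by (subst sum.swap) simp
    also have "(\<Sum>w\<in>?K. \<Sum>E\<in>Pow ?Q. bern E ?Q (vw w)) = m ^ k"
      by (simp only: sum_bern[OF fin(1)] cardK[symmetric] sum_constant mult_1_right of_nat_eq_iff)
    also have "m ^ k / m ^ k = 1" using m by simp
    finally show ?thesis .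
  qed
  have logq: "- log 2 (q E) \<le> k * log 2 m + (\<Sum>e\<in>?Q. - log 2 (if e \<in> E then edge_weights ?V X e else 1 - edge_weights ?V X e))"
    if X: "X \<in> space ?P" for E X
  proof -
    define w where "w = restrict (c \<circ> X) ?I"
    have w: "w \<in> ?K" using component_in_unit[OF X] C(2) by (auto simp: w_def)
    have eqw: "bern E ?Q (vw w) = bern E ?Q (edge_weights ?V X)"
      unfolding bern_def by (intro prod.cong) (auto simp: vw_def w_def edge_weights_def pairs_on_def)
    have "bern E ?Q (vw w) \<le> (\<Sum>w\<in>?K. bern E ?Q (vw w))"
      using fin(3) w bpos by (intro member_le_sum) (auto intro: less_imp_le)
    then have "bern E ?Q (vw w) / m ^ k \<le> q E"
      unfolding q_def using m by (intro divide_right_mono) auto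
    then have "log 2 (bern E ?Q (vw w) / m ^ k) \<le> log 2 (q E)"
      using bpos[of E w] m by (intro log_mono) auto
    moreover have "log 2 (bern E ?Q (vw w) / m ^ k) = log 2 (bern E ?Q (vw w)) - k * log 2 m"
      using bpos[of E w] m by (simp add: log_divide log_nat_power)
    moreover have "log 2 (bern E ?Q (vw w)) = (\<Sum>e\<in>?Q. log 2 (if e \<in> E then edge_weights ?V X e else 1 - edge_weights ?V X e))"
      using bpos[of E w] unfolding eqw by (intro log_bern fin(1)) simp
    ultimately show ?thesis by (simp add: sum_negf)
  qed
  have intb: "integrable ?P (\<lambda>X. bern E ?Q (edge_weights F X))" for E
    by (rule integrable_bern_edge_weights[OF F order_refl])
  have intcr: "integrable unit_square ?cr"
    using b by (intro integrable_cross_entropy F V) (auto simp: case_prod_beta)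
  have "(\<Sum>H\<in>labelled_graphs k. eta (kernel_density H F)) = (\<Sum>E\<in>Pow ?Q. eta (pattern_density ?I F E))"
    by (rule sum_labelled_graphs_density[OF k])
  also have "\<dots> \<le> (\<Sum>E\<in>Pow ?Q. - pattern_density ?I F E * log 2 (q E))"
    using qpos sum_pattern_density[OF _ F, of ?I] sumq
    by (intro gibbs_inequality fin(2) pattern_density_nonneg[OF F] less_imp_le[OF qpos]) (auto simp: less_imp_neq[symmetric])
  also have "\<dots> = (\<integral>X. (\<Sum>E\<in>Pow ?Q. bern E ?Q (edge_weights F X) * (- log 2 (q E))) \<partial>?P)"
  proof (subst Bochner_Integration.integral_sum)
    show "(\<Sum>E\<in>Pow ?Q. - pattern_density ?I F E * log 2 (q E))
       = (\<Sum>E\<in>Pow ?Q. \<integral>X. bern E ?Q (edge_weights F X) * (- log 2 (q E)) \<partial>?P)"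
      unfolding integral_mult_left_zero pattern_density_def by simp
  qed (intro integrable_mult_left intb)
  also have "\<dots> \<le> (\<integral>X. k * log 2 m + (\<Sum>e\<in>?Q. ?cr (X (fst e), X (snd e))) \<partial>?P)"
  proof (rule integral_mono)
    show "integrable ?P (\<lambda>X. \<Sum>E\<in>Pow ?Q. bern E ?Q (edge_weights F X) * (- log 2 (q E)))"
      by (intro Bochner_Integration.integrable_sum integrable_mult_left intb)
    show "integrable ?P (\<lambda>X. k * log 2 m + (\<Sum>e\<in>?Q. ?cr (X (fst e), X (snd e))))"
      using integral_sum_edges(2)[OF _ intcr, of ?I] by (intro Bochner_Integration.integrable_add) auto
  next
    fix X assume X: "X \<in> space ?P"
    let ?g = "\<lambda>e p. - log 2 (if p then edge_weights ?V X e else 1 - edge_weights ?V X e)"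
    have "(\<Sum>E\<in>Pow ?Q. bern E ?Q (edge_weights F X) * (- log 2 (q E)))
       \<le> (\<Sum>E\<in>Pow ?Q. bern E ?Q (edge_weights F X) * (k * log 2 m + (\<Sum>e\<in>?Q. ?g e (e \<in> E))))"
      using bern_edge_weights_bounds[OF F X] logq[OF X] by (intro sum_mono mult_left_mono) auto
    also have "\<dots> = (k * log 2 m) * (\<Sum>E\<in>Pow ?Q. bern E ?Q (edge_weights F X))
       + (\<Sum>E\<in>Pow ?Q. bern E ?Q (edge_weights F X) * (\<Sum>e\<in>?Q. ?g e (e \<in> E)))"
      by (subst sum_distrib_left) (simp only: distrib_left sum.distrib mult.commute)
    also have "\<dots> = k * log 2 m + (\<Sum>e\<in>?Q. ?cr (X (fst e), X (snd e)))"
      unfolding sum_bern[OF fin(1)] sum_bern_times[OF fin(1), of _ ?g]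
      by (simp add: cross_entropy_def edge_weights_def case_prod_beta)
    finally show "(\<Sum>E\<in>Pow ?Q. bern E ?Q (edge_weights F X) * (- log 2 (q E)))
       \<le> k * log 2 m + (\<Sum>e\<in>?Q. ?cr (X (fst e), X (snd e)))" .
  qed
  also have "\<dots> = k * log 2 m + (k choose 2) * (\<integral>z. ?cr z \<partial>unit_square)"
    using integral_sum_edges[OF _ intcr, of ?I]
    by (subst Bochner_Integration.integral_add) (auto simp: unitP.P.prob_space card_pairs_on)
  finally show ?thesis by (simp add: m_def)
qed

section \<open>Approximation in L1 by step functions on rectangles\<close>

inductive rect_step :: "(real \<times> real \<Rightarrow> real) \<Rightarrow> bool" where
  zero: "rect_step (\<lambda>_. 0)"
| add: "rect_step s \<Longrightarrow> A \<in> sets unit_measure \<Longrightarrow> B \<in> sets unit_measure \<Longrightarrow>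
    rect_step (\<lambda>z. s z + a * indicator (A \<times> B) z)"

lemma rect_step_plus:
  assumes "rect_step s" "rect_step t"
  shows "rect_step (\<lambda>z. s z + t z)"
  using assms(2)
proof (induction rule: rect_step.induct)
  case (add t A B a)
  then have "rect_step (\<lambda>z. (s z + t z) + a * indicator (A \<times> B) z)" by (intro rect_step.add) auto
  then show ?case by (simp add: add.assoc)
qed (simp add: assms)

lemma rect_step_scale: "rect_step s \<Longrightarrow> rect_step (\<lambda>z. r * s z)"
proof (induction rule: rect_step.induct)
  case (add s A B a)
  then have "rect_step (\<lambda>z. r * s z + (r * a) * indicator (A \<times> B) z)" by (intro rect_step.add) auto
  then show ?case by (simp add: algebra_simps)
qed (simp add: rect_step.zero)

lemma integrable_rect_step: "rect_step s \<Longrightarrow> integrable unit_square s"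
proof (induction rule: rect_step.induct)
  case (add s A B a)
  then have "integrable unit_square (indicator (A \<times> B) :: _ \<Rightarrow> real)"
    by (intro integrable_real_indicator) (auto simp: unit2.P.emeasure_eq_measure)
  then show ?case using add by (intro Bochner_Integration.integrable_add integrable_mult_right) auto
qed simp

text \<open>A point is labelled by its membership in the sides of all rectangles used so far, two
  bits per rectangle; these bits determine every indicator involved.\<close>

lemma rect_step_labels:
  "rect_step s \<Longrightarrow> \<exists>(c :: real \<Rightarrow> bool list) v. finite (range c) \<and> (\<forall>x y. s (x, y) = v (c x) (c y))"
proof (induction rule: rect_step.induct)
  case zero
  show ?case by (rule exI[of _ "\<lambda>_. []"], rule exI[of _ "\<lambda>_ _. 0"]) auto
next
  case (add s A B a)
  then obtain c :: "real \<Rightarrow> bool list" and v where c: "finite (range c)" "\<And>x y. s (x, y) = v (c x) (c y)"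
    by blast
  define c' where "c' x = (x \<in> A) # (x \<in> B) # c x" for x
  have "range c' \<subseteq> (\<lambda>(p, q, l). p # q # l) ` (UNIV \<times> UNIV \<times> range c)"
  proof (rule image_subsetI)
    fix x show "c' x \<in> (\<lambda>(p, q, l). p # q # l) ` (UNIV \<times> UNIV \<times> range c)"
      by (rule image_eqI[of _ _ "(x \<in> A, x \<in> B, c x)"]) (auto simp: c'_def)
  qed
  moreover have "finite ((\<lambda>(p, q, l). p # q # l) ` (UNIV \<times> UNIV \<times> range c))"
    using c(1) by (simp add: finite_imageI)
  ultimately have "finite (range c')" by (rule finite_subset)
  \<comment> \<open>The first bit of the label of x decides x \<in> A, the second bit of the label
    of y decides y \<in> B, and the tails are the old labels.\<close>
  moreover define v' where "v' l l' = v (tl (tl l)) (tl (tl l')) + a * (if hd l \<and> hd (tl l') then 1 else 0)" for l l'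
  have "s (x, y) + a * indicator (A \<times> B) (x, y) = v' (c' x) (c' y)" for x y
    by (simp add: c'_def v'_def c(2) indicator_def)
  ultimately show ?case by (intro exI[of _ c'] exI[of _ v']) auto
qed

definition rect_approx :: "(real \<times> real \<Rightarrow> real) \<Rightarrow> bool" where
  "rect_approx f \<longleftrightarrow> (\<forall>\<tau>>0. \<exists>s. rect_step s \<and> (\<integral>z. \<bar>f z - s z\<bar> \<partial>unit_square) < \<tau>)"

lemma rect_approx_step: "rect_step s \<Longrightarrow> rect_approx s"
  unfolding rect_approx_def by (auto intro!: exI[of _ s])

lemma rect_approx_L1_limit:
  assumes int: "integrable unit_square f" and "\<And>n. integrable unit_square (g n)" "\<And>n. rect_approx (g n)"
    and lim: "(\<lambda>n. \<integral>z. \<bar>f z - g n z\<bar> \<partial>unit_square) \<longlonglongrightarrow> 0"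
  shows "rect_approx f"
  unfolding rect_approx_def
proof (intro allI impI)
  fix \<tau> :: real assume "\<tau> > 0"
  then have "\<forall>\<^sub>F n in sequentially. (\<integral>z. \<bar>f z - g n z\<bar> \<partial>unit_square) < \<tau> / 2"
    using lim by (intro order_tendstoD) auto
  then obtain n where n: "(\<integral>z. \<bar>f z - g n z\<bar> \<partial>unit_square) < \<tau> / 2"
    by (auto simp: eventually_sequentially)
  obtain s where s: "rect_step s" "(\<integral>z. \<bar>g n z - s z\<bar> \<partial>unit_square) < \<tau> / 2"
    using assms(3)[of n] \<open>\<tau> > 0\<close> unfolding rect_approx_def by (meson half_gt_zero)
  note i = int assms(2)[of n] integrable_rect_step[OF s(1)]
  have "(\<integral>z. \<bar>f z - s z\<bar> \<partial>unit_square) \<le> (\<integral>z. \<bar>f z - g n z\<bar> + \<bar>g n z - s z\<bar> \<partial>unit_square)"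
    using i by (intro integral_mono) auto
  also have "\<dots> = (\<integral>z. \<bar>f z - g n z\<bar> \<partial>unit_square) + (\<integral>z. \<bar>g n z - s z\<bar> \<partial>unit_square)"
    using i by (intro Bochner_Integration.integral_add) auto
  finally show "\<exists>s. rect_step s \<and> (\<integral>z. \<bar>f z - s z\<bar> \<partial>unit_square) < \<tau>"
    using n s by (intro exI[of _ s]) auto
qed

lemma rect_approx_add:
  assumes "integrable unit_square f" "integrable unit_square g" "rect_approx f" "rect_approx g"
  shows "rect_approx (\<lambda>z. f z + g z)"
  unfolding rect_approx_def
proof (intro allI impI)
  fix \<tau> :: real assume "\<tau> > 0"
  then obtain s t where s: "rect_step s" "(\<integral>z. \<bar>f z - s z\<bar> \<partial>unit_square) < \<tau> / 2"
    and t: "rect_step t" "(\<integral>z. \<bar>g z - t z\<bar> \<partial>unit_square) < \<tau> / 2"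
    using assms(3,4) unfolding rect_approx_def by (meson half_gt_zero)
  note i = assms(1,2) integrable_rect_step[OF s(1)] integrable_rect_step[OF t(1)]
  have "(\<integral>z. \<bar>f z + g z - (s z + t z)\<bar> \<partial>unit_square) \<le> (\<integral>z. \<bar>f z - s z\<bar> + \<bar>g z - t z\<bar> \<partial>unit_square)"
    using i by (intro integral_mono) auto
  also have "\<dots> = (\<integral>z. \<bar>f z - s z\<bar> \<partial>unit_square) + (\<integral>z. \<bar>g z - t z\<bar> \<partial>unit_square)"
    using i by (intro Bochner_Integration.integral_add) auto
  finally show "\<exists>s. rect_step s \<and> (\<integral>z. \<bar>f z + g z - s z\<bar> \<partial>unit_square) < \<tau>"
    using s t rect_step_plus by (intro exI[of _ "\<lambda>z. s z + t z"]) auto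
qed

lemma rect_approx_scale:
  assumes "integrable unit_square f" "rect_approx f"
  shows "rect_approx (\<lambda>z. r * f z)"
proof (cases "r = 0")
  case False
  show ?thesis unfolding rect_approx_def
  proof (intro allI impI)
    fix \<tau> :: real assume "\<tau> > 0"
    then have "\<tau> / \<bar>r\<bar> > 0" using False by simp
    then obtain s where s: "rect_step s" "(\<integral>z. \<bar>f z - s z\<bar> \<partial>unit_square) < \<tau> / \<bar>r\<bar>"
      using assms unfolding rect_approx_def by meson
    have "(\<integral>z. \<bar>r * f z - r * s z\<bar> \<partial>unit_square) = \<bar>r\<bar> * (\<integral>z. \<bar>f z - s z\<bar> \<partial>unit_square)"
      by (simp add: abs_mult flip: right_diff_distrib)
    also have "\<dots> < \<tau>" using s(2) False by (simp add: field_simps)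
    finally show "\<exists>s. rect_step s \<and> (\<integral>z. \<bar>r * f z - s z\<bar> \<partial>unit_square) < \<tau>"
      using rect_step_scale[OF s(1)] by blast
  qed
qed (simp add: rect_approx_step rect_step.zero)

text \<open>Dynkin's argument: rectangles are closed under intersection and generate the product
  sigma-algebra, and the approximable sets are closed under complements and disjoint countable
  unions.\<close>

lemma rect_approx_indicator:
  assumes "A \<in> sets unit_square"
  shows "rect_approx (indicator A)"
proof -
  have int: "integrable unit_square (indicator A :: _ \<Rightarrow> real)" if "A \<in> sets unit_square" for A
    using that by (intro integrable_real_indicator) (auto simp: unit2.P.emeasure_eq_measure)
  have rect: "rect_approx (indicator (A \<times> B))" if "A \<in> sets unit_measure" "B \<in> sets unit_measure" for A B
    using rect_approx_step[OF rect_step.add[OF rect_step.zero that, of 1]] by simp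
  have sub: "{a \<times> b |a b. a \<in> sets unit_measure \<and> b \<in> sets unit_measure} \<subseteq> Pow (space unit_measure \<times> space unit_measure)"
    by (rule pair_measure_closed)
  show ?thesis
    using Int_stable_pair_measure_generator sub assms[unfolded sets_pair_measure]
  proof (induct rule: sigma_sets_induct_disjoint)
    case (basic A)
    then show ?case using rect by auto
  next
    case empty
    show ?case using rect_approx_step[OF rect_step.zero] by (simp add: indicator_def[abs_def])
  next
    case (compl A)
    then have A: "A \<in> sets unit_square" by (simp add: sets_pair_measure)
    have U: "rect_approx (indicator ({0..1} \<times> {0..1}))"
      using rect[of "{0..1}" "{0..1}"] sets.top[of unit_measure] by simp
    have Um: "{0..1} \<times> {0..1} \<in> sets unit_square" using sets.top[of unit_square] by (simp add: space_unit_square)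
    have "rect_approx (\<lambda>z. indicator ({0..1} \<times> {0..1}) z + (-1) * indicator A z)"
      by (intro rect_approx_add rect_approx_scale integrable_mult_right int A Um U compl(2))
    moreover have "(\<lambda>z. indicator ({0..1} \<times> {0..1}) z + (-1) * indicator A z)
        = (indicator (space unit_measure \<times> space unit_measure - A) :: _ \<Rightarrow> real)"
      using sets.sets_into_space[OF A] by (auto simp: indicator_def fun_eq_iff space_unit_square)
    ultimately show ?case by simp
  next
    case (union A)
    then have A: "A i \<in> sets unit_square" for i by (auto simp: sets_pair_measure)
    \<comment> \<open>By disjointness the partial sums are indicators below that of the union, so
      the L1 error is a difference of measures and tends to 0 by countable additivity.\<close>
    let ?g = "\<lambda>n z. \<Sum>i<n. indicator (A i) z :: real"
    have ig: "integrable unit_square (?g n)" for n using int A by (intro Bochner_Integration.integrable_sum) auto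
    show ?case
    proof (rule rect_approx_L1_limit[where g = ?g])
      have "\<Union> (range A) \<in> sets unit_square" using A by auto
      then show "integrable unit_square (indicator (\<Union> (range A)) :: _ \<Rightarrow> real)" by (rule int)
      show "integrable unit_square (?g n)" for n by (rule ig)
      show "rect_approx (?g n)" for n
      proof (induction n)
        case 0
        show ?case by (simp add: rect_approx_step rect_step.zero)
      next
        case (Suc n)
        show ?case unfolding sum.lessThan_Suc
          using Suc ig int A union by (intro rect_approx_add) auto
      qed
      have le: "?g n z \<le> indicator (\<Union> (range A)) z" for n z
      proof -
        have "?g n z = indicator (\<Union>i<n. A i) z"
          by (rule indicator_UN_disjoint[symmetric, OF finite_lessThan
                disjoint_family_on_mono[OF subset_UNIV union(1)]])
        also have "\<dots> \<le> indicator (\<Union> (range A)) z" by (rule indicator_leI) auto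
        finally show ?thesis .
      qed
      have "(\<integral>z. \<bar>indicator (\<Union> (range A)) z - ?g n z\<bar> \<partial>unit_square)
         = measure unit_square (\<Union> (range A)) - (\<Sum>i<n. measure unit_square (A i))" for n
      proof -
        have "(\<integral>z. \<bar>indicator (\<Union> (range A)) z - ?g n z\<bar> \<partial>unit_square)
           = (\<integral>z. indicator (\<Union> (range A)) z - ?g n z \<partial>unit_square)"
          using le by (intro Bochner_Integration.integral_cong) auto
        also have "\<dots> = measure unit_square (\<Union> (range A)) - (\<Sum>i<n. measure unit_square (A i))"
          using A ig int by (subst Bochner_Integration.integral_diff)
            (auto simp: Bochner_Integration.integral_sum Int_absorb1 sets.sets_into_space)
        finally show ?thesis .
      qed
      moreover have "(\<lambda>n. measure unit_square (\<Union> (range A)) - (\<Sum>i<n. measure unit_square (A i)))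
          \<longlonglongrightarrow> measure unit_square (\<Union> (range A)) - measure unit_square (\<Union> (range A))"
        using unit2.P.finite_measure_UNION[of A] A union(1)
        by (intro tendsto_diff tendsto_const) (auto simp: sums_def)
      ultimately show "(\<lambda>n. \<integral>z. \<bar>indicator (\<Union> (range A)) z - ?g n z\<bar> \<partial>unit_square) \<longlonglongrightarrow> 0"
        by simp
    qed
  qed
qed

lemma rect_approx_integrable:
  assumes "integrable unit_square f"
  shows "rect_approx f"
  using assms
proof (induction rule: integrable_induct)
  case (base A c)
  then have "integrable unit_square (indicator A :: _ \<Rightarrow> real)" by (intro integrable_real_indicator)
  then have "rect_approx (\<lambda>z. c * indicator A z)" using rect_approx_indicator base by (intro rect_approx_scale) auto
  then show ?case by (simp add: mult.commute)
next
  case (add f g)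
  then show ?case by (intro rect_approx_add)
next
  case (lim f s)
  show ?case
  proof (rule rect_approx_L1_limit[of f s])
    have "(\<lambda>n. \<integral>z. \<bar>f z - s n z\<bar> \<partial>unit_square) \<longlonglongrightarrow> (\<integral>z. 0 \<partial>unit_square)"
    \<comment> \<open>The induction rule provides approximations with |s n| \<le> 2 |f|, whence |f -
      s n| \<le> 3 |f|.\<close>
    proof (rule integral_dominated_convergence[where w = "\<lambda>z. 3 * \<bar>f z\<bar>"])
      show "AE z in unit_square. (\<lambda>n. \<bar>f z - s n z\<bar>) \<longlonglongrightarrow> 0"
      proof (rule AE_I2)
        fix z assume "z \<in> space unit_square"
        from tendsto_rabs[OF tendsto_diff[OF tendsto_const[of "f z"] lim.hyps(2)[OF this]]]
        show "(\<lambda>n. \<bar>f z - s n z\<bar>) \<longlonglongrightarrow> 0" by simp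
      qed
      show "AE z in unit_square. norm \<bar>f z - s n z\<bar> \<le> 3 * \<bar>f z\<bar>" for n
      proof (rule AE_I2)
        fix z assume "z \<in> space unit_square"
        from lim.hyps(3)[OF this, of n] show "norm \<bar>f z - s n z\<bar> \<le> 3 * \<bar>f z\<bar>" by simp
      qed
    qed (use lim.hyps(1,4) in auto)
    then show "(\<lambda>n. \<integral>z. \<bar>f z - s n z\<bar> \<partial>unit_square) \<longlonglongrightarrow> 0" by simp
  qed (use lim in auto)
qed

section \<open>Choice of the step function for the cross entropy\<close>

definition clamp01 :: "real \<Rightarrow> real \<Rightarrow> real" where
  "clamp01 \<epsilon> x = max \<epsilon> (min (1 - \<epsilon>) x)"

text \<open>If a < \<epsilon>, replacing a by \<epsilon> in the first logarithm only helps, and the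
  second term is at most -log(1 - \<epsilon>). The case 1 - a < \<epsilon> is symmetric, and in
  between nothing is changed.\<close>

lemma cross_entropy_clamp_le:
  assumes a: "0 \<le> a" "a \<le> 1" and \<epsilon>: "0 < \<epsilon>" "\<epsilon> < 1/2"
  shows "cross_entropy a (clamp01 \<epsilon> a) \<le> binary_entropy a - log 2 (1 - \<epsilon>)"
proof -
  have key: "cross_entropy a \<epsilon> \<le> binary_entropy a - log 2 (1 - \<epsilon>)" if a: "0 \<le> a" "a < \<epsilon>" for a
  proof -
    have "- a * log 2 \<epsilon> \<le> eta a"
      using a \<epsilon> by (cases "a = 0") (auto simp: eta_def intro!: mult_left_mono)
    moreover have "- (1 - a) * log 2 (1 - \<epsilon>) \<le> - log 2 (1 - \<epsilon>)"
      using a \<epsilon> mult_nonneg_nonpos[of a "log 2 (1 - \<epsilon>)"] by (simp add: algebra_simps)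
    moreover have "0 \<le> eta (1 - a)" using a \<epsilon> by (intro eta_nonneg) auto
    ultimately show ?thesis by (simp add: cross_entropy_def binary_entropy_eta algebra_simps)
  qed
  consider "a < \<epsilon>" | "1 - a < \<epsilon>" | "\<epsilon> \<le> a" "a \<le> 1 - \<epsilon>" by linarith
  then show ?thesis
  proof cases
    case 1
    then show ?thesis using key[of a] a \<epsilon> by (simp add: clamp01_def)
  next
    case 2
    then have "clamp01 \<epsilon> a = 1 - \<epsilon>" using \<epsilon> by (simp add: clamp01_def)
    moreover have "cross_entropy (1 - a) \<epsilon> = cross_entropy a (1 - \<epsilon>)" "binary_entropy (1 - a) = binary_entropy a"
      by (simp_all add: cross_entropy_def binary_entropy_def algebra_simps)
    ultimately show ?thesis using key[of "1 - a"] a 2 by simp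
  next
    case 3
    then have "clamp01 \<epsilon> a = a" by (simp add: clamp01_def)
    moreover have "log 2 (1 - \<epsilon>) \<le> 0" using \<epsilon> by simp
    ultimately show ?thesis by (simp add: cross_entropy_def binary_entropy_def)
  qed
qed

lemma log_lipschitz:
  assumes "0 < \<epsilon>" "\<epsilon> \<le> x" "\<epsilon> \<le> y"
  shows "log 2 y - log 2 x \<le> \<bar>x - y\<bar> / (\<epsilon> * ln 2)"
proof -
  have pos: "x > 0" "y > 0" using assms by auto
  have "ln y - ln x = ln (y / x)" using pos by (simp add: ln_div)
  also have "\<dots> \<le> y / x - 1" using pos by (intro ln_le_minus_one) simp
  also have "\<dots> = (y - x) / x" using pos by (simp add: field_simps)
  also have "\<dots> \<le> \<bar>x - y\<bar> / x" using pos by (intro divide_right_mono) auto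
  also have "\<dots> \<le> \<bar>x - y\<bar> / \<epsilon>" using assms by (intro divide_left_mono) auto
  finally have "(ln y - ln x) / ln 2 \<le> (\<bar>x - y\<bar> / \<epsilon>) / ln 2" by (intro divide_right_mono) auto
  then show ?thesis by (simp add: log_def diff_divide_distrib)
qed

lemma cross_entropy_lipschitz:
  assumes a: "0 \<le> a" "a \<le> 1" and \<epsilon>: "0 < \<epsilon>" and "\<epsilon> \<le> x" "x \<le> 1 - \<epsilon>" "\<epsilon> \<le> y" "y \<le> 1 - \<epsilon>"
  shows "cross_entropy a x \<le> cross_entropy a y + \<bar>x - y\<bar> / (\<epsilon> * ln 2)"
proof -
  define d where "d = \<bar>x - y\<bar> / (\<epsilon> * ln 2)"
  have "log 2 y - log 2 x \<le> d" "log 2 (1 - y) - log 2 (1 - x) \<le> d"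
    unfolding d_def using log_lipschitz[of \<epsilon> x y] log_lipschitz[of \<epsilon> "1 - x" "1 - y"] assms by (auto simp: abs_minus_commute)
  then have "a * (log 2 y - log 2 x) + (1 - a) * (log 2 (1 - y) - log 2 (1 - x)) \<le> a * d + (1 - a) * d"
    using a by (intro add_mono mult_left_mono) auto
  then show ?thesis unfolding d_def[symmetric] by (simp add: cross_entropy_def algebra_simps)
qed

lemma clamp01_bounds: "0 < \<epsilon> \<Longrightarrow> \<epsilon> < 1/2 \<Longrightarrow> \<epsilon> \<le> clamp01 \<epsilon> x \<and> clamp01 \<epsilon> x \<le> 1 - \<epsilon>"
  by (auto simp: clamp01_def)

text \<open>Clamping F first makes the cross entropy Lipschitz in its second argument, so that an L1
  approximation of the clamped function is enough. The approximation is clamped again to keep its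
  values away from 0 and 1.\<close>

lemma exists_step_cross_entropy:
  assumes F: "kernel F" and \<delta>: "\<delta> > 0"
  obtains c :: "real \<Rightarrow> bool list" and v :: "bool list \<Rightarrow> bool list \<Rightarrow> real" and \<epsilon> :: real where "finite (range c)" "0 < \<epsilon>" "\<And>p q. \<epsilon> \<le> v p q \<and> v p q \<le> 1 - \<epsilon>"
    "kernel (\<lambda>x y. v (c x) (c y))"
    "(\<integral>z. cross_entropy (case_prod F z) (case_prod (\<lambda>x y. v (c x) (c y)) z) \<partial>unit_square) < kernel_entropy F + \<delta>"
proof -
  have "((\<lambda>\<epsilon>. - log 2 (1 - \<epsilon>)) \<longlongrightarrow> 0) (at_right (0::real))" by real_asymp
  then have "\<forall>\<^sub>F \<epsilon> in at_right 0. - log 2 (1 - \<epsilon>) < \<delta> / 2"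
    using \<delta> by (intro order_tendstoD) auto
  moreover have "\<forall>\<^sub>F \<epsilon> in at_right 0. 0 < \<epsilon> \<and> \<epsilon> < (1/2 :: real)"
    by (intro eventually_at_right_less[THEN eventually_conj[rotated]] eventually_conj) (auto simp: eventually_at_right_field intro: exI[of _ "1/2"])
  ultimately have "\<forall>\<^sub>F \<epsilon> in at_right 0. 0 < \<epsilon> \<and> \<epsilon> < (1/2 :: real) \<and> - log 2 (1 - \<epsilon>) < \<delta> / 2"
    by eventually_elim auto
  then obtain \<epsilon> :: real where \<epsilon>: "0 < \<epsilon>" "\<epsilon> < 1/2" "- log 2 (1 - \<epsilon>) < \<delta> / 2"
    using eventually_happens' trivial_limit_at_right_real by (metis (mono_tags, lifting))
  note [measurable] = kernelD(1)[OF F]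
  have cm[measurable]: "clamp01 \<epsilon> \<in> borel_measurable borel" unfolding clamp01_def[abs_def] by measurable
  define f where "f z = clamp01 \<epsilon> (case_prod F z)" for z
  have fm[measurable]: "f \<in> borel_measurable unit_square" unfolding f_def by measurable
  have intf: "integrable unit_square f"
  proof (rule unit2.P.integrable_bounded_real[OF fm])
    show "\<bar>f z\<bar> \<le> 1" for z
      using clamp01_bounds[OF \<epsilon>(1,2), of "case_prod F z"] \<epsilon> by (simp add: f_def)
  qed
  \<comment> \<open>The Lipschitz constant is 1 / (\<epsilon> ln 2), so an L1 error below \<tau>
    costs less than \<delta> / 2; the other half pays for the clamping.\<close>
  define \<tau> where "\<tau> = \<delta> / 2 * (\<epsilon> * ln 2)"
  have "\<tau> > 0" using \<epsilon> \<delta> by (simp add: \<tau>_def)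
  then obtain s where s: "rect_step s" "(\<integral>z. \<bar>f z - s z\<bar> \<partial>unit_square) < \<tau>"
    using rect_approx_integrable[OF intf] unfolding rect_approx_def by blast
  obtain c :: "real \<Rightarrow> bool list" and v0 where c: "finite (range c)" "\<And>x y. s (x, y) = v0 (c x) (c y)"
    using rect_step_labels[OF s(1)] by blast
  have ints: "integrable unit_square s" by (rule integrable_rect_step[OF s(1)])
  then have [measurable]: "s \<in> borel_measurable unit_square" by auto
  define v where "v p q = clamp01 \<epsilon> (v0 p q)" for p q
  have vb: "\<epsilon> \<le> v p q \<and> v p q \<le> 1 - \<epsilon>" for p q
    unfolding v_def by (rule clamp01_bounds[OF \<epsilon>(1,2)])
  let ?V = "\<lambda>x y. v (c x) (c y)"
  have Vs: "case_prod ?V z = clamp01 \<epsilon> (s z)" for z by (cases z) (simp add: v_def c(2))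
  have "(\<lambda>z. clamp01 \<epsilon> (s z)) \<in> borel_measurable unit_square" by measurable
  then have Vm: "case_prod ?V \<in> borel_measurable unit_square" by (simp add: Vs[symmetric])
  have V: "kernel ?V"
    unfolding kernel_def using Vm vb \<epsilon> by (auto intro: order_trans[of 0 \<epsilon>] order_trans[of _ "1 - \<epsilon>"])
  have pt: "cross_entropy (case_prod F z) (case_prod ?V z)
      \<le> binary_entropy (case_prod F z) - log 2 (1 - \<epsilon>) + \<bar>f z - s z\<bar> / (\<epsilon> * ln 2)"
    if z: "z \<in> space unit_square" for z
  proof -
    have a: "0 \<le> case_prod F z" "case_prod F z \<le> 1" using kernelD[OF F] z by (auto simp: space_unit_square)
    have "cross_entropy (case_prod F z) (case_prod ?V z)
        \<le> cross_entropy (case_prod F z) (f z) + \<bar>case_prod ?V z - f z\<bar> / (\<epsilon> * ln 2)"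
      unfolding Vs f_def using clamp01_bounds[OF \<epsilon>(1,2)] by (intro cross_entropy_lipschitz a \<epsilon>(1)) auto
    moreover have "cross_entropy (case_prod F z) (f z) \<le> binary_entropy (case_prod F z) - log 2 (1 - \<epsilon>)"
      unfolding f_def by (rule cross_entropy_clamp_le[OF a \<epsilon>(1,2)])
    moreover have "\<bar>case_prod ?V z - f z\<bar> / (\<epsilon> * ln 2) \<le> \<bar>f z - s z\<bar> / (\<epsilon> * ln 2)"
    proof (rule divide_right_mono)
      \<comment> \<open>The clamp fixes f and is 1-Lipschitz, so clamping s brings it no farther
        from f.\<close>
      have "clamp01 \<epsilon> (f z) = f z" using clamp01_bounds[OF \<epsilon>(1,2), of "case_prod F z"] by (auto simp: f_def clamp01_def)
      then show "\<bar>case_prod ?V z - f z\<bar> \<le> \<bar>f z - s z\<bar>"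
        unfolding Vs using \<epsilon> by (auto simp: clamp01_def)
    qed (use \<epsilon> in auto)
    ultimately show ?thesis by linarith
  qed
  have "(\<integral>z. cross_entropy (case_prod F z) (case_prod ?V z) \<partial>unit_square)
    \<le> (\<integral>z. binary_entropy (case_prod F z) - log 2 (1 - \<epsilon>) + \<bar>f z - s z\<bar> / (\<epsilon> * ln 2) \<partial>unit_square)"
  proof (rule integral_mono[OF _ _ pt])
    show "integrable unit_square (\<lambda>z. cross_entropy (case_prod F z) (case_prod ?V z))"
      using vb \<epsilon>(1) by (intro integrable_cross_entropy[OF F V \<epsilon>(1)]) (auto simp: case_prod_beta)
    show "integrable unit_square (\<lambda>z. binary_entropy (case_prod F z) - log 2 (1 - \<epsilon>) + \<bar>f z - s z\<bar> / (\<epsilon> * ln 2))"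
      using integrable_binary_entropy_kernel[OF F] intf ints by auto
  qed
  also have "\<dots> = kernel_entropy F - log 2 (1 - \<epsilon>) + (\<integral>z. \<bar>f z - s z\<bar> \<partial>unit_square) / (\<epsilon> * ln 2)"
    using integrable_binary_entropy_kernel[OF F] intf ints by (simp add: kernel_entropy_def unit2.P.prob_space)
  also have "\<dots> < kernel_entropy F + \<delta>"
  proof -
    have "(\<integral>z. \<bar>f z - s z\<bar> \<partial>unit_square) / (\<epsilon> * ln 2) < \<delta> / 2"
      using s(2) \<epsilon>(1) by (simp add: \<tau>_def pos_divide_less_eq)
    then show ?thesis using \<epsilon>(3) by linarith
  qed
  finally show ?thesis using that[of c \<epsilon> v] c(1) \<epsilon>(1) vb V by blast
qed

lemma real_choose_2: "real (n choose 2) = real n * (real n - 1) / 2"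
  by (induction n) (simp_all add: numeral_2_eq_2 field_simps)

lemma sample_entropy_less_kernel_entropy:
  assumes F: "kernel F" and \<delta>: "\<delta> > 0"
  shows "\<exists>k\<ge>2. (\<Sum>H\<in>labelled_graphs k. eta (kernel_density H F)) / (k choose 2) < kernel_entropy F + \<delta>"
proof (rule exists_step_cross_entropy[OF F half_gt_zero[OF \<delta>]])
  fix c :: "real \<Rightarrow> bool list" and v :: "bool list \<Rightarrow> bool list \<Rightarrow> real" and \<epsilon> :: real
  let ?J = "\<integral>z. cross_entropy (case_prod F z) (case_prod (\<lambda>x y. v (c x) (c y)) z) \<partial>unit_square"
  assume c: "finite (range c)" "0 < \<epsilon>" "\<And>p q. \<epsilon> \<le> v p q \<and> v p q \<le> 1 - \<epsilon>"
    "kernel (\<lambda>x y. v (c x) (c y))"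
    "?J < kernel_entropy F + \<delta> / 2"
  define L where "L = log 2 (real (card (range c)))"
  \<comment> \<open>The cost of the labels is linear in k while the number of pairs is
    quadratic.\<close>
  have "(\<lambda>k. k * L / (real k * (real k - 1) / 2)) \<longlonglongrightarrow> 0" by real_asymp
  then have "\<forall>\<^sub>F k in sequentially. k * L / (real k * (real k - 1) / 2) < \<delta> / 2"
    using \<delta> by (intro order_tendstoD) auto
  then have "\<forall>\<^sub>F k in sequentially. k * L / (real k * (real k - 1) / 2) < \<delta> / 2 \<and> k \<ge> 2"
    using eventually_ge_at_top by (rule eventually_conj)
  then obtain k where k: "k * L / (real k * (real k - 1) / 2) < \<delta> / 2" "k \<ge> 2"
    by (auto simp: eventually_sequentially)
  have ch: "real (k choose 2) = real k * (real k - 1) / 2"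
    by (rule real_choose_2)
  have pos: "real (k choose 2) > 0" using k(2) by (simp add: zero_less_binomial)
  have "(\<Sum>H\<in>labelled_graphs k. eta (kernel_density H F)) \<le> k * L + (k choose 2) * ?J"
    unfolding L_def using c k(2) by (intro sample_entropy_le_cross_entropy[OF F]) auto
  then have "(\<Sum>H\<in>labelled_graphs k. eta (kernel_density H F)) / (k choose 2)
      \<le> (k * L + (k choose 2) * ?J) / (k choose 2)" by (intro divide_right_mono) auto
  also have "\<dots> = k * L / (k choose 2) + ?J" using pos by (simp add: add_divide_distrib)
  also have "\<dots> < \<delta> / 2 + (kernel_entropy F + \<delta> / 2)" using k(1) c(5) unfolding ch by (intro add_strict_mono)
  finally show ?thesis using k(2) by (intro exI[of _ k]) simp
qed

section \<open>Weak regularity\<close>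

definition cell :: "(real \<Rightarrow> 'l) \<Rightarrow> 'l \<Rightarrow> real set" where
  "cell c w = {x \<in> {0..1}. c x = w}"

text \<open>A finite measurable partition given by its label function. Since cells may be empty, one
  set C of labels serves the partitions of all graphons in a sequence.\<close>

definition labelling :: "'l set \<Rightarrow> (real \<Rightarrow> 'l) \<Rightarrow> bool" where
  "labelling C c \<longleftrightarrow> finite C \<and> (\<forall>x\<in>{0..1}. c x \<in> C) \<and> (\<forall>w\<in>C. cell c w \<in> sets unit_measure)"

definition cell_weight :: "(real \<Rightarrow> 'l) \<Rightarrow> 'l \<Rightarrow> real" where
  "cell_weight c w = measure unit_measure (cell c w)"

definition cell_integral :: "(real \<times> real \<Rightarrow> real) \<Rightarrow> (real \<Rightarrow> 'l) \<Rightarrow> 'l \<Rightarrow> 'l \<Rightarrow> real" where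
  "cell_integral K c w w' = (\<integral>z. K z * (indicator (cell c w) (fst z) * indicator (cell c w') (snd z)) \<partial>unit_square)"

lemma labellingD:
  assumes "labelling C c"
  shows "finite C" "x \<in> {0..1} \<Longrightarrow> c x \<in> C" "w \<in> C \<Longrightarrow> cell c w \<in> sets unit_measure"
  using assms by (auto simp: labelling_def)

lemma label_fun_eq_sum:
  assumes "labelling C c" "z \<in> space unit_square"
  shows "\<gamma> (c (fst z)) (c (snd z)) =
    (\<Sum>w\<in>C. \<Sum>w'\<in>C. \<gamma> w w' * (indicator (cell c w) (fst z) * indicator (cell c w') (snd z) :: real))"
proof -
  have z: "fst z \<in> {0..1}" "snd z \<in> {0..1}" using assms(2) by (auto simp: space_unit_square)
  have ind: "indicator (cell c w) x = (if c x = w then 1 else 0 :: real)" if "x \<in> {0..1}" for x w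
    using that by (auto simp: cell_def indicator_def)
  have "(\<Sum>w\<in>C. \<Sum>w'\<in>C. \<gamma> w w' * (indicator (cell c w) (fst z) * indicator (cell c w') (snd z) :: real))
    = (\<Sum>w\<in>C. if c (fst z) = w then \<Sum>w'\<in>C. if c (snd z) = w' then \<gamma> w w' else 0 else 0)"
    unfolding ind[OF z(1)] ind[OF z(2)] by (intro sum.cong) (auto intro!: sum.cong)
  also have "\<dots> = \<gamma> (c (fst z)) (c (snd z))"
    using labellingD(1)[OF assms(1)] labellingD(2)[OF assms(1) z(1)] labellingD(2)[OF assms(1) z(2)] by simp
  finally show ?thesis ..
qed

lemma measurable_label_fun:
  assumes "labelling C c"
  shows "(\<lambda>z. \<gamma> (c (fst z)) (c (snd z)) :: real) \<in> borel_measurable unit_square"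
proof -
  have "(\<lambda>z. \<Sum>w\<in>C. \<Sum>w'\<in>C. \<gamma> w w' * (indicator (cell c w) (fst z) * indicator (cell c w') (snd z) :: real))
      \<in> borel_measurable unit_square"
  proof (intro borel_measurable_sum)
    fix w w' assume "w \<in> C" "w' \<in> C"
    then have [measurable]: "cell c w \<in> sets unit_measure" "cell c w' \<in> sets unit_measure"
      using labellingD[OF assms] by auto
    show "(\<lambda>z. \<gamma> w w' * (indicator (cell c w) (fst z) * indicator (cell c w') (snd z) :: real))
      \<in> borel_measurable unit_square" by measurable
  qed
  then show ?thesis
    by (rule measurable_cong[THEN iffD1, rotated]) (rule label_fun_eq_sum[OF assms, symmetric])
qed

lemma integrable_rectangle:
  assumes "K \<in> borel_measurable unit_square" "\<And>z. z \<in> space unit_square \<Longrightarrow> \<bar>K z\<bar> \<le> B"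
    "A \<in> sets unit_measure" "A' \<in> sets unit_measure"
  shows "integrable unit_square (\<lambda>z. K z * (indicator A (fst z) * indicator A' (snd z)) :: real)"
proof (rule unit2.P.integrable_bounded_real[of _ B])
  note [measurable] = assms(1,3,4)
  show "(\<lambda>z. K z * (indicator A (fst z) * indicator A' (snd z)) :: real) \<in> borel_measurable unit_square" by measurable
  fix z assume "z \<in> space unit_square"
  from assms(2)[OF this] show "\<bar>K z * (indicator A (fst z) * indicator A' (snd z))\<bar> \<le> B"
    by (auto simp: indicator_def)
qed

lemma integral_label_fun:
  assumes lab: "labelling C c" and K: "K \<in> borel_measurable unit_square" "\<And>z. z \<in> space unit_square \<Longrightarrow> \<bar>K z\<bar> \<le> B"
  shows "(\<integral>z. K z * \<gamma> (c (fst z)) (c (snd z)) \<partial>unit_square) = (\<Sum>w\<in>C. \<Sum>w'\<in>C. \<gamma> w w' * cell_integral K c w w')"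
proof -
  let ?g = "\<lambda>w w' z. K z * (indicator (cell c w) (fst z) * indicator (cell c w') (snd z))"
  have int: "integrable unit_square (?g w w')" if "w \<in> C" "w' \<in> C" for w w'
    using that labellingD[OF lab] by (intro integrable_rectangle[OF K]) auto
  have "(\<integral>z. K z * \<gamma> (c (fst z)) (c (snd z)) \<partial>unit_square)
     = (\<integral>z. (\<Sum>w\<in>C. \<Sum>w'\<in>C. \<gamma> w w' * ?g w w' z) \<partial>unit_square)"
    by (intro Bochner_Integration.integral_cong refl, subst label_fun_eq_sum[OF lab])
       (auto simp: sum_distrib_left mult_ac)
  also have "\<dots> = (\<Sum>w\<in>C. \<integral>z. (\<Sum>w'\<in>C. \<gamma> w w' * ?g w w' z) \<partial>unit_square)"
    using int by (intro Bochner_Integration.integral_sum Bochner_Integration.integrable_sum integrable_mult_right)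
  also have "\<dots> = (\<Sum>w\<in>C. \<Sum>w'\<in>C. \<integral>z. \<gamma> w w' * ?g w w' z \<partial>unit_square)"
    using int by (intro sum.cong refl Bochner_Integration.integral_sum integrable_mult_right)
  also have "\<dots> = (\<Sum>w\<in>C. \<Sum>w'\<in>C. \<gamma> w w' * cell_integral K c w w')"
    by (simp add: cell_integral_def)
  finally show ?thesis .
qed

lemma cell_integral_1:
  assumes "labelling C c" "w \<in> C" "w' \<in> C"
  shows "cell_integral (\<lambda>_. 1) c w w' = cell_weight c w * cell_weight c w'"
proof -
  have m: "cell c w \<in> sets unit_measure" "cell c w' \<in> sets unit_measure" using labellingD[OF assms(1)] assms by auto
  have "cell_integral (\<lambda>_. 1) c w w' = (\<integral>z. indicator (cell c w \<times> cell c w') z \<partial>unit_square)"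
    unfolding cell_integral_def by (intro Bochner_Integration.integral_cong) (auto simp: indicator_def)
  also have "\<dots> = measure unit_square (cell c w \<times> cell c w')"
    using m by (simp add: Int_absorb1 sets.sets_into_space)
  also have "\<dots> = cell_weight c w * cell_weight c w'"
    using unit.emeasure_pair_measure_Times[OF m]
    by (simp add: measure_def cell_weight_def enn2real_mult)
  finally show ?thesis .
qed

lemma integral_label_fun_1:
  assumes lab: "labelling C c"
  shows "(\<integral>z. \<gamma> (c (fst z)) (c (snd z)) \<partial>unit_square) = (\<Sum>w\<in>C. \<Sum>w'\<in>C. \<gamma> w w' * (cell_weight c w * cell_weight c w'))"
  using integral_label_fun[OF lab, of "\<lambda>_. 1" 1 \<gamma>] by (simp add: cell_integral_1[OF lab] cong: sum.cong)

section \<open>Averaging over cells\<close>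

text \<open>On a null rectangle the quotient is 0 by convention; this is consistent with
  \<open>cell_average_times\<close> because the integral vanishes there as well.\<close>

definition cell_average :: "(real \<times> real \<Rightarrow> real) \<Rightarrow> (real \<Rightarrow> 'l) \<Rightarrow> 'l \<Rightarrow> 'l \<Rightarrow> real" where
  "cell_average K c w w' = cell_integral K c w w' / (cell_weight c w * cell_weight c w')"

lemma cell_weight_nonneg: "0 \<le> cell_weight c w"
  by (simp add: cell_weight_def)

lemma cell_integral_bounds:
  assumes "labelling C c" "w \<in> C" "w' \<in> C" "kernel F"
  shows "0 \<le> cell_integral (case_prod F) c w w'"
    "cell_integral (case_prod F) c w w' \<le> cell_weight c w * cell_weight c w'"
proof -
  have m: "cell c w \<in> sets unit_measure" "cell c w' \<in> sets unit_measure" using labellingD[OF assms(1)] assms by auto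
  have F: "0 \<le> case_prod F z" "case_prod F z \<le> 1" if "z \<in> space unit_square" for z
    using that kernelD[OF assms(4)] by (auto simp: space_unit_square)
  show "0 \<le> cell_integral (case_prod F) c w w'"
    unfolding cell_integral_def using F by (intro integral_nonneg_AE AE_I2 mult_nonneg_nonneg) auto
  have "cell_integral (case_prod F) c w w' \<le> cell_integral (\<lambda>_. 1) c w w'"
    unfolding cell_integral_def using F m kernelD(1)[OF assms(4)]
    by (intro integral_mono integrable_rectangle[of _ 1] mult_right_mono) auto
  then show "cell_integral (case_prod F) c w w' \<le> cell_weight c w * cell_weight c w'"
    by (simp add: cell_integral_1[OF assms(1-3)])
qed

lemma divide_le_1_nonneg: "0 \<le> x \<Longrightarrow> x \<le> q \<Longrightarrow> x / q \<le> (1::real)"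
  by (cases "q = 0") (auto simp: divide_le_eq_1)

lemma cell_average_bounds:
  assumes "labelling C c" "w \<in> C" "w' \<in> C" "kernel F"
  shows "0 \<le> cell_average (case_prod F) c w w'" "cell_average (case_prod F) c w w' \<le> 1"
proof -
  have p: "0 \<le> cell_weight c w * cell_weight c w'" by (simp add: cell_weight_nonneg)
  show "0 \<le> cell_average (case_prod F) c w w'"
    unfolding cell_average_def by (intro divide_nonneg_nonneg cell_integral_bounds(1)[OF assms] p)
  show "cell_average (case_prod F) c w w' \<le> 1"
    unfolding cell_average_def using cell_integral_bounds[OF assms] by (rule divide_le_1_nonneg)
qed

lemma cell_average_times:
  assumes "labelling C c" "w \<in> C" "w' \<in> C" "kernel F"
  shows "cell_average (case_prod F) c w w' * (cell_weight c w * cell_weight c w') = cell_integral (case_prod F) c w w'"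
  using cell_integral_bounds[OF assms] by (auto simp: cell_average_def)

lemma kernel_label_fun:
  assumes "labelling C c" "\<And>w w'. w \<in> C \<Longrightarrow> w' \<in> C \<Longrightarrow> 0 \<le> \<gamma> w w' \<and> \<gamma> w w' \<le> 1"
  shows "kernel (\<lambda>x y. \<gamma> (c x) (c y))"
  using measurable_label_fun[OF assms(1), of \<gamma>] assms(2) labellingD(2)[OF assms(1)]
  by (auto simp: kernel_def case_prod_beta')

text \<open>The conditional expectation of F given the labels of both coordinates.\<close>

definition stepped :: "(real \<Rightarrow> real \<Rightarrow> real) \<Rightarrow> (real \<Rightarrow> 'l) \<Rightarrow> real \<Rightarrow> real \<Rightarrow> real" where
  "stepped F c x y = cell_average (case_prod F) c (c x) (c y)"

lemma kernel_stepped: "labelling C c \<Longrightarrow> kernel F \<Longrightarrow> kernel (stepped F c)"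
  unfolding stepped_def[abs_def] by (intro kernel_label_fun) (auto simp: cell_average_bounds)

text \<open>The defining property of conditional expectation: functions of the labels cannot tell F
  from its average. All orthogonality relations for averaged kernels rest on it.\<close>

lemma integral_stepped:
  assumes lab: "labelling C c" and F: "kernel F"
  shows "(\<integral>z. case_prod F z * \<gamma> (c (fst z)) (c (snd z)) \<partial>unit_square)
    = (\<integral>z. case_prod (stepped F c) z * \<gamma> (c (fst z)) (c (snd z)) \<partial>unit_square)"
proof -
  have b: "\<bar>case_prod F z\<bar> \<le> 1" if "z \<in> space unit_square" for z
    using that kernelD[OF F] by (auto simp: space_unit_square)
  have "(\<integral>z. case_prod F z * \<gamma> (c (fst z)) (c (snd z)) \<partial>unit_square)
    = (\<Sum>w\<in>C. \<Sum>w'\<in>C. \<gamma> w w' * cell_integral (case_prod F) c w w')"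
    using integral_label_fun[OF lab kernelD(1)[OF F] b, of \<gamma>] by simp
  also have "\<dots> = (\<Sum>w\<in>C. \<Sum>w'\<in>C. (cell_average (case_prod F) c w w' * \<gamma> w w') * (cell_weight c w * cell_weight c w'))"
    by (intro sum.cong refl) (simp add: cell_average_times[OF lab _ _ F, symmetric] mult_ac)
  also have "\<dots> = (\<integral>z. cell_average (case_prod F) c (c (fst z)) (c (snd z)) * \<gamma> (c (fst z)) (c (snd z)) \<partial>unit_square)"
    by (rule integral_label_fun_1[OF lab, symmetric])
  finally show ?thesis by (simp add: stepped_def case_prod_beta)
qed

text \<open>Nonnegativity of the variance.\<close>

lemma square_integral_le:
  fixes f :: "real \<times> real \<Rightarrow> real"
  assumes "f \<in> borel_measurable unit_square" "\<And>z. z \<in> space unit_square \<Longrightarrow> \<bar>f z\<bar> \<le> B"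
  shows "(\<integral>z. f z \<partial>unit_square)\<^sup>2 \<le> (\<integral>z. (f z)\<^sup>2 \<partial>unit_square)"
proof -
  have "integrable unit_square f" using assms by (intro unit2.P.integrable_bounded_real)
  moreover have "integrable unit_square (\<lambda>z. (f z)\<^sup>2)"
    using assms(1) by (intro unit2.P.integrable_bounded_real[of _ "B\<^sup>2"]) (auto intro!: abs_le_square_iff[THEN iffD1] order_trans[OF assms(2)])
  ultimately show ?thesis
    using unit2.P.variance_eq[of f] unit2.P.variance_positive[of f] by simp
qed

text \<open>Pythagoras: \<open>orth\<close> says that V' - V is orthogonal to V.\<close>

lemma integral_diff_square:
  assumes V: "kernel V" and V': "kernel V'"
    and orth: "(\<integral>z. case_prod V' z * case_prod V z \<partial>unit_square) = (\<integral>z. case_prod V z * case_prod V z \<partial>unit_square)"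
  shows "(\<integral>z. (case_prod V' z - case_prod V z)\<^sup>2 \<partial>unit_square)
    = (\<integral>z. (case_prod V' z)\<^sup>2 \<partial>unit_square) - (\<integral>z. (case_prod V z)\<^sup>2 \<partial>unit_square)"
proof -
  note [measurable] = kernelD(1)[OF V] kernelD(1)[OF V']
  have b: "0 \<le> case_prod V z \<and> case_prod V z \<le> 1" "0 \<le> case_prod V' z \<and> case_prod V' z \<le> 1" if "z \<in> space unit_square" for z
    using that kernelD[OF V] kernelD[OF V'] by (auto simp: space_unit_square)
  have int: "integrable unit_square (\<lambda>z. case_prod V' z * case_prod V' z)"
     "integrable unit_square (\<lambda>z. case_prod V' z * case_prod V z)"
     "integrable unit_square (\<lambda>z. case_prod V z * case_prod V z)"
    using b by (auto intro!: unit2.P.integrable_bounded_real[of _ 1] abs_mult_unit_le)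
  have "(\<integral>z. (case_prod V' z - case_prod V z)\<^sup>2 \<partial>unit_square)
     = (\<integral>z. case_prod V' z * case_prod V' z - 2 * (case_prod V' z * case_prod V z) + case_prod V z * case_prod V z \<partial>unit_square)"
    by (intro Bochner_Integration.integral_cong) (auto simp: power2_eq_square algebra_simps)
  also have "\<dots> = (\<integral>z. case_prod V' z * case_prod V' z \<partial>unit_square)
      - 2 * (\<integral>z. case_prod V' z * case_prod V z \<partial>unit_square) + (\<integral>z. case_prod V z * case_prod V z \<partial>unit_square)"
    using int by simp
  finally show ?thesis unfolding orth by (simp add: power2_eq_square)
qed

section \<open>Nested partitions and the energy increment\<close>

text \<open>The partitions come from initial segments of one sequence of sets, so they refine each
  other and \<open>take\<close> is the map from fine labels to coarse ones.\<close>

definition word :: "(nat \<Rightarrow> real set) \<Rightarrow> nat \<Rightarrow> real \<Rightarrow> bool list" where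
  "word S k x = map (\<lambda>n. x \<in> S n) [0..<k]"

abbreviation words :: "nat \<Rightarrow> bool list set" where
  "words k \<equiv> {w. length w = k}"

lemma finite_words: "finite (words k)"
  using finite_lists_length_eq[of "UNIV :: bool set" k] by simp

lemma words_Suc: "words (Suc k) = (\<lambda>(w, b). w @ [b]) ` (words k \<times> UNIV)"
proof (intro equalityI subsetI)
  fix v assume v: "v \<in> words (Suc k)"
  then obtain w b where "v = w @ [b]" by (cases v rule: rev_cases) auto
  then show "v \<in> (\<lambda>(w, b). w @ [b]) ` (words k \<times> (UNIV :: bool set))"
    using v by (intro image_eqI[of _ _ "(w, b)"]) auto
qed auto

lemma sum_words_Suc: "(\<Sum>v\<in>words (Suc k). f v) = (\<Sum>w\<in>words k. \<Sum>b\<in>UNIV. f (w @ [b]))"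
proof -
  have "inj_on (\<lambda>(w, b). w @ [b]) (words k \<times> UNIV)" by (auto simp: inj_on_def)
  then have "(\<Sum>v\<in>words (Suc k). f v) = (\<Sum>(w, b)\<in>words k \<times> UNIV. f (w @ [b]))"
    unfolding words_Suc by (subst sum.reindex) (auto simp: case_prod_beta)
  then show ?thesis by (simp add: sum.cartesian_product finite_words)
qed

lemma word_Suc: "word S (Suc k) x = word S k x @ [x \<in> S k]"
  by (simp add: word_def)

lemma length_word [simp]: "length (word S k x) = k"
  by (simp add: word_def)

lemma take_word: "j \<le> k \<Longrightarrow> take j (word S k x) = word S j x"
  by (simp add: word_def take_map)

lemma nth_word: "n < k \<Longrightarrow> word S k x ! n \<longleftrightarrow> x \<in> S n"
  by (simp add: word_def)

lemma word_cong: "(\<And>n. n < k \<Longrightarrow> S n = S' n) \<Longrightarrow> word S k = word S' k"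
  by (auto simp: word_def fun_eq_iff)

lemma labelling_word:
  assumes "\<And>n. S n \<in> sets unit_measure"
  shows "labelling (words k) (word S k)"
  unfolding labelling_def
proof (intro conjI ballI finite_words)
  fix w assume "w \<in> words k"
  then have "cell (word S k) w = {x \<in> space unit_measure. \<forall>n\<in>{..<k}. (x \<in> S n) = w ! n}"
    by (auto simp: cell_def word_def list_eq_iff_nth_eq)
  also have "\<dots> \<in> sets unit_measure" using assms by measurable
  finally show "cell (word S k) w \<in> sets unit_measure" .
qed auto

definition energy :: "(real \<Rightarrow> real \<Rightarrow> real) \<Rightarrow> (nat \<Rightarrow> real set) \<Rightarrow> nat \<Rightarrow> real" where
  "energy F S k = (\<integral>z. (case_prod (stepped F (word S k)) z)\<^sup>2 \<partial>unit_square)"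

definition deviation :: "(real \<Rightarrow> real \<Rightarrow> real) \<Rightarrow> (real \<Rightarrow> bool list) \<Rightarrow> real set \<Rightarrow> real set \<Rightarrow> real" where
  "deviation F c A B = (\<integral>z. (case_prod F z - case_prod (stepped F c) z) * (indicator A (fst z) * indicator B (snd z)) \<partial>unit_square)"

lemma kernel_bounds:
  assumes "kernel F" "z \<in> space unit_square"
  shows "0 \<le> case_prod F z \<and> case_prod F z \<le> 1"
  using assms kernelD[OF assms(1)] by (auto simp: space_unit_square)

lemma kernel_diff_bound:
  assumes "kernel F" "kernel F'" "z \<in> space unit_square"
  shows "\<bar>case_prod F z - case_prod F' z\<bar> \<le> 1"
  using kernel_bounds[OF assms(1,3)] kernel_bounds[OF assms(2,3)] by (cases z) (simp add: abs_le_iff)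

lemma deviation_bound:
  assumes F: "kernel F" and lab: "labelling C c"
  shows "\<bar>deviation F c A B\<bar> \<le> 1"
  unfolding deviation_def
proof (rule unit2.P.abs_integral_le)
  fix z assume z: "z \<in> space unit_square"
  show "\<bar>(case_prod F z - case_prod (stepped F c) z) * (indicator A (fst z) * indicator B (snd z))\<bar> \<le> 1"
    using kernel_diff_bound[OF F kernel_stepped[OF lab F] z] by (auto simp: indicator_def)
qed simp

text \<open>After refining by the two sets, the test function is a function of the new labels, so F
  may be replaced by its new average V' in the deviation. Its square is then at most the squared L2
  distance of V' and V, which by Pythagoras is the gain in energy.\<close>

lemma energy_increment:
  assumes F: "kernel F" and S: "\<And>n. S n \<in> sets unit_measure"
  shows "energy F S k + (deviation F (word S k) (S k) (S (Suc k)))\<^sup>2 \<le> energy F S (Suc (Suc k))"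
proof -
  let ?c = "word S k" and ?c' = "word S (Suc (Suc k))"
  let ?V = "stepped F ?c" and ?V' = "stepped F ?c'"
  have lab: "labelling (words k) ?c" "labelling (words (Suc (Suc k))) ?c'" using labelling_word[OF S] by auto
  have V: "kernel ?V" "kernel ?V'" by (intro kernel_stepped[OF lab(1) F] kernel_stepped[OF lab(2) F])+
  note [measurable] = kernelD(1)[OF F] kernelD(1)[OF V(1)] kernelD(1)[OF V(2)] S
  \<comment> \<open>Coarse labels are prefixes of fine ones, so V is also a function of the fine
    labels.\<close>
  have Vc': "case_prod ?V z = cell_average (case_prod F) ?c (take k (?c' (fst z))) (take k (?c' (snd z)))" for z
    by (simp add: stepped_def take_word case_prod_beta)
  have "(\<integral>z. case_prod ?V' z * case_prod ?V z \<partial>unit_square) = (\<integral>z. case_prod F z * case_prod ?V z \<partial>unit_square)"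
    using integral_stepped[OF lab(2) F, of "\<lambda>w w'. cell_average (case_prod F) ?c (take k w) (take k w')"]
    unfolding Vc' by simp
  also have "\<dots> = (\<integral>z. case_prod ?V z * case_prod ?V z \<partial>unit_square)"
    using integral_stepped[OF lab(1) F, of "cell_average (case_prod F) ?c"] by (simp add: stepped_def case_prod_beta)
  finally have pyth: "(\<integral>z. (case_prod ?V' z - case_prod ?V z)\<^sup>2 \<partial>unit_square) = energy F S (Suc (Suc k)) - energy F S k"
    unfolding energy_def by (rule integral_diff_square[OF V])
  let ?I = "\<lambda>z. indicator (S k) (fst z) * indicator (S (Suc k)) (snd z) :: real"
  have Ic': "?I z = (\<lambda>w w'. of_bool (w ! k) * of_bool (w' ! Suc k)) (?c' (fst z)) (?c' (snd z))" for z
    by (simp add: nth_word indicator_def)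
  have b1: "\<bar>case_prod K z\<bar> \<le> 1" if "kernel K" "z \<in> space unit_square" for K z
    using kernel_bounds[OF that] by simp
  have int: "integrable unit_square (\<lambda>z. case_prod K z * ?I z)" if "kernel K" for K
    using integrable_rectangle[OF kernelD(1)[OF that] b1[OF that] S S] .
  have "deviation F ?c (S k) (S (Suc k)) = (\<integral>z. case_prod F z * ?I z \<partial>unit_square) - (\<integral>z. case_prod ?V z * ?I z \<partial>unit_square)"
    unfolding deviation_def left_diff_distrib using int[OF F] int[OF V(1)] by simp
  also have "(\<integral>z. case_prod F z * ?I z \<partial>unit_square) = (\<integral>z. case_prod ?V' z * ?I z \<partial>unit_square)"
    unfolding Ic' by (rule integral_stepped[OF lab(2) F])
  also have "\<dots> - (\<integral>z. case_prod ?V z * ?I z \<partial>unit_square) = (\<integral>z. (case_prod ?V' z - case_prod ?V z) * ?I z \<partial>unit_square)"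
    unfolding left_diff_distrib using int[OF V(1)] int[OF V(2)] by simp
  finally have dev: "deviation F ?c (S k) (S (Suc k)) = (\<integral>z. (case_prod ?V' z - case_prod ?V z) * ?I z \<partial>unit_square)" .
  have I1: "\<bar>x * ?I z\<bar> \<le> \<bar>x\<bar>" for x z by (auto simp: indicator_def)
  have "(deviation F ?c (S k) (S (Suc k)))\<^sup>2 \<le> (\<integral>z. ((case_prod ?V' z - case_prod ?V z) * ?I z)\<^sup>2 \<partial>unit_square)"
    unfolding dev
  proof (rule square_integral_le[of _ 1])
    fix z assume "z \<in> space unit_square"
    from kernel_diff_bound[OF V(2,1) this] I1[of "case_prod ?V' z - case_prod ?V z" z]
    show "\<bar>(case_prod ?V' z - case_prod ?V z) * ?I z\<bar> \<le> 1" by linarith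
  qed measurable
  also have "\<dots> \<le> (\<integral>z. (case_prod ?V' z - case_prod ?V z)\<^sup>2 \<partial>unit_square)"
  proof (rule integral_mono)
    show i: "integrable unit_square (\<lambda>z. (case_prod ?V' z - case_prod ?V z)\<^sup>2)"
      using kernel_diff_bound[OF V(2,1)] by (intro unit2.P.integrable_bounded_real[of _ 1]) (auto simp: abs_square_le_1)
    show sq: "((case_prod ?V' z - case_prod ?V z) * ?I z)\<^sup>2 \<le> (case_prod ?V' z - case_prod ?V z)\<^sup>2" for z
      using I1 by (intro abs_le_square_iff[THEN iffD1])
    show "integrable unit_square (\<lambda>z. ((case_prod ?V' z - case_prod ?V z) * ?I z)\<^sup>2)"
      by (rule Bochner_Integration.integrable_bound[OF i]) (use sq in auto)
  qed
  finally show ?thesis unfolding pyth by simp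
qed

lemma energy_bounds:
  assumes F: "kernel F" and S: "\<And>n. S n \<in> sets unit_measure"
  shows "0 \<le> energy F S k" "energy F S k \<le> 1"
proof -
  have V: "kernel (stepped F (word S k))" using kernel_stepped[OF labelling_word[OF S] F] .
  show "0 \<le> energy F S k" unfolding energy_def by (intro integral_nonneg_AE) auto
  have "\<bar>energy F S k\<bar> \<le> 1"
    unfolding energy_def power2_eq_square
    by (rule unit2.P.abs_integral_le) (intro abs_mult_unit_le kernel_bounds[OF V], simp_all)
  then show "energy F S k \<le> 1" by simp
qed

text \<open>The supremum need not be attained, and half of it is good enough. If it is not positive
  all deviations vanish and empty sets will do.\<close>

lemma exists_near_max_deviation:
  assumes F: "kernel F" and lab: "labelling C c"
  shows "\<exists>A\<in>sets unit_measure. \<exists>B\<in>sets unit_measure. \<forall>A'\<in>sets unit_measure. \<forall>B'\<in>sets unit_measure.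
    \<bar>deviation F c A' B'\<bar> \<le> 2 * \<bar>deviation F c A B\<bar>"
proof -
  define D where "D = (\<lambda>(A, B). \<bar>deviation F c A B\<bar>) ` (sets unit_measure \<times> sets unit_measure)"
  have bdd: "bdd_above D" using deviation_bound[OF F lab] by (auto simp: D_def bdd_above_def)
  have ne: "D \<noteq> {}" using sets.empty_sets by (auto simp: D_def)
  have le: "\<bar>deviation F c A B\<bar> \<le> Sup D" if "A \<in> sets unit_measure" "B \<in> sets unit_measure" for A B
    using that by (intro cSup_upper bdd) (auto simp: D_def)
  show ?thesis
  proof (cases "Sup D > 0")
    case True
    then have "Sup D / 2 < Sup D" by simp
    then obtain d where d: "d \<in> D" "Sup D / 2 < d" using less_cSupD[OF ne] by blast
    then obtain A B where AB: "A \<in> sets unit_measure" "B \<in> sets unit_measure" "Sup D / 2 < \<bar>deviation F c A B\<bar>"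
      unfolding D_def by fastforce
    show ?thesis
    proof (rule bexI[OF _ AB(1)], rule bexI[OF _ AB(2)], intro ballI)
      fix A' B' assume "A' \<in> sets unit_measure" "B' \<in> sets unit_measure"
      from le[OF this] AB(3) show "\<bar>deviation F c A' B'\<bar> \<le> 2 * \<bar>deviation F c A B\<bar>" by simp
    qed
  next
    case False
    show ?thesis
    proof (intro bexI[of _ "{}"] ballI)
      fix A' B' assume "A' \<in> sets unit_measure" "B' \<in> sets unit_measure"
      from le[OF this] False show "\<bar>deviation F c A' B'\<bar> \<le> 2 * \<bar>deviation F c {} {}\<bar>" by simp
    qed simp_all
  qed
qed

text \<open>Greedy form of the weak regularity lemma of Frieze and Kannan: the pairs of sets are chosen once
  and for all, independently of the precision.\<close>

lemma weak_regularity: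
  assumes F: "kernel F"
  shows "\<exists>S. (\<forall>n. S n \<in> sets unit_measure) \<and>
    (\<forall>K\<ge>1. \<exists>j\<in>{K..<2*K}. cut_bound (2 / sqrt K) (\<lambda>(x, y). F x y - stepped F (word S (2 * j)) x y))"
proof -
  define good where "good c A B \<longleftrightarrow> A \<in> sets unit_measure \<and> B \<in> sets unit_measure \<and>
    (\<forall>A'\<in>sets unit_measure. \<forall>B'\<in>sets unit_measure. \<bar>deviation F c A' B'\<bar> \<le> 2 * \<bar>deviation F c A B\<bar>)" for c A B
  define nxt where "nxt L = (SOME (A, B). good (word (nth L) (length L)) A B)" for L
  \<comment> \<open>Each round appends a pair A, B, so after j rounds the labels are words of length
    2 j.\<close>
  define ext where "ext L = L @ [fst (nxt L), snd (nxt L)]" for L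
  define G where "G j = (ext ^^ j) []" for j
  have G_Suc: "G (Suc j) = G j @ [fst (nxt (G j)), snd (nxt (G j))]" for j by (simp add: G_def ext_def)
  have len: "length (G j) = 2 * j" for j by (induction j) (auto simp: G_Suc, simp add: G_def)
  have goodG: "good (word (nth L) (length L)) (fst (nxt L)) (snd (nxt L))" if L: "\<And>A. A \<in> set L \<Longrightarrow> A \<in> sets unit_measure" for L
  proof -
    \<comment> \<open>Padding by empty sets provides the infinite sequence that
      \<open>labelling_word\<close> expects.\<close>
    define L' where "L' n = (if n < length L then L ! n else {})" for n
    have "labelling (words (length L)) (word L' (length L))"
      using L by (intro labelling_word) (auto simp: L'_def)
    moreover have "word L' (length L) = word (nth L) (length L)" by (intro word_cong) (simp add: L'_def)
    ultimately have "labelling (words (length L)) (word (nth L) (length L))" by simp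
    from exists_near_max_deviation[OF F this]
    obtain A B where "good (word (nth L) (length L)) A B" unfolding good_def by blast
    then have "\<exists>p. case_prod (good (word (nth L) (length L))) p" by (intro exI[of _ "(A, B)"]) simp
    from someI_ex[OF this] show ?thesis unfolding nxt_def by (simp add: case_prod_beta')
  qed
  have Gsets: "A \<in> sets unit_measure" if "A \<in> set (G j)" for A j
    using that
  proof (induction j arbitrary: A)
    case (Suc j)
    then show ?case using goodG[of "G j"] by (auto simp: G_Suc good_def)
  qed (simp add: G_def)
  \<comment> \<open>Round n + 1 is late enough, as 2 (n + 1) > n; later rounds keep earlier
    entries.\<close>
  define S where "S n = G (Suc n) ! n" for n
  have prefix: "G l ! n = G j ! n" if "j \<le> l" "n < 2 * j" for j l n
    using that by (induction l rule: dec_induct) (auto simp: G_Suc nth_append len)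
  have SG: "S n = G j ! n" if "n < 2 * j" for n j
  proof (cases "j \<le> Suc n")
    case True
    then show ?thesis using prefix[OF True that] by (simp add: S_def)
  next
    case False
    then show ?thesis using prefix[of "Suc n" j n] by (simp add: S_def)
  qed
  have S: "S n \<in> sets unit_measure" for n
    unfolding S_def by (rule Gsets, rule nth_mem) (simp add: len)
  have good: "good (word S (2 * j)) (S (2 * j)) (S (Suc (2 * j)))" for j
  proof -
    have "word (nth (G j)) (2 * j) = word S (2 * j)" by (intro word_cong) (simp add: SG[of _ j])
    moreover have "S (2 * j) = fst (nxt (G j))" "S (Suc (2 * j)) = snd (nxt (G j))"
      using SG[of "2 * j" "Suc j"] SG[of "Suc (2 * j)" "Suc j"] by (simp_all add: G_Suc nth_append len)
    ultimately show ?thesis using goodG[of "G j", OF Gsets] by (simp add: len)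
  qed
  define d where "d j = deviation F (word S (2 * j)) (S (2 * j)) (S (Suc (2 * j)))" for j
  have inc: "energy F S (2 * j) + (d j)\<^sup>2 \<le> energy F S (2 * Suc j)" for j
    using energy_increment[OF F, of S "2 * j"] S by (simp add: d_def)
  have sum_d: "(\<Sum>j\<in>{K..<l}. (d j)\<^sup>2) \<le> energy F S (2 * l) - energy F S (2 * K)" if "K \<le> l" for K l
    using that
  proof (induction l rule: dec_induct)
    case (step l)
    then show ?case using inc[of l] by simp
  qed simp
  have "\<exists>j\<in>{K..<2*K}. cut_bound (2 / sqrt K) (\<lambda>(x, y). F x y - stepped F (word S (2 * j)) x y)" if K: "K \<ge> 1" for K
  proof -
    \<comment> \<open>The energies lie in [0,1], so the K increments in the window cannot all exceed
      1/K. The window is finite and the same for every F, which the compactness proof needs.\<close>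
    have "\<exists>j\<in>{K..<2*K}. (d j)\<^sup>2 \<le> 1 / K"
    proof (rule ccontr)
      assume "\<not> ?thesis"
      then have "1 / K < (d j)\<^sup>2" if "j \<in> {K..<2*K}" for j using that by (auto simp: not_le)
      then have "(\<Sum>j\<in>{K..<2*K}. 1 / real K) < (\<Sum>j\<in>{K..<2*K}. (d j)\<^sup>2)"
        using K by (intro sum_strict_mono) auto
      also have "\<dots> \<le> 1" using sum_d[of K "2 * K"] energy_bounds[OF F, of S "2 * (2 * K)"] energy_bounds[OF F, of S "2 * K"] S by simp
      finally show False using K by simp
    qed
    then obtain j where j: "j \<in> {K..<2*K}" "(d j)\<^sup>2 \<le> 1 / K" by blast
    have dj: "\<bar>d j\<bar> \<le> 1 / sqrt K"
      using real_sqrt_le_mono[OF j(2)] by (simp add: real_sqrt_divide)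
    let ?V = "stepped F (word S (2 * j))"
    have lab: "labelling (words (2 * j)) (word S (2 * j))" by (rule labelling_word[OF S])
    have V: "kernel ?V" by (rule kernel_stepped[OF lab F])
    note [measurable] = kernelD(1)[OF F] kernelD(1)[OF V]
    have "cut_bound (2 / sqrt K) (\<lambda>z. case_prod F z - case_prod ?V z)"
    proof (rule cut_bound_setsI[of _ 1])
      fix A B assume AB: "A \<in> sets unit_measure" "B \<in> sets unit_measure"
      have "\<bar>deviation F (word S (2 * j)) A B\<bar> \<le> 2 * \<bar>d j\<bar>"
        using good[of j] AB by (simp add: good_def d_def)
      then show "\<bar>\<integral>z. (case_prod F z - case_prod ?V z) * (indicator A (fst z) * indicator B (snd z)) \<partial>unit_square\<bar> \<le> 2 / sqrt K"
        using dj by (simp add: deviation_def)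
    qed (use kernel_diff_bound[OF F V] in auto)
    then show ?thesis using j(1) by (intro bexI[of _ j]) (simp_all add: case_prod_beta')
  qed
  then show ?thesis using S by blast
qed

text \<open>Only weights and values enter, not the position of the cells, and they enter
  polynomially. Hence these numbers are all that has to converge.\<close>

lemma step_kernel_density:
  assumes lab: "labelling C c"
  shows "kernel_density H (\<lambda>x y. \<gamma> (c x) (c y)) =
    (\<Sum>w\<in>verts H \<rightarrow>\<^sub>E C. (\<Prod>u\<in>verts H. cell_weight c (w u)) *
       bern (edge_pairs H) (pairs_on (verts H)) (\<lambda>(u, v). \<gamma> (w u) (w v)))"
proof -
  let ?I = "verts H" let ?P = "\<Pi>\<^sub>M i\<in>?I. unit_measure" and ?W = "verts H \<rightarrow>\<^sub>E C"
  define \<phi> where "\<phi> w = bern (edge_pairs H) (pairs_on ?I) (\<lambda>(u, v). \<gamma> (w u) (w v))" for w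
  define E where "E w = {X \<in> space ?P. \<forall>u\<in>?I. X u \<in> cell c (w u)}" for w
  have finW: "finite ?W" using labellingD(1)[OF lab] by (intro finite_PiE) auto
  have cellm: "cell c (w u) \<in> sets unit_measure" if "w \<in> ?W" "u \<in> ?I" for w u
    using that labellingD(3)[OF lab] by blast
  have Em: "E w \<in> sets ?P" if "w \<in> ?W" for w
  proof -
    have "E w = Pi\<^sub>E ?I (\<lambda>u. cell c (w u))"
      unfolding E_def by (auto simp: space_PiM PiE_def Pi_def cell_def)
    then show ?thesis using cellm[OF that] by (simp add: sets_PiM_I_finite)
  qed
  have mE: "measure ?P (E w) = (\<Prod>u\<in>?I. cell_weight c (w u))" if "w \<in> ?W" for w
  proof -
    have "emeasure ?P (E w) = (\<Prod>u\<in>?I. emeasure unit_measure (cell c (w u)))"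
      unfolding E_def using cellm[OF that] by (intro unitP.emeasure_PiM_Collect) auto
    also have "\<dots> = ennreal (\<Prod>u\<in>?I. cell_weight c (w u))"
      by (simp add: cell_weight_def unit.emeasure_eq_measure prod_ennreal)
    finally show ?thesis by (simp add: measure_def prod_nonneg cell_weight_nonneg)
  qed
  have pt: "bern (edge_pairs H) (pairs_on ?I) (edge_weights (\<lambda>x y. \<gamma> (c x) (c y)) X) = (\<Sum>w\<in>?W. \<phi> w * indicator (E w) X)"
    if X: "X \<in> space ?P" for X
  proof -
    define w0 where "w0 = restrict (c \<circ> X) ?I"
    have w0: "w0 \<in> ?W" using component_in_unit[OF X] labellingD(2)[OF lab] by (auto simp: w0_def)
    have "X \<in> E w \<longleftrightarrow> w = w0" if "w \<in> ?W" for w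
    proof
      assume "X \<in> E w"
      then have "\<And>u. u \<in> ?I \<Longrightarrow> c (X u) = w u" by (auto simp: E_def cell_def)
      then show "w = w0" using that by (intro PiE_ext[OF that w0]) (auto simp: w0_def)
    next
      assume "w = w0"
      then show "X \<in> E w" using X component_in_unit[OF X] by (auto simp: E_def cell_def w0_def)
    qed
    then have "(\<Sum>w\<in>?W. \<phi> w * indicator (E w) X) = (\<Sum>w\<in>?W. if w = w0 then \<phi> w else 0)"
      by (intro sum.cong) (auto simp: indicator_def)
    also have "\<dots> = \<phi> w0" using w0 finW by simp
    also have "\<dots> = bern (edge_pairs H) (pairs_on ?I) (edge_weights (\<lambda>x y. \<gamma> (c x) (c y)) X)"
      unfolding \<phi>_def bern_def by (intro prod.cong) (auto simp: edge_weights_def pairs_on_def w0_def)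
    finally show ?thesis ..
  qed
  have "kernel_density H (\<lambda>x y. \<gamma> (c x) (c y)) = (\<integral>X. (\<Sum>w\<in>?W. \<phi> w * indicator (E w) X) \<partial>?P)"
    unfolding kernel_density_def using pt by (intro Bochner_Integration.integral_cong) auto
  also have "\<dots> = (\<Sum>w\<in>?W. \<integral>X. \<phi> w * indicator (E w) X \<partial>?P)"
    using Em by (intro Bochner_Integration.integral_sum integrable_mult_right integrable_real_indicator)
      (auto simp: unitP.P.emeasure_eq_measure)
  also have "\<dots> = (\<Sum>w\<in>?W. \<phi> w * measure ?P (E w))"
    using Em by (intro sum.cong) (auto simp: Int_absorb1 sets.sets_into_space)
  finally show ?thesis using mE by (simp add: \<phi>_def mult.commute cong: sum.cong)
qed

lemma step_kernel_density_tendsto: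
  assumes lab: "\<And>i. labelling C (c i)" "labelling C c'"
    and w: "\<And>w. w \<in> C \<Longrightarrow> (\<lambda>i. cell_weight (c i) w) \<longlonglongrightarrow> cell_weight c' w"
    and \<gamma>: "\<And>w w'. w \<in> C \<Longrightarrow> w' \<in> C \<Longrightarrow> (\<lambda>i. \<gamma> i w w') \<longlonglongrightarrow> \<gamma>' w w'"
  shows "(\<lambda>i. kernel_density H (\<lambda>x y. \<gamma> i (c i x) (c i y))) \<longlonglongrightarrow> kernel_density H (\<lambda>x y. \<gamma>' (c' x) (c' y))"
  unfolding step_kernel_density[OF lab(1)] step_kernel_density[OF lab(2)]
proof (intro tendsto_sum tendsto_mult tendsto_prod)
  fix f u assume "f \<in> verts H \<rightarrow>\<^sub>E C" "u \<in> verts H"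
  then show "(\<lambda>i. cell_weight (c i) (f u)) \<longlonglongrightarrow> cell_weight c' (f u)" by (intro w) auto
next
  fix f assume f: "f \<in> verts H \<rightarrow>\<^sub>E C"
  show "(\<lambda>i. bern (edge_pairs H) (pairs_on (verts H)) (\<lambda>(u, v). \<gamma> i (f u) (f v))) \<longlonglongrightarrow>
     bern (edge_pairs H) (pairs_on (verts H)) (\<lambda>(u, v). \<gamma>' (f u) (f v))"
    unfolding bern_def
  proof (intro tendsto_prod)
    fix e assume "e \<in> pairs_on (verts H)"
    then have "f (fst e) \<in> C" "f (snd e) \<in> C" using f by (auto simp: pairs_on_def)
    from \<gamma>[OF this] show "(\<lambda>i. if e \<in> edge_pairs H then case e of (u, v) \<Rightarrow> \<gamma> i (f u) (f v) else 1 - (case e of (u, v) \<Rightarrow> \<gamma> i (f u) (f v)))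
       \<longlonglongrightarrow> (if e \<in> edge_pairs H then case e of (u, v) \<Rightarrow> \<gamma>' (f u) (f v) else 1 - (case e of (u, v) \<Rightarrow> \<gamma>' (f u) (f v)))"
      by (auto simp: case_prod_beta intro!: tendsto_intros)
  qed
qed

section \<open>Compactness of the space of graph limits\<close>

instance graph :: countable
proof
  have "(UNIV :: graph set) = (\<Union>k. labelled_graphs k)" by (auto simp: labelled_graphs_def)
  moreover have "countable (\<Union>k. labelled_graphs k)"
    by (rule countable_UN) (auto intro: countable_finite finite_labelled_graphs)
  ultimately have "countable (UNIV :: graph set)" by simp
  then show "\<exists>to_nat :: graph \<Rightarrow> nat. inj to_nat" unfolding countable_def by simp
qed

text \<open>Tychonoff in place of a diagonal argument: the cube is compact, and over a countable
  index set first countability makes it sequentially compact.\<close>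

lemma pointwise_convergent_subsequence:
  fixes f :: "nat \<Rightarrow> 'a :: countable \<Rightarrow> real"
  assumes "\<And>i x. 0 \<le> f i x \<and> f i x \<le> 1"
  obtains r l where "strict_mono r" "\<And>x. (\<lambda>i. f (r i) x) \<longlonglongrightarrow> l x"
proof -
  have "compactin (product_topology (\<lambda>_::'a. euclidean :: real topology) UNIV) (Pi\<^sub>E UNIV (\<lambda>_. {0..1}))"
    unfolding compactin_PiE by simp
  then have "compact (Pi\<^sub>E UNIV (\<lambda>_::'a. {0..1::real}))"
    by (simp add: euclidean_product_topology flip: compactin_euclidean_iff)
  then have "seq_compact (Pi\<^sub>E UNIV (\<lambda>_::'a. {0..1::real}))" by (rule compact_imp_seq_compact)
  moreover have "f i \<in> Pi\<^sub>E UNIV (\<lambda>_. {0..1})" for i using assms by auto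
  ultimately obtain l r where "strict_mono r" "(f \<circ> r) \<longlonglongrightarrow> l" by (metis seq_compactE)
  then show ?thesis using that[of r l] by (auto simp: tendsto_fun_iff comp_def)
qed

section \<open>The limit graphon of a consistent system of weights and averages\<close>

text \<open>What survives the limit of the partitions. \<open>\<beta>_split\<close> is the
  martingale property, that an average is the weighted mean over the four subrectangles, multiplied
  out so that null cells need no division.\<close>

locale nested_weights =
  fixes \<alpha> :: "bool list \<Rightarrow> real" and \<beta> :: "bool list \<Rightarrow> bool list \<Rightarrow> real"
  assumes \<alpha>_Nil: "\<alpha> [] = 1"
    and \<alpha>_split: "\<And>w. \<alpha> w = \<alpha> (w @ [False]) + \<alpha> (w @ [True])"
    and \<alpha>_nonneg: "\<And>w. 0 \<le> \<alpha> w"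
    and \<beta>_bounds: "\<And>w w'. 0 \<le> \<beta> w w' \<and> \<beta> w w' \<le> 1"
    and \<beta>_sym: "\<And>w w'. \<beta> w w' = \<beta> w' w"
    and \<beta>_split: "\<And>w w'. length w = length w' \<Longrightarrow> \<beta> w w' * (\<alpha> w * \<alpha> w') =
      (\<Sum>b\<in>UNIV. \<Sum>b'\<in>UNIV. \<beta> (w @ [b]) (w' @ [b']) * (\<alpha> (w @ [b]) * \<alpha> (w' @ [b'])))"
begin

text \<open>The words label nested intervals: \<open>w\<close> labels the interval \<open>[lo w, lo w + \<alpha> w)\<close>.\<close>

definition lo :: "bool list \<Rightarrow> real" where
  "lo w = (\<Sum>n<length w. if w ! n then \<alpha> (take n w @ [False]) else 0)"

lemma lo_Nil: "lo [] = 0"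
  by (simp add: lo_def)

lemma lo_snoc: "lo (w @ [b]) = lo w + (if b then \<alpha> (w @ [False]) else 0)"
  by (auto simp: lo_def nth_append intro!: sum.cong)

text \<open>The address of x in the tree of intervals: at each level go right exactly when x is not
  to the left of the dividing point.\<close>

primrec interval_word :: "nat \<Rightarrow> real \<Rightarrow> bool list" where
  "interval_word 0 x = []"
| "interval_word (Suc k) x = interval_word k x @ [lo (interval_word k x) + \<alpha> (interval_word k x @ [False]) \<le> x]"

lemma length_interval_word [simp]: "length (interval_word k x) = k"
  by (induction k) auto

lemma take_interval_word: "j \<le> k \<Longrightarrow> take j (interval_word k x) = interval_word j x"
  by (induction k rule: dec_induct) auto

lemma interval_word_eq_iff:
  assumes "0 \<le> x" "x < 1"
  shows "interval_word (length w) x = w \<longleftrightarrow> lo w \<le> x \<and> x < lo w + \<alpha> w"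
proof (induction w rule: rev_induct)
  case Nil
  then show ?case using assms by (simp add: lo_Nil \<alpha>_Nil)
next
  case (snoc b w)
  have "interval_word (length (w @ [b])) x = w @ [b] \<longleftrightarrow>
      (lo w \<le> x \<and> x < lo w + \<alpha> w) \<and> (lo w + \<alpha> (w @ [False]) \<le> x) = b"
    using snoc by auto
  also have "\<dots> \<longleftrightarrow> lo (w @ [b]) \<le> x \<and> x < lo (w @ [b]) + \<alpha> (w @ [b])"
    using \<alpha>_split[of w] \<alpha>_nonneg[of "w @ [False]"] \<alpha>_nonneg[of "w @ [True]"]
    by (cases b) (auto simp: lo_snoc)
  finally show ?case .
qed

lemma lo_bounds: "0 \<le> lo w \<and> lo w + \<alpha> w \<le> 1"
proof (induction w rule: rev_induct)
  case (snoc b w)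
  then show ?case
    using \<alpha>_split[of w] \<alpha>_nonneg[of "w @ [False]"] \<alpha>_nonneg[of "w @ [True]"]
    by (cases b) (auto simp: lo_snoc)
qed (simp add: lo_Nil \<alpha>_Nil)

text \<open>The point 1 lies in no half-open interval but still has an address; being a null set, it
  does not change the weights.\<close>

lemma cell_interval_word:
  assumes "length w = k"
  shows "cell (interval_word k) w = {lo w..<lo w + \<alpha> w} \<union> (cell (interval_word k) w \<inter> {1})"
proof -
  have "x \<in> cell (interval_word k) w \<longleftrightarrow> x \<in> {lo w..<lo w + \<alpha> w} \<union> (cell (interval_word k) w \<inter> {1})" for x
  proof (cases "0 \<le> x \<and> x < 1")
    case True
    then show ?thesis using interval_word_eq_iff[of x w] assms by (auto simp: cell_def)
  next
    case False
    then show ?thesis using lo_bounds[of w] by (auto simp: cell_def)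
  qed
  then show ?thesis by blast
qed

lemma cell_interval_word_measure:
  assumes "length w = k"
  shows "cell (interval_word k) w \<in> sets unit_measure" "cell_weight (interval_word k) w = \<alpha> w"
proof -
  let ?A = "cell (interval_word k) w"
  have null: "?A \<inter> {1} \<in> null_sets lborel" by (rule finite_imp_null_set_lborel) simp
  have sub: "?A \<subseteq> {0..1}" by (auto simp: cell_def)
  have "{lo w..<lo w + \<alpha> w} \<union> (?A \<inter> {1}) \<in> sets lborel" using null by (intro sets.Un) auto
  then have m: "?A \<in> sets lborel" using cell_interval_word[OF assms] by simp
  then show "?A \<in> sets unit_measure"
    using sub by (simp add: unit_measure_def sets_restrict_space_iff)
  have "cell_weight (interval_word k) w = measure lborel ?A"
    using sub by (simp add: cell_weight_def unit_measure_def measure_restrict_space)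
  also have "\<dots> = measure lborel ({lo w..<lo w + \<alpha> w} \<union> (?A \<inter> {1}))"
    using cell_interval_word[OF assms] by simp
  also have "\<dots> = measure lborel {lo w..<lo w + \<alpha> w}"
    using null by (intro measure_Un_null_set) auto
  also have "\<dots> = \<alpha> w" using \<alpha>_nonneg[of w] by simp
  finally show "cell_weight (interval_word k) w = \<alpha> w" .
qed

lemma labelling_interval_word: "labelling (words k) (interval_word k)"
  unfolding labelling_def by (auto simp: finite_words cell_interval_word_measure)

definition stage :: "nat \<Rightarrow> real \<Rightarrow> real \<Rightarrow> real" where
  "stage k x y = \<beta> (interval_word k x) (interval_word k y)"

lemma kernel_stage: "kernel (stage k)"
  unfolding stage_def[abs_def] by (intro kernel_label_fun[OF labelling_interval_word] \<beta>_bounds)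

text \<open>Martingale property of the stages: summing over the last bit of both words,
  \<open>\<beta>_split\<close> collapses stage k + 1 to stage k.\<close>

lemma integral_stage_Suc:
  "(\<integral>z. case_prod (stage (Suc k)) z * \<gamma> (interval_word k (fst z)) (interval_word k (snd z)) \<partial>unit_square)
   = (\<integral>z. case_prod (stage k) z * \<gamma> (interval_word k (fst z)) (interval_word k (snd z)) \<partial>unit_square)"
proof -
  let ?w = "interval_word"
  have "(\<integral>z. case_prod (stage (Suc k)) z * \<gamma> (?w k (fst z)) (?w k (snd z)) \<partial>unit_square)
     = (\<integral>z. (\<lambda>v v'. \<beta> v v' * \<gamma> (take k v) (take k v')) (?w (Suc k) (fst z)) (?w (Suc k) (snd z)) \<partial>unit_square)"
    by (simp add: stage_def case_prod_beta take_interval_word del: interval_word.simps)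
  also have "\<dots> = (\<Sum>v\<in>words (Suc k). \<Sum>v'\<in>words (Suc k). (\<beta> v v' * \<gamma> (take k v) (take k v')) * (\<alpha> v * \<alpha> v'))"
    unfolding integral_label_fun_1[OF labelling_interval_word, where \<gamma> = "\<lambda>v v'. \<beta> v v' * \<gamma> (take k v) (take k v')"]
    by (intro sum.cong refl) (auto simp: cell_interval_word_measure simp del: interval_word.simps)
  also have "\<dots> = (\<Sum>w\<in>words k. \<Sum>b\<in>UNIV. \<Sum>w'\<in>words k. \<Sum>b'\<in>UNIV.
      \<gamma> w w' * (\<beta> (w @ [b]) (w' @ [b']) * (\<alpha> (w @ [b]) * \<alpha> (w' @ [b']))))"
    unfolding sum_words_Suc by (intro sum.cong refl) (auto simp: mult_ac)
  also have "\<dots> = (\<Sum>w\<in>words k. \<Sum>w'\<in>words k. \<Sum>b\<in>UNIV. \<Sum>b'\<in>UNIV.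
      \<gamma> w w' * (\<beta> (w @ [b]) (w' @ [b']) * (\<alpha> (w @ [b]) * \<alpha> (w' @ [b']))))"
    by (intro sum.cong refl sum.swap)
  also have "\<dots> = (\<Sum>w\<in>words k. \<Sum>w'\<in>words k. (\<beta> w w' * \<gamma> w w') * (\<alpha> w * \<alpha> w'))"
  proof (intro sum.cong refl)
    fix w w' assume "w \<in> words k" "w' \<in> words k"
    then have "\<beta> w w' * (\<alpha> w * \<alpha> w') =
      (\<Sum>b\<in>UNIV. \<Sum>b'\<in>UNIV. \<beta> (w @ [b]) (w' @ [b']) * (\<alpha> (w @ [b]) * \<alpha> (w' @ [b'])))"
      by (intro \<beta>_split) simp
    then show "(\<Sum>b\<in>UNIV. \<Sum>b'\<in>UNIV. \<gamma> w w' * (\<beta> (w @ [b]) (w' @ [b']) * (\<alpha> (w @ [b]) * \<alpha> (w' @ [b']))))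
       = (\<beta> w w' * \<gamma> w w') * (\<alpha> w * \<alpha> w')"
      by (simp add: mult_ac flip: sum_distrib_left)
  qed
  also have "\<dots> = (\<integral>z. (\<lambda>v v'. \<beta> v v' * \<gamma> v v') (?w k (fst z)) (?w k (snd z)) \<partial>unit_square)"
    unfolding integral_label_fun_1[OF labelling_interval_word, where \<gamma> = "\<lambda>v v'. \<beta> v v' * \<gamma> v v'"]
    by (intro sum.cong refl) (auto simp: cell_interval_word_measure)
  finally show ?thesis by (simp add: stage_def case_prod_beta)
qed

lemma integral_stage_orthogonal:
  assumes "k \<le> l"
  shows "(\<integral>z. case_prod (stage l) z * case_prod (stage k) z \<partial>unit_square)
    = (\<integral>z. case_prod (stage k) z * case_prod (stage k) z \<partial>unit_square)"
  using assms
proof (induction l rule: dec_induct)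
  case (step l)
  have "case_prod (stage k) z = (\<lambda>v v'. \<beta> (take k v) (take k v')) (interval_word l (fst z)) (interval_word l (snd z))" for z
    using step(1) by (simp add: stage_def case_prod_beta take_interval_word)
  then show ?case
    using integral_stage_Suc[of l "\<lambda>v v'. \<beta> (take k v) (take k v')"] step.IH by simp
qed simp

definition stage_energy :: "nat \<Rightarrow> real" where
  "stage_energy k = (\<integral>z. (case_prod (stage k) z)\<^sup>2 \<partial>unit_square)"

lemma L1_stage_diff:
  assumes "k \<le> l"
  shows "(\<integral>z. \<bar>case_prod (stage l) z - case_prod (stage k) z\<bar> \<partial>unit_square)\<^sup>2 \<le> stage_energy l - stage_energy k"
proof -
  note [measurable] = kernelD(1)[OF kernel_stage[of k]] kernelD(1)[OF kernel_stage[of l]]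
  have "(\<integral>z. \<bar>case_prod (stage l) z - case_prod (stage k) z\<bar> \<partial>unit_square)\<^sup>2
     \<le> (\<integral>z. \<bar>case_prod (stage l) z - case_prod (stage k) z\<bar>\<^sup>2 \<partial>unit_square)"
    using kernel_diff_bound[OF kernel_stage kernel_stage] by (intro square_integral_le[of _ 1]) auto
  also have "\<dots> = stage_energy l - stage_energy k"
    using integral_diff_square[OF kernel_stage kernel_stage integral_stage_orthogonal[OF assms]]
    by (simp add: stage_energy_def)
  finally show ?thesis .
qed

text \<open>Convergence of a bounded martingale by energies: these increase, are at most 1, and
  their differences dominate the squared L1 distances.\<close>

lemma stage_L1_Cauchy:
  assumes "\<epsilon> > 0"
  shows "\<exists>N. \<forall>k\<ge>N. \<forall>l\<ge>N. (\<integral>z. \<bar>case_prod (stage k) z - case_prod (stage l) z\<bar> \<partial>unit_square) < \<epsilon>"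
proof -
  have mono: "stage_energy k \<le> stage_energy l" if "k \<le> l" for k l
    using L1_stage_diff[OF that] by (smt (verit) zero_le_power2)
  have bnd: "\<bar>stage_energy k\<bar> \<le> 1" for k
    unfolding stage_energy_def power2_eq_square
    by (rule unit2.P.abs_integral_le) (intro abs_mult_unit_le kernel_bounds[OF kernel_stage], simp_all)
  have "convergent stage_energy"
  proof (rule Bseq_mono_convergent)
    show "Bseq stage_energy" using bnd by (intro BseqI'[of _ 1]) simp
  qed (use mono in auto)
  then have "Cauchy stage_energy" by (rule convergent_Cauchy)
  moreover have "\<epsilon>\<^sup>2 > 0" using assms by simp
  ultimately obtain N where N: "\<And>k l. k \<ge> N \<Longrightarrow> l \<ge> N \<Longrightarrow> dist (stage_energy k) (stage_energy l) < \<epsilon>\<^sup>2"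
    unfolding Cauchy_def by meson
  have less: "(\<integral>z. \<bar>case_prod (stage l) z - case_prod (stage k) z\<bar> \<partial>unit_square) < \<epsilon>" if "k \<ge> N" "k \<le> l" for k l
  proof -
    have "stage_energy l - stage_energy k < \<epsilon>\<^sup>2"
      using N[OF order_trans[OF that] that(1)] unfolding dist_real_def by linarith
    with L1_stage_diff[OF that(2)]
    have "(\<integral>z. \<bar>case_prod (stage l) z - case_prod (stage k) z\<bar> \<partial>unit_square)\<^sup>2 < \<epsilon>\<^sup>2"
      by (rule le_less_trans)
    then show ?thesis by (rule power2_less_imp_less[OF _ less_imp_le[OF assms]])
  qed
  then have "(\<integral>z. \<bar>case_prod (stage k) z - case_prod (stage l) z\<bar> \<partial>unit_square) < \<epsilon>" if "k \<ge> N" "l \<ge> N" for k l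
  proof (cases "l \<le> k")
    case False
    then have "(\<integral>z. \<bar>case_prod (stage l) z - case_prod (stage k) z\<bar> \<partial>unit_square) < \<epsilon>"
      using less[of k l] that by linarith
    then show ?thesis by (subst abs_minus_commute)
  qed (rule less[OF that(2)])
  then show ?thesis by blast
qed

lemma limit_kernel:
  obtains U where "kernel U" "\<And>x y. U x y = U y x"
    "\<And>\<epsilon>. \<epsilon> > 0 \<Longrightarrow> \<exists>N. \<forall>k\<ge>N. (\<integral>z. \<bar>case_prod (stage k) z - case_prod U z\<bar> \<partial>unit_square) \<le> \<epsilon>"
proof -
  have int: "integrable unit_square (case_prod (stage k))" for k
    using kernel_bounds[OF kernel_stage] by (intro unit2.P.integrable_bounded_real[of _ 1] kernelD(1) kernel_stage) auto
  have "\<exists>N. \<forall>i\<ge>N. \<forall>j\<ge>N. (\<integral>z. norm (case_prod (stage i) z - case_prod (stage j) z) \<partial>unit_square) < e" if "e > 0" for e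
    using stage_L1_Cauchy[OF that] by simp
  then obtain r where r: "strict_mono r" and ae: "AE z in unit_square. Cauchy (\<lambda>i. case_prod (stage (r i)) z)"
    using cauchy_L1_AE_cauchy_subseq[of unit_square "\<lambda>k. case_prod (stage k)", OF int] by blast
  \<comment> \<open>Clamping keeps U in [0,1] even on the null set where the limit does not exist.
    The pointwise definition makes U symmetric everywhere, as a graphon must be.\<close>
  define U where "U x y = max 0 (min 1 (lim (\<lambda>i. stage (r i) x y)))" for x y
  note [measurable] = kernelD(1)[OF kernel_stage]
  have "(\<lambda>z. max 0 (min 1 (lim (\<lambda>i. case_prod (stage (r i)) z)))) \<in> borel_measurable unit_square" by measurable
  then have U: "kernel U" by (auto simp: kernel_def U_def case_prod_beta')
  note [measurable] = kernelD(1)[OF U]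
  have intU: "integrable unit_square (case_prod U)"
    using kernel_bounds[OF U] by (intro unit2.P.integrable_bounded_real[of _ 1] kernelD(1) U) auto
  have lim: "(\<lambda>i. \<integral>z. \<bar>case_prod (stage (r i)) z - case_prod U z\<bar> \<partial>unit_square) \<longlonglongrightarrow> (\<integral>z. 0 \<partial>unit_square)"
  proof (rule integral_dominated_convergence[where w = "\<lambda>_. 1"])
    show "AE z in unit_square. (\<lambda>i. \<bar>case_prod (stage (r i)) z - case_prod U z\<bar>) \<longlonglongrightarrow> 0"
      using ae AE_space
    proof eventually_elim
      fix z assume z: "Cauchy (\<lambda>i. case_prod (stage (r i)) z)" "z \<in> space unit_square"
      then have L: "(\<lambda>i. case_prod (stage (r i)) z) \<longlonglongrightarrow> lim (\<lambda>i. case_prod (stage (r i)) z)"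
        by (simp add: Cauchy_convergent_iff convergent_LIMSEQ_iff)
      have "lim (\<lambda>i. case_prod (stage (r i)) z) \<le> 1"
        by (rule LIMSEQ_le_const2[OF L]) (use kernel_bounds[OF kernel_stage z(2)] in auto)
      moreover have "0 \<le> lim (\<lambda>i. case_prod (stage (r i)) z)"
        by (rule LIMSEQ_le_const[OF L]) (use kernel_bounds[OF kernel_stage z(2)] in auto)
      ultimately have "case_prod U z = lim (\<lambda>i. case_prod (stage (r i)) z)"
        by (simp add: U_def case_prod_beta)
      then have "(\<lambda>i. case_prod (stage (r i)) z - case_prod U z) \<longlonglongrightarrow> 0"
        using L by (simp add: LIM_zero)
      from tendsto_rabs[OF this] show "(\<lambda>i. \<bar>case_prod (stage (r i)) z - case_prod U z\<bar>) \<longlonglongrightarrow> 0" by simp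
    qed
    show "AE z in unit_square. norm \<bar>case_prod (stage (r i)) z - case_prod U z\<bar> \<le> 1" for i
      using kernel_diff_bound[OF kernel_stage U] by (intro AE_I2) simp
  qed auto
  show ?thesis
  proof (rule that[OF U])
    show "U x y = U y x" for x y
    proof -
      have "stage k x y = stage k y x" for k by (simp add: stage_def \<beta>_sym)
      then show ?thesis by (simp add: U_def)
    qed
    fix \<epsilon> :: real assume \<epsilon>: "\<epsilon> > 0"
    then obtain N where N: "\<And>k l. k \<ge> N \<Longrightarrow> l \<ge> N \<Longrightarrow>
        (\<integral>z. \<bar>case_prod (stage k) z - case_prod (stage l) z\<bar> \<partial>unit_square) < \<epsilon> / 2"
      using stage_L1_Cauchy[of "\<epsilon> / 2"] by auto
    have "\<forall>\<^sub>F i in sequentially. (\<integral>z. \<bar>case_prod (stage (r i)) z - case_prod U z\<bar> \<partial>unit_square) < \<epsilon> / 2"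
      using lim \<epsilon> by (intro order_tendstoD) auto
    moreover have "\<forall>\<^sub>F i in sequentially. r i \<ge> N"
      using filterlim_subseq[OF r] by (simp add: filterlim_at_top)
    ultimately have "\<forall>\<^sub>F i in sequentially. (\<integral>z. \<bar>case_prod (stage (r i)) z - case_prod U z\<bar> \<partial>unit_square) < \<epsilon> / 2 \<and> r i \<ge> N"
      by (rule eventually_conj)
    then obtain i where i: "(\<integral>z. \<bar>case_prod (stage (r i)) z - case_prod U z\<bar> \<partial>unit_square) < \<epsilon> / 2" "r i \<ge> N"
      by (auto simp: eventually_sequentially)
    show "\<exists>N. \<forall>k\<ge>N. (\<integral>z. \<bar>case_prod (stage k) z - case_prod U z\<bar> \<partial>unit_square) \<le> \<epsilon>"
    proof (intro exI[of _ N] allI impI)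
      fix k assume k: "N \<le> k"
      have "(\<integral>z. \<bar>case_prod (stage k) z - case_prod U z\<bar> \<partial>unit_square)
         \<le> (\<integral>z. \<bar>case_prod (stage k) z - case_prod (stage (r i)) z\<bar> + \<bar>case_prod (stage (r i)) z - case_prod U z\<bar> \<partial>unit_square)"
        by (intro integral_mono integrable_abs Bochner_Integration.integrable_add
            Bochner_Integration.integrable_diff int intU) linarith
      also have "\<dots> = (\<integral>z. \<bar>case_prod (stage k) z - case_prod (stage (r i)) z\<bar> \<partial>unit_square)
          + (\<integral>z. \<bar>case_prod (stage (r i)) z - case_prod U z\<bar> \<partial>unit_square)"
        by (intro Bochner_Integration.integral_add integrable_abs Bochner_Integration.integrable_diff int intU)
      finally show "(\<integral>z. \<bar>case_prod (stage k) z - case_prod U z\<bar> \<partial>unit_square) \<le> \<epsilon>"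
        using N[OF k i(2)] i(1) by linarith
    qed
  qed
qed

end

section \<open>Consistency of the weights and averages of a single graphon\<close>

lemma cell_weight_word_Nil: "cell_weight (word S 0) [] = 1"
proof -
  have "cell (word S 0) [] = space unit_measure" by (auto simp: cell_def word_def)
  then show ?thesis unfolding cell_weight_def by (simp only: unit.prob_space)
qed

lemma cell_word_split:
  assumes "length w = k"
  shows "cell (word S k) w = cell (word S (Suc k)) (w @ [False]) \<union> cell (word S (Suc k)) (w @ [True])"
    "cell (word S (Suc k)) (w @ [False]) \<inter> cell (word S (Suc k)) (w @ [True]) = {}"
  by (auto simp: cell_def word_Suc)

lemma indicator_cell_word_split:
  assumes "length w = k"
  shows "indicator (cell (word S k) w) x = (\<Sum>b\<in>UNIV. indicator (cell (word S (Suc k)) (w @ [b])) x :: real)"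
proof -
  have "indicator (cell (word S k) w) x = indicator (cell (word S (Suc k)) (w @ [False])) x
     + (indicator (cell (word S (Suc k)) (w @ [True])) x :: real)"
    unfolding cell_word_split(1)[OF assms]
    by (rule indicator_disj_union) (rule cell_word_split(2)[OF assms])
  then show ?thesis by (simp add: UNIV_bool)
qed

lemma cell_weight_word_split:
  assumes S: "\<And>n. S n \<in> sets unit_measure" and w: "length w = k"
  shows "cell_weight (word S k) w = cell_weight (word S (Suc k)) (w @ [False]) + cell_weight (word S (Suc k)) (w @ [True])"
proof -
  have "cell (word S (Suc k)) (w @ [b]) \<in> sets unit_measure" for b
    using labellingD(3)[OF labelling_word[OF S], of "w @ [b]" "Suc k"] w by simp
  then show ?thesis
    unfolding cell_weight_def cell_word_split(1)[OF w]
    by (intro unit.finite_measure_Union cell_word_split(2)[OF w])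
qed

lemma cell_integral_word_split:
  assumes S: "\<And>n. S n \<in> sets unit_measure" and F: "kernel F" and w: "length w = k" "length w' = k"
  shows "cell_integral (case_prod F) (word S k) w w' =
    (\<Sum>b\<in>UNIV. \<Sum>b'\<in>UNIV. cell_integral (case_prod F) (word S (Suc k)) (w @ [b]) (w' @ [b']))"
proof -
  let ?i = "\<lambda>w x. indicator (cell (word S (Suc k)) w) x :: real"
  have m: "cell (word S (Suc k)) (v @ [b]) \<in> sets unit_measure" if "length v = k" for v b
    using labellingD(3)[OF labelling_word[OF S], of "v @ [b]" "Suc k"] that by simp
  have "\<bar>case_prod F z\<bar> \<le> 1" if "z \<in> space unit_square" for z
    using kernel_bounds[OF F that] by simp
  then have int: "integrable unit_square (\<lambda>z. case_prod F z * (?i (w @ [b]) (fst z) * ?i (w' @ [b']) (snd z)))" for b b'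
    using w by (intro integrable_rectangle[of _ 1] kernelD(1)[OF F] m) auto
  have "cell_integral (case_prod F) (word S k) w w' =
    (\<integral>z. (\<Sum>b\<in>UNIV. \<Sum>b'\<in>UNIV. case_prod F z * (?i (w @ [b]) (fst z) * ?i (w' @ [b']) (snd z))) \<partial>unit_square)"
    unfolding cell_integral_def indicator_cell_word_split[OF w(1)] indicator_cell_word_split[OF w(2)]
    by (simp only: sum_product) (simp only: sum_distrib_left)
  also have "\<dots> = (\<Sum>b\<in>UNIV. \<integral>z. (\<Sum>b'\<in>UNIV. case_prod F z * (?i (w @ [b]) (fst z) * ?i (w' @ [b']) (snd z))) \<partial>unit_square)"
    by (intro Bochner_Integration.integral_sum Bochner_Integration.integrable_sum int)
  also have "\<dots> = (\<Sum>b\<in>UNIV. \<Sum>b'\<in>UNIV. \<integral>z. case_prod F z * (?i (w @ [b]) (fst z) * ?i (w' @ [b']) (snd z)) \<partial>unit_square)"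
    by (intro sum.cong refl Bochner_Integration.integral_sum int)
  finally show ?thesis by (simp add: cell_integral_def)
qed

lemma cell_integral_sym:
  assumes F: "kernel F" and sym: "\<And>x y. x \<in> {0..1} \<Longrightarrow> y \<in> {0..1} \<Longrightarrow> F x y = F y x"
    and lab: "labelling C c" "w \<in> C" "w' \<in> C"
  shows "cell_integral (case_prod F) c w w' = cell_integral (case_prod F) c w' w"
proof -
  note [measurable] = kernelD(1)[OF F] labellingD(3)[OF lab(1) lab(2)] labellingD(3)[OF lab(1) lab(3)]
  let ?f = "\<lambda>z. case_prod F z * (indicator (cell c w) (fst z) * indicator (cell c w') (snd z)) :: real"
  have "cell_integral (case_prod F) c w w' = (\<integral>(x, y). ?f (y, x) \<partial>unit_square)"
    unfolding cell_integral_def by (rule unit2.integral_product_swap[symmetric]) measurable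
  also have "\<dots> = cell_integral (case_prod F) c w' w"
    unfolding cell_integral_def
    by (intro Bochner_Integration.integral_cong) (auto simp: space_unit_square sym)
  finally show ?thesis .
qed

lemma kernel_density_bounds:
  assumes "kernel F" shows "0 \<le> kernel_density H F" "kernel_density H F \<le> 1"
proof -
  have "0 \<le> kernel_density H F" "\<bar>kernel_density H F\<bar> \<le> 1"
    unfolding kernel_density_def using bern_edge_weights_bounds[OF assms]
    by (intro integral_nonneg_AE AE_I2 unitP.P.abs_integral_le; force)+
  then show "0 \<le> kernel_density H F" "kernel_density H F \<le> 1" by auto
qed

text \<open>For a given precision, the density of H is compared along the chain from
  \<open>F (r i)\<close> to its regular partition, to stage 2 j and to U. The outer links are
  counting lemmas, the middle one is convergence of finitely many numbers.\<close>

theorem graphon_sequence_compact: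
  fixes W :: "nat \<Rightarrow> graphon"
  obtains r U where "strict_mono r" "\<And>H. (\<lambda>i. graphon_density H (W (r i))) \<longlonglongrightarrow> graphon_density H U"
proof -
  define F where "F i = graphon_fun (W i)" for i
  have F: "kernel (F i)" for i by (simp add: F_def kernel_graphon_fun)
  have Fsym: "F i x y = F i y x" if "x \<in> {0..1}" "y \<in> {0..1}" for i x y
    using graphon_fun[of "W i"] that by (auto simp: F_def)
  have "\<exists>S. \<forall>i. (\<forall>n. S i n \<in> sets unit_measure) \<and>
    (\<forall>K\<ge>1. \<exists>j\<in>{K..<2*K}. cut_bound (2 / sqrt K) (\<lambda>(x, y). F i x y - stepped (F i) (word (S i) (2 * j)) x y))"
    using weak_regularity[OF F] by (intro choice) blast
  then obtain S where S: "\<And>i n. S i n \<in> sets unit_measure"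
    and reg: "\<And>i K. K \<ge> 1 \<Longrightarrow> \<exists>j\<in>{K..<2*K}. cut_bound (2 / sqrt K) (\<lambda>(x, y). F i x y - stepped (F i) (word (S i) (2 * j)) x y)"
    by blast
  have lab: "labelling (words k) (word (S i) k)" for i k by (rule labelling_word[OF S])
  define a where "a i w = cell_weight (word (S i) (length w)) w" for i w
  \<comment> \<open>Only words of equal length label cells of the same partition; 0 is a filler for
    the rest.\<close>
  define b where "b i w w' = (if length w = length w' then cell_average (case_prod (F i)) (word (S i) (length w)) w w' else 0)" for i w w'
  have a: "0 \<le> a i w" "a i w \<le> 1" for i w
    by (simp_all add: a_def cell_weight_def)
  have b: "0 \<le> b i w w' \<and> b i w w' \<le> 1" for i w w'
    using cell_average_bounds[OF lab _ _ F, of w "length w" w'] by (auto simp: b_def)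
  \<comment> \<open>Weights, averages and densities are put into one countable family, so a single
    subsequence serves all three.\<close>
  define f :: "nat \<Rightarrow> bool list + (bool list \<times> bool list) + graph \<Rightarrow> real"
    where "f i p = (case p of Inl w \<Rightarrow> a i w | Inr (Inl (w, w')) \<Rightarrow> b i w w' | Inr (Inr H) \<Rightarrow> kernel_density H (F i))" for i p
  have "0 \<le> f i p \<and> f i p \<le> 1" for i p
    using a b kernel_density_bounds[OF F] by (auto simp: f_def split: sum.split)
  then obtain r l where r: "strict_mono r" and l: "\<And>p. (\<lambda>i. f (r i) p) \<longlonglongrightarrow> l p"
    using pointwise_convergent_subsequence by blast
  define \<alpha> where "\<alpha> w = l (Inl w)" for w
  define \<beta> where "\<beta> w w' = l (Inr (Inl (w, w')))" for w w'
  define t where "t H = l (Inr (Inr H))" for H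
  have \<alpha>: "(\<lambda>i. a (r i) w) \<longlonglongrightarrow> \<alpha> w" for w using l[of "Inl w"] by (simp add: f_def \<alpha>_def)
  have \<beta>: "(\<lambda>i. b (r i) w w') \<longlonglongrightarrow> \<beta> w w'" for w w' using l[of "Inr (Inl (w, w'))"] by (simp add: f_def \<beta>_def)
  have t: "(\<lambda>i. kernel_density H (F (r i))) \<longlonglongrightarrow> t H" for H using l[of "Inr (Inr H)"] by (simp add: f_def t_def)
  interpret nested_weights \<alpha> \<beta>
  proof
    have "a i [] = 1" for i using cell_weight_word_Nil by (simp add: a_def)
    then show "\<alpha> [] = 1" using \<alpha>[of "[]"] by (simp add: LIMSEQ_const_iff)
    show "\<alpha> w = \<alpha> (w @ [False]) + \<alpha> (w @ [True])" for w
    proof -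
      have "a i w = a i (w @ [False]) + a i (w @ [True])" for i
        using cell_weight_word_split[OF S, of w "length w"] by (simp add: a_def)
      then have "(\<lambda>i. a (r i) w) \<longlonglongrightarrow> \<alpha> (w @ [False]) + \<alpha> (w @ [True])"
        using tendsto_add[OF \<alpha>[of "w @ [False]"] \<alpha>[of "w @ [True]"]] by simp
      then show ?thesis using \<alpha>[of w] LIMSEQ_unique by blast
    qed
    show "0 \<le> \<alpha> w" for w using LIMSEQ_le_const[OF \<alpha>] a by blast
    show "0 \<le> \<beta> w w' \<and> \<beta> w w' \<le> 1" for w w'
      using LIMSEQ_le_const[OF \<beta>] LIMSEQ_le_const2[OF \<beta>] b by blast
    show "\<beta> w w' = \<beta> w' w" for w w'
    proof -
      have "b i w w' = b i w' w" for i
        using cell_integral_sym[OF F Fsym lab, of w "length w" w' i i]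
        by (simp add: b_def cell_average_def mult.commute)
      then show ?thesis using \<beta>[of w w'] \<beta>[of w' w] LIMSEQ_unique by simp
    qed
    fix w w' :: "bool list" assume len: "length w = length w'"
    have ci: "b i v v' * (a i v * a i v') = cell_integral (case_prod (F i)) (word (S i) (length v)) v v'"
      if "length v = length v'" for i v v'
      using cell_average_times[OF lab _ _ F, of v "length v" v'] that by (simp add: b_def a_def)
    have "b i w w' * (a i w * a i w') = (\<Sum>p\<in>UNIV. \<Sum>q\<in>UNIV. b i (w @ [p]) (w' @ [q]) * (a i (w @ [p]) * a i (w' @ [q])))" for i
      using cell_integral_word_split[OF S F refl len[symmetric]] len by (simp add: ci)
    then have "(\<lambda>i. b (r i) w w' * (a (r i) w * a (r i) w')) \<longlonglongrightarrow>
        (\<Sum>p\<in>UNIV. \<Sum>q\<in>UNIV. \<beta> (w @ [p]) (w' @ [q]) * (\<alpha> (w @ [p]) * \<alpha> (w' @ [q])))"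
      by (simp only:) (intro tendsto_sum tendsto_mult \<alpha> \<beta>)
    then show "\<beta> w w' * (\<alpha> w * \<alpha> w') = (\<Sum>p\<in>UNIV. \<Sum>q\<in>UNIV. \<beta> (w @ [p]) (w' @ [q]) * (\<alpha> (w @ [p]) * \<alpha> (w' @ [q])))"
      using tendsto_mult[OF \<beta>[of w w'] tendsto_mult[OF \<alpha>[of w] \<alpha>[of w']]] LIMSEQ_unique by blast
  qed
  obtain U where U: "kernel U" "\<And>x y. U x y = U y x"
    and Ulim: "\<And>\<epsilon>. \<epsilon> > 0 \<Longrightarrow> \<exists>N. \<forall>k\<ge>N. (\<integral>z. \<bar>case_prod (stage k) z - case_prod U z\<bar> \<partial>unit_square) \<le> \<epsilon>"
    using limit_kernel by blast
  have stage_lim: "(\<lambda>i. kernel_density H (stepped (F (r i)) (word (S (r i)) k))) \<longlonglongrightarrow> kernel_density H (stage k)" for H k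
  proof -
    have "(\<lambda>i. kernel_density H (\<lambda>x y. cell_average (case_prod (F (r i))) (word (S (r i)) k) (word (S (r i)) k x) (word (S (r i)) k y)))
       \<longlonglongrightarrow> kernel_density H (\<lambda>x y. \<beta> (interval_word k x) (interval_word k y))"
    proof (rule step_kernel_density_tendsto[OF lab labelling_interval_word])
      fix w w' :: "bool list" assume w: "w \<in> words k"
      then show "(\<lambda>i. cell_weight (word (S (r i)) k) w) \<longlonglongrightarrow> cell_weight (interval_word k) w"
        using \<alpha>[of w] by (simp add: a_def cell_interval_word_measure)
      assume "w' \<in> words k"
      then show "(\<lambda>i. cell_average (case_prod (F (r i))) (word (S (r i)) k) w w') \<longlonglongrightarrow> \<beta> w w'"
        using \<beta>[of w w'] w by (simp add: b_def)
    qed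
    then show ?thesis by (simp add: stepped_def[abs_def] stage_def[abs_def])
  qed
  have dens: "t H = kernel_density H U" for H
  proof -
    define C where "C = real (card (pairs_on (verts H)))"
    have C: "C \<ge> 0" by (simp add: C_def)
    \<comment> \<open>The 2 counts two convergences along the subsequence, the 2 C two uses of the
      counting lemma over C pairs.\<close>
    have "\<bar>t H - kernel_density H U\<bar> \<le> (2 + 2 * C) * \<epsilon>" if \<epsilon>: "\<epsilon> > 0" for \<epsilon>
    proof -
      obtain N where N: "\<And>k. k \<ge> N \<Longrightarrow> (\<integral>z. \<bar>case_prod (stage k) z - case_prod U z\<bar> \<partial>unit_square) \<le> \<epsilon>"
        using Ulim[OF \<epsilon>] by blast
      have "(\<lambda>K. 2 / sqrt (real K)) \<longlonglongrightarrow> 0" by real_asymp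
      then have "\<forall>\<^sub>F K in sequentially. 2 / sqrt (real K) < \<epsilon>" using \<epsilon> by (intro order_tendstoD) auto
      then have "\<forall>\<^sub>F K in sequentially. 2 / sqrt (real K) < \<epsilon> \<and> K \<ge> max N 1"
        using eventually_ge_at_top by (rule eventually_conj)
      then obtain K where K: "2 / sqrt (real K) < \<epsilon>" "K \<ge> N" "K \<ge> 1"
        by (auto simp: eventually_sequentially)
      \<comment> \<open>The regular j depends on i, which is chosen later; so closeness is first
        secured for all j in the finite window at once.\<close>
      let ?V = "\<lambda>i j. stepped (F (r i)) (word (S (r i)) (2 * j))"
      have "\<forall>\<^sub>F i in sequentially. \<forall>j\<in>{K..<2*K}. \<bar>kernel_density H (?V i j) - kernel_density H (stage (2 * j))\<bar> < \<epsilon>"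
        using tendstoD[OF stage_lim \<epsilon>] by (intro eventually_ball_finite) (auto simp: dist_real_def)
      moreover have "\<forall>\<^sub>F i in sequentially. \<bar>kernel_density H (F (r i)) - t H\<bar> < \<epsilon>"
        using tendstoD[OF t \<epsilon>] by (simp add: dist_real_def)
      ultimately have "\<forall>\<^sub>F i in sequentially. (\<forall>j\<in>{K..<2*K}. \<bar>kernel_density H (?V i j) - kernel_density H (stage (2 * j))\<bar> < \<epsilon>)
         \<and> \<bar>kernel_density H (F (r i)) - t H\<bar> < \<epsilon>" by (rule eventually_conj)
      then obtain i where i: "\<forall>j\<in>{K..<2*K}. \<bar>kernel_density H (?V i j) - kernel_density H (stage (2 * j))\<bar> < \<epsilon>"
         "\<bar>kernel_density H (F (r i)) - t H\<bar> < \<epsilon>" by (auto simp: eventually_sequentially)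
      obtain j where j: "j \<in> {K..<2*K}" "cut_bound (2 / sqrt K) (\<lambda>(x, y). F (r i) x y - ?V i j x y)"
        using reg[OF K(3)] by blast
      have "\<bar>kernel_density H (F (r i)) - kernel_density H (?V i j)\<bar> \<le> C * (2 / sqrt K)"
        unfolding C_def by (intro kernel_density_counting F kernel_stepped[OF lab] j(2)) simp
      also have "\<dots> \<le> C * \<epsilon>" using K(1) C by (intro mult_left_mono) auto
      finally have 1: "\<bar>kernel_density H (F (r i)) - kernel_density H (?V i j)\<bar> \<le> C * \<epsilon>" .
      have "cut_bound \<epsilon> (\<lambda>(x, y). stage (2 * j) x y - U x y)"
      proof (rule cut_bound_L1[of _ 1])
        show "(\<lambda>(x, y). stage (2 * j) x y - U x y) \<in> borel_measurable unit_square"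
          using borel_measurable_diff[OF kernelD(1)[OF kernel_stage] kernelD(1)[OF U(1)]] by (simp add: case_prod_beta')
        show "\<bar>case z of (x, y) \<Rightarrow> stage (2 * j) x y - U x y\<bar> \<le> 1" if "z \<in> space unit_square" for z
          using kernel_diff_bound[OF kernel_stage U(1) that, of "2 * j"] by (simp add: case_prod_beta)
        show "(\<integral>z. \<bar>case z of (x, y) \<Rightarrow> stage (2 * j) x y - U x y\<bar> \<partial>unit_square) \<le> \<epsilon>"
          using N[of "2 * j"] j(1) K(2) by (simp add: case_prod_beta)
      qed
      then have 2: "\<bar>kernel_density H (stage (2 * j)) - kernel_density H U\<bar> \<le> C * \<epsilon>"
        unfolding C_def using \<epsilon> by (intro kernel_density_counting kernel_stage U(1)) auto
      show ?thesis using 1 2 i(2) bspec[OF i(1) j(1)] by (simp add: algebra_simps)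
    qed
    then have bound: "\<bar>t H - kernel_density H U\<bar> \<le> (2 + 2 * C) * \<epsilon>" if "\<epsilon> > 0" for \<epsilon> using that by blast
    have "\<bar>t H - kernel_density H U\<bar> \<le> 0"
    proof (rule field_le_epsilon)
      fix e :: real assume "e > 0"
      then show "\<bar>t H - kernel_density H U\<bar> \<le> 0 + e"
        using bound[of "e / (2 + 2 * C)"] C by simp
    qed
    then show ?thesis by simp
  qed
  have "graphon_fun (Abs_graphon U) = U"
    using U kernelD[OF U(1)] by (intro Abs_graphon_inverse) auto
  then have "(\<lambda>i. graphon_density H (W (r i))) \<longlonglongrightarrow> graphon_density H (Abs_graphon U)" for H
    using t[of H] by (simp add: graphon_density_eq dens F_def)
  then show ?thesis using that r by blast
qed

section \<open>The upper bound\<close>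

lemma limit_density_kernel: "limit_density H \<Gamma> = kernel_density H (graphon_fun (rep_graph_limit \<Gamma>))"
  by (simp add: limit_density.rep_eq graphon_density_eq)

lemma limit_entropy_kernel: "limit_entropy \<Gamma> = kernel_entropy (graphon_fun (rep_graph_limit \<Gamma>))"
  by (simp add: limit_entropy_def graphon_entropy_eq)

lemma limit_density_nonneg: "0 \<le> limit_density H \<Gamma>"
  by (simp add: limit_density_kernel kernel_density_bounds kernel_graphon_fun)

lemma limit_entropy_bounds: "0 \<le> limit_entropy \<Gamma>" "limit_entropy \<Gamma> \<le> 1"
  by (simp_all add: limit_entropy_kernel kernel_entropy_bounds kernel_graphon_fun)

section \<open>Semicontinuity and the maximum on the support\<close>

definition sample_entropy :: "nat \<Rightarrow> graph_limit \<Rightarrow> real" where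
  "sample_entropy k \<Gamma> = (\<Sum>H\<in>labelled_graphs k. eta (limit_density H \<Gamma>))"

lemma limit_entropy_le_sample_entropy:
  assumes "2 \<le> k"
  shows "limit_entropy \<Gamma> \<le> sample_entropy k \<Gamma> / (k choose 2)"
proof -
  have "real (k choose 2) > 0" using assms by (simp add: zero_less_binomial)
  moreover have "(k choose 2) * limit_entropy \<Gamma> \<le> sample_entropy k \<Gamma>"
    unfolding limit_entropy_kernel sample_entropy_def limit_density_kernel
    using assms by (intro kernel_entropy_le_sample_entropy kernel_graphon_fun) simp
  ultimately show ?thesis by (simp add: pos_le_divide_eq mult.commute)
qed

lemma sample_entropy_less_limit_entropy:
  assumes "\<delta> > 0"
  shows "\<exists>k\<ge>2. sample_entropy k \<Gamma> / (k choose 2) < limit_entropy \<Gamma> + \<delta>"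
  unfolding limit_entropy_kernel sample_entropy_def limit_density_kernel
  using assms by (intro sample_entropy_less_kernel_entropy kernel_graphon_fun)

text \<open>k is chosen for the limit \<Gamma> alone; for this fixed k the upper bound for the
  entropy of \<open>\<Gamma>s i\<close> is continuous in the densities.\<close>

lemma limit_entropy_upper_semicontinuous:
  assumes conv: "\<And>H. (\<lambda>i. limit_density H (\<Gamma>s i)) \<longlonglongrightarrow> limit_density H \<Gamma>"
    and ent: "(\<lambda>i. limit_entropy (\<Gamma>s i)) \<longlonglongrightarrow> s"
  shows "s \<le> limit_entropy \<Gamma>"
proof (rule field_le_epsilon)
  fix \<delta> :: real assume "\<delta> > 0"
  then obtain k where k: "k \<ge> 2" "sample_entropy k \<Gamma> / (k choose 2) < limit_entropy \<Gamma> + \<delta>"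
    using sample_entropy_less_limit_entropy by blast
  have "(\<lambda>i. eta (limit_density H (\<Gamma>s i))) \<longlonglongrightarrow> eta (limit_density H \<Gamma>)" for H
    by (rule continuous_on_tendsto_compose[OF continuous_on_eta conv]) (auto simp: limit_density_nonneg)
  then have "(\<lambda>i. sample_entropy k (\<Gamma>s i) / (k choose 2)) \<longlonglongrightarrow> sample_entropy k \<Gamma> / (k choose 2)"
    unfolding sample_entropy_def by (intro tendsto_divide tendsto_sum tendsto_const) (use k in auto)
  from LIMSEQ_le[OF ent this] have "s \<le> sample_entropy k \<Gamma> / (k choose 2)"
    using limit_entropy_le_sample_entropy[OF k(1)] by blast
  then show "s \<le> limit_entropy \<Gamma> + \<delta>" using k(2) by simp
qed

lemma graph_limit_sequence_compact:
  fixes \<Gamma>s :: "nat \<Rightarrow> graph_limit"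
  obtains r \<Gamma> where "strict_mono r" "\<And>H. (\<lambda>i. limit_density H (\<Gamma>s (r i))) \<longlonglongrightarrow> limit_density H \<Gamma>"
proof -
  obtain r U where r: "strict_mono r"
    and U: "\<And>H. (\<lambda>i. graphon_density H (rep_graph_limit (\<Gamma>s (r i)))) \<longlonglongrightarrow> graphon_density H U"
    using graphon_sequence_compact[of "\<lambda>i. rep_graph_limit (\<Gamma>s i)"] by blast
  show ?thesis
    by (rule that[OF r, of "abs_graph_limit U"]) (use U in \<open>simp add: limit_density.rep_eq[of _ "\<Gamma>s _"] limit_density.abs_eq\<close>)
qed

lemma measure_support_closed:
  assumes "\<And>i. \<Gamma>s i \<in> measure_support \<mu>" and conv: "\<And>H. (\<lambda>i. limit_density H (\<Gamma>s i)) \<longlonglongrightarrow> limit_density H \<Gamma>"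
  shows "\<Gamma> \<in> measure_support \<mu>"
  unfolding measure_support_def
proof (intro CollectI allI impI)
  fix U assume U: "open U \<and> \<Gamma> \<in> U"
  then obtain T where T: "open T" "U = Limit -` T" unfolding open_graph_limit_def by blast
  have "(\<lambda>i. Limit (\<Gamma>s i)) \<longlonglongrightarrow> Limit \<Gamma>" using conv by (simp add: Limit_tendsto_Limit_iff)
  then have "\<forall>\<^sub>F i in sequentially. Limit (\<Gamma>s i) \<in> T"
    using T U by (intro topological_tendstoD) auto
  then obtain i where "\<Gamma>s i \<in> U" using T by (auto simp: eventually_sequentially)
  then show "0 < emeasure \<mu> U" using assms(1)[of i] U by (auto simp: measure_support_def)
qed

lemma limit_entropy_attains_max:
  fixes \<mu> :: "graph_limit measure"
  assumes "measure_support \<mu> \<noteq> {}"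
  obtains \<Gamma> where "\<Gamma> \<in> measure_support \<mu>" "\<And>\<Gamma>'. \<Gamma>' \<in> measure_support \<mu> \<Longrightarrow> limit_entropy \<Gamma>' \<le> limit_entropy \<Gamma>"
proof -
  let ?E = "limit_entropy ` measure_support \<mu>"
  have bdd: "bdd_above ?E" using limit_entropy_bounds(2) by (auto simp: bdd_above_def)
  have ne: "?E \<noteq> {}" using assms by simp
  have "\<exists>\<Gamma>\<in>measure_support \<mu>. Sup ?E - 1 / Suc i < limit_entropy \<Gamma>" for i
    using less_cSupD[OF ne, of "Sup ?E - 1 / Suc i"] by auto
  then obtain \<Gamma>s where \<Gamma>s: "\<And>i. \<Gamma>s i \<in> measure_support \<mu>" "\<And>i. Sup ?E - 1 / Suc i < limit_entropy (\<Gamma>s i)"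
    by metis
  have lim: "(\<lambda>i. limit_entropy (\<Gamma>s i)) \<longlonglongrightarrow> Sup ?E"
  proof (rule tendsto_sandwich)
    have "(\<lambda>i. s - 1 / Suc i) \<longlonglongrightarrow> s" for s :: real by real_asymp
    then show "(\<lambda>i. Sup ?E - 1 / Suc i) \<longlonglongrightarrow> Sup ?E" .
    show "\<forall>\<^sub>F i in sequentially. Sup ?E - 1 / Suc i \<le> limit_entropy (\<Gamma>s i)"
      using \<Gamma>s(2) by (intro always_eventually allI less_imp_le)
    show "\<forall>\<^sub>F i in sequentially. limit_entropy (\<Gamma>s i) \<le> Sup ?E"
      using \<Gamma>s(1) bdd by (intro always_eventually allI cSup_upper) auto
  qed simp
  obtain r \<Gamma> where r: "strict_mono r" and conv: "\<And>H. (\<lambda>i. limit_density H (\<Gamma>s (r i))) \<longlonglongrightarrow> limit_density H \<Gamma>"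
    using graph_limit_sequence_compact by blast
  have "\<Gamma> \<in> measure_support \<mu>" using \<Gamma>s(1) by (intro measure_support_closed[OF _ conv])
  moreover have "Sup ?E \<le> limit_entropy \<Gamma>"
    using LIMSEQ_subseq_LIMSEQ[OF lim r] by (intro limit_entropy_upper_semicontinuous[OF conv]) (simp add: comp_def)
  ultimately show ?thesis using that[of \<Gamma>] bdd by (meson cSup_upper image_eqI order_trans)
qed

text \<open>The space of graph limits is second countable, so almost all of the mass of \<open>\<mu>\<close> is covered by
  finitely many of the neighbourhoods.\<close>

lemma measure_support_finite_cover:
  fixes \<mu> :: "graph_limit measure"
  assumes "prob_space \<mu>" "sets \<mu> = sets borel"
    and N: "\<And>\<Gamma>. \<Gamma> \<in> measure_support \<mu> \<Longrightarrow> open (N \<Gamma>) \<and> \<Gamma> \<in> N \<Gamma>" and "\<delta> > 0"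
  obtains F where "finite F" "F \<subseteq> measure_support \<mu>" "measure \<mu> (\<Union>\<Gamma>\<in>F. N \<Gamma>) > 1 - \<delta>"
proof -
  interpret prob_space \<mu> by fact
  have sp: "space \<mu> = UNIV" using sets_eq_imp_space_eq[OF assms(2)] by simp
  have op: "U \<in> sets \<mu>" if "open U" for U using that assms(2) by simp
  \<comment> \<open>A point off the support has a null neighbourhood, and countably many of these
    are still null. So the neighbourhoods of support points carry the full mass.\<close>
  have "\<exists>U. open U \<and> \<Gamma> \<in> U \<and> (if \<Gamma> \<in> measure_support \<mu> then U = N \<Gamma> else emeasure \<mu> U = 0)" for \<Gamma>
  proof (cases "\<Gamma> \<in> measure_support \<mu>")
    case True
    then show ?thesis using N[OF True] by auto
  next
    case False
    then obtain U where "open U" "\<Gamma> \<in> U" "emeasure \<mu> U = 0"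
      unfolding measure_support_def by (auto simp: not_gr_zero)
    then show ?thesis using False by auto
  qed
  then obtain U where U: "\<And>\<Gamma>. open (U \<Gamma>)" "\<And>\<Gamma>. \<Gamma> \<in> U \<Gamma>" "\<And>\<Gamma>. \<Gamma> \<in> measure_support \<mu> \<Longrightarrow> U \<Gamma> = N \<Gamma>"
    "\<And>\<Gamma>. \<Gamma> \<notin> measure_support \<mu> \<Longrightarrow> emeasure \<mu> (U \<Gamma>) = 0" by metis
  \<comment> \<open>Lindelof's theorem is applied to open sets in the target of
    \<open>embed\<close>, a countable product of real lines, and pulled back.\<close>
  have "\<exists>T. open T \<and> U \<Gamma> = (\<lambda>\<Gamma>. embed (Limit \<Gamma>)) -` T" for \<Gamma>
  proof -
    obtain V where "open V" "U \<Gamma> = Limit -` V" using U(1) unfolding open_graph_limit_def by blast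
    moreover from this obtain T where "open T" "V = embed -` T" unfolding open_graph_or_limit_def by blast
    ultimately show ?thesis by (intro exI[of _ T]) auto
  qed
  then obtain T where T: "\<And>\<Gamma>. open (T \<Gamma>)" "\<And>\<Gamma>. U \<Gamma> = (\<lambda>\<Gamma>. embed (Limit \<Gamma>)) -` T \<Gamma>" by metis
  obtain \<T> where \<T>: "\<T> \<subseteq> range T" "countable \<T>" "\<Union>\<T> = \<Union>(range T)"
    using Lindelof[of "range T"] T(1) by blast
  then obtain D where D: "countable D" "\<T> = T ` D" using countable_subset_image[of \<T> T UNIV] by auto
  have cover: "\<exists>\<Gamma>'\<in>D. \<Gamma> \<in> U \<Gamma>'" for \<Gamma>
  proof -
    have "embed (Limit \<Gamma>) \<in> T \<Gamma>" using U(2)[of \<Gamma>] T(2)[of \<Gamma>] by auto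
    then have "embed (Limit \<Gamma>) \<in> \<Union>\<T>" unfolding \<T>(3) by blast
    then show ?thesis using D(2) T(2) by auto
  qed
  then have Dne: "D \<noteq> {}" by blast
  define e where "e = from_nat_into D"
  have e: "range e = D" using D(1) Dne by (simp add: e_def range_from_nat_into)
  define A where "A n = (\<Union>i\<in>{i. i < n \<and> e i \<in> measure_support \<mu>}. U (e i))" for n
  have Am: "A n \<in> sets \<mu>" for n unfolding A_def using U(1) by (intro op open_UN) auto
  have "(\<lambda>n. measure \<mu> (A n)) \<longlonglongrightarrow> measure \<mu> (\<Union>n. A n)"
    using Am by (intro finite_Lim_measure_incseq) (auto simp: incseq_def A_def intro: less_le_trans)
  moreover have "measure \<mu> (\<Union>n. A n) = 1"
  proof -
    define Z where "Z = (\<Union>i\<in>{i. e i \<notin> measure_support \<mu>}. U (e i))"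
    have "Z \<in> null_sets \<mu>" unfolding Z_def
      by (intro null_sets_UN') (auto simp: null_sets_def U op)
    moreover have "space \<mu> = (\<Union>n. A n) \<union> Z"
    proof -
      have "\<Gamma> \<in> (\<Union>n. A n) \<union> Z" for \<Gamma>
      proof -
        obtain i where i: "\<Gamma> \<in> U (e i)" using cover[of \<Gamma>] e by auto
        show ?thesis
        proof (cases "e i \<in> measure_support \<mu>")
          case True
          then have "\<Gamma> \<in> A (Suc i)" using i by (auto simp: A_def)
          then show ?thesis by blast
        qed (use i in \<open>auto simp: Z_def\<close>)
      qed
      then show ?thesis unfolding sp by blast
    qed
    ultimately show ?thesis using measure_Un_null_set[of "\<Union>n. A n" \<mu> Z] Am prob_space by auto
  qed
  ultimately have "\<forall>\<^sub>F n in sequentially. 1 - \<delta> < measure \<mu> (A n)"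
    using \<open>\<delta> > 0\<close> by (intro order_tendstoD(1)) auto
  then obtain n where n: "1 - \<delta> < measure \<mu> (A n)" by (auto simp: eventually_sequentially)
  define F where "F = e ` {i. i < n \<and> e i \<in> measure_support \<mu>}"
  have "A n = (\<Union>\<Gamma>\<in>F. N \<Gamma>)" using U(3) by (auto simp: A_def F_def)
  then show ?thesis using that[of F] n by (auto simp: F_def)
qed

text \<open>Continuity of the entropy within the nonnegative orthant. The box is given by non-strict
  bounds, since expectations preserve these.\<close>

lemma eta_sum_nhd:
  fixes p :: "'a \<Rightarrow> real"
  assumes "finite L" "\<And>a. a \<in> L \<Longrightarrow> 0 \<le> p a" "\<eta> > 0"
  shows "\<exists>\<epsilon>>0. \<forall>x. (\<forall>a\<in>L. 0 \<le> x a \<and> \<bar>x a - p a\<bar> \<le> \<epsilon>) \<longrightarrow> (\<Sum>a\<in>L. eta (x a)) < (\<Sum>a\<in>L. eta (p a)) + \<eta>"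
  using assms
proof (induction L arbitrary: \<eta> rule: finite_induct)
  case empty
  then show ?case by (auto intro!: exI[of _ 1])
next
  case (insert a L)
  have "\<eta> / 2 > 0" using insert by simp
  have "\<exists>\<epsilon>>0. \<forall>x. (\<forall>a\<in>L. 0 \<le> x a \<and> \<bar>x a - p a\<bar> \<le> \<epsilon>) \<longrightarrow>
      (\<Sum>a\<in>L. eta (x a)) < (\<Sum>a\<in>L. eta (p a)) + \<eta> / 2"
    by (rule insert.IH) (use insert.prems in auto)
  then obtain \<epsilon>1 where \<epsilon>1: "\<epsilon>1 > 0" "\<forall>x. (\<forall>a\<in>L. 0 \<le> x a \<and> \<bar>x a - p a\<bar> \<le> \<epsilon>1) \<longrightarrow>
      (\<Sum>a\<in>L. eta (x a)) < (\<Sum>a\<in>L. eta (p a)) + \<eta> / 2"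
    by (elim exE conjE) (rule that)
  have "\<exists>d>0. \<forall>y\<in>{0..}. dist y (p a) < d \<longrightarrow> dist (eta y) (eta (p a)) < \<eta> / 2"
    using continuous_on_eta[unfolded continuous_on_iff, rule_format, of "p a" "\<eta> / 2"]
      insert.prems(1)[of a] \<open>\<eta> / 2 > 0\<close> by fastforce
  then obtain d where d: "d > 0" "\<And>y. 0 \<le> y \<Longrightarrow> \<bar>y - p a\<bar> < d \<Longrightarrow> \<bar>eta y - eta (p a)\<bar> < \<eta> / 2"
    by (auto simp: dist_real_def)
  show ?case
  proof (intro exI[of _ "min \<epsilon>1 (d / 2)"] conjI allI impI)
    fix x assume x: "\<forall>a\<in>insert a L. 0 \<le> x a \<and> \<bar>x a - p a\<bar> \<le> min \<epsilon>1 (d / 2)"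
    have "(\<Sum>a\<in>L. eta (x a)) < (\<Sum>a\<in>L. eta (p a)) + \<eta> / 2" using x by (intro \<epsilon>1(2)[rule_format]) auto
    moreover have "\<bar>eta (x a) - eta (p a)\<bar> < \<eta> / 2" using x d(1) by (intro d(2)) auto
    ultimately show "(\<Sum>a\<in>insert a L. eta (x a)) < (\<Sum>a\<in>insert a L. eta (p a)) + \<eta>"
      unfolding sum.insert[OF insert(1,2)] by linarith
  qed (use \<epsilon>1 d in auto)
qed

lemma pmf_entropy_sampled_eq:
  assumes R: "set_pmf R \<subseteq> unlabelled_graphs n" and k: "1 \<le> k" "k \<le> n"
  shows "pmf_entropy (sampled k R) = (\<Sum>H\<in>labelled_graphs k. eta (measure_pmf.expectation R (ugraph_density H)))"
proof -
  have "pmf_entropy (sampled k R) = (\<Sum>E\<in>Pow (pairs_on {1..k}). eta (pmf (sampled k R) E))"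
    by (rule pmf_entropy_eq_sum[OF _ set_sampled]) simp
  also have "\<dots> = (\<Sum>H\<in>labelled_graphs k. eta (pmf (sampled k R) (edge_pairs H)))"
    by (rule sum.reindex_bij_betw[OF bij_betw_edge_pairs[OF k(1)], symmetric])
  also have "\<dots> = (\<Sum>H\<in>labelled_graphs k. eta (measure_pmf.expectation R (ugraph_density H)))"
    using pmf_sampled[OF R] k(2) by (intro sum.cong refl) (auto simp: labelled_graphs_def)
  finally show ?thesis .
qed

section \<open>Neighbourhoods of the support and the mass near them\<close>

text \<open>Weak convergence tests continuous functions only, so this hat function replaces the
  indicator of a neighbourhood. It is positive exactly where the l1 distance of the order-k
  densities from those of \<Gamma> is below \<epsilon>, and it is defined on graphs and limits
  alike.\<close>

definition bump :: "nat \<Rightarrow> real \<Rightarrow> graph_limit \<Rightarrow> graph_or_limit \<Rightarrow> real" where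
  "bump k \<epsilon> \<Gamma> x = max 0 (1 - (\<Sum>H\<in>labelled_graphs k. \<bar>induced_density H x - limit_density H \<Gamma>\<bar>) / \<epsilon>)"

lemma continuous_induced_density: "continuous_on UNIV (induced_density H)"
  unfolding continuous_on_def
proof
  fix x :: graph_or_limit
  have "((\<lambda>i. i) \<longlongrightarrow> x) (at x within UNIV)" by (rule tendsto_ident_at)
  then show "(induced_density H \<longlongrightarrow> induced_density H x) (at x within UNIV)"
    unfolding tendsto_graph_or_limit_iff by blast
qed

lemma continuous_bump: "\<epsilon> > 0 \<Longrightarrow> continuous_on UNIV (bump k \<epsilon> \<Gamma>)"
  unfolding bump_def[abs_def] by (intro continuous_intros continuous_induced_density) auto

lemma bump_self: "bump k \<epsilon> \<Gamma> (Limit \<Gamma>) = 1"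
  by (simp add: bump_def)

lemma bump_posD:
  assumes "bump k \<epsilon> \<Gamma> x > 0" "\<epsilon> > 0" "H \<in> labelled_graphs k"
  shows "\<bar>induced_density H x - limit_density H \<Gamma>\<bar> \<le> \<epsilon>"
proof -
  have "(\<Sum>H\<in>labelled_graphs k. \<bar>induced_density H x - limit_density H \<Gamma>\<bar>) / \<epsilon> < 1"
    using assms(1) by (simp add: bump_def less_max_iff_disj)
  then have "(\<Sum>H\<in>labelled_graphs k. \<bar>induced_density H x - limit_density H \<Gamma>\<bar>) < \<epsilon>"
    using assms(2) by (simp add: divide_less_eq)
  moreover have "\<bar>induced_density H x - limit_density H \<Gamma>\<bar> \<le> (\<Sum>H\<in>labelled_graphs k. \<bar>induced_density H x - limit_density H \<Gamma>\<bar>)"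
    using assms(3) by (intro member_le_sum) (auto simp: finite_labelled_graphs)
  ultimately show ?thesis by simp
qed

lemma ugraph_density_bounds: "0 \<le> ugraph_density H g" "ugraph_density H g \<le> 1"
  by (simp_all add: ugraph_density.rep_eq graph_density_def)

text \<open>The set of distributions supported in a density box is convex, so the averaged densities still
  lie in the box.\<close>

lemma pmf_entropy_in_box:
  fixes B \<epsilon> :: real
  assumes R: "set_pmf R \<subseteq> unlabelled_graphs n" and k: "2 \<le> k" "k \<le> n" and \<epsilon>: "\<epsilon> > 0"
    and box: "\<And>x. (\<And>H. H \<in> labelled_graphs k \<Longrightarrow> 0 \<le> x H \<and> \<bar>x H - limit_density H \<Gamma>\<bar> \<le> \<epsilon>) \<Longrightarrow>
       (\<Sum>H\<in>labelled_graphs k. eta (x H)) / (k choose 2) < B"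
    and bump: "\<And>g. g \<in> set_pmf R \<Longrightarrow> bump k \<epsilon> \<Gamma> (Graph g) > 0"
  shows "pmf_entropy R \<le> (n choose 2) * B"
proof -
  let ?x = "\<lambda>H. measure_pmf.expectation R (ugraph_density H)"
  have int: "integrable (measure_pmf R) (ugraph_density H)" for H
    using ugraph_density_bounds by (intro measure_pmf.integrable_bounded_real[where B = 1]) (auto simp: abs_le_iff intro: order_trans[of _ 0])
  have "0 \<le> ?x H \<and> \<bar>?x H - limit_density H \<Gamma>\<bar> \<le> \<epsilon>" if H: "H \<in> labelled_graphs k" for H
  proof
    show "0 \<le> ?x H" using ugraph_density_bounds by (intro integral_nonneg_AE) auto
    have b: "\<bar>ugraph_density H g - limit_density H \<Gamma>\<bar> \<le> \<epsilon>" if "g \<in> set_pmf R" for g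
      using bump_posD[OF bump[OF that] \<epsilon> H] by simp
    have "AE g in R. ugraph_density H g \<le> limit_density H \<Gamma> + \<epsilon>" "AE g in R. limit_density H \<Gamma> - \<epsilon> \<le> ugraph_density H g"
      using b by (auto simp: AE_measure_pmf_iff abs_le_iff algebra_simps)
    then have "?x H \<le> limit_density H \<Gamma> + \<epsilon>" "limit_density H \<Gamma> - \<epsilon> \<le> ?x H"
      using measure_pmf.integral_le_const[OF int] measure_pmf.integral_ge_const[OF int] by blast+
    then show "\<bar>?x H - limit_density H \<Gamma>\<bar> \<le> \<epsilon>" by (simp add: abs_le_iff)
  qed
  from box[of ?x, OF this] have "pmf_entropy (sampled k R) / (k choose 2) < B"
    using pmf_entropy_sampled_eq[OF R _ k(2)] k(1) by simp
  with pmf_entropy_le_sampled[OF R k] have "pmf_entropy R / (n choose 2) \<le> B" by linarith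
  moreover have "real (n choose 2) > 0" using k by (simp add: zero_less_binomial)
  ultimately show ?thesis by (simp add: pos_divide_le_eq mult.commute)
qed

text \<open>Chain rule for the label. Given \<open>None\<close> no information on densities is left,
  only the trivial bound n choose 2; this event has probability at most \<delta>, which explains the
  \<delta> beside B.\<close>

lemma pmf_entropy_near_support:
  fixes B \<delta> :: real
  assumes R: "set_pmf R \<subseteq> unlabelled_graphs n" and n: "2 \<le> n" and F: "finite F"
    and k: "\<And>\<Gamma>. \<Gamma> \<in> F \<Longrightarrow> 2 \<le> k \<Gamma> \<and> k \<Gamma> \<le> n" and \<epsilon>: "\<And>\<Gamma>. \<Gamma> \<in> F \<Longrightarrow> \<epsilon> \<Gamma> > 0"
    and box: "\<And>\<Gamma> x. \<Gamma> \<in> F \<Longrightarrow> (\<And>H. H \<in> labelled_graphs (k \<Gamma>) \<Longrightarrow> 0 \<le> x H \<and> \<bar>x H - limit_density H \<Gamma>\<bar> \<le> \<epsilon> \<Gamma>) \<Longrightarrow>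
       (\<Sum>H\<in>labelled_graphs (k \<Gamma>). eta (x H)) / (k \<Gamma> choose 2) < B"
    and prob: "measure_pmf.prob R {g. \<exists>\<Gamma>\<in>F. bump (k \<Gamma>) (\<epsilon> \<Gamma>) \<Gamma> (Graph g) > 0} \<ge> 1 - \<delta>" and B: "0 \<le> B"
  shows "pmf_entropy R \<le> log 2 (card F + 1) + (n choose 2) * (B + \<delta>)"
proof -
  let ?near = "\<lambda>\<Gamma> g. \<Gamma> \<in> F \<and> bump (k \<Gamma>) (\<epsilon> \<Gamma>) \<Gamma> (Graph g) > 0"
  \<comment> \<open>Neighbourhoods may overlap, so one is chosen. \<open>None\<close> accounts for
    the extra 1 in \<open>card F + 1\<close>.\<close>
  define label where "label g = (if \<exists>\<Gamma>. ?near \<Gamma> g then Some (SOME \<Gamma>. ?near \<Gamma> g) else None)" for g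
  have label: "?near \<Gamma> g" if "label g = Some \<Gamma>" for g \<Gamma>
    using that someI_ex[of "\<lambda>\<Gamma>. ?near \<Gamma> g"] by (auto simp: label_def split: if_splits)
  have fin: "finite (set_pmf R)" using R finite_unlabelled_graphs finite_subset by blast
  let ?Q = "map_pmf label R" and ?S = "label ` set_pmf R"
  let ?cond = "\<lambda>b. cond_pmf R (label -` {b})"
  have cset: "set_pmf (?cond b) = set_pmf R \<inter> label -` {b}" if "b \<in> ?S" for b
    using that by (intro set_cond_pmf) auto
  have "set_pmf ?Q \<subseteq> insert None (Some ` F)"
  proof -
    have "label g \<in> insert None (Some ` F)" for g
      using label[of g] by (cases "label g") auto
    then show ?thesis by auto
  qed
  then have "pmf_entropy ?Q \<le> log 2 (card (insert None (Some ` F)))"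
    using F by (intro pmf_entropy_le_log_card) auto
  also have "card (insert None (Some ` F)) = card F + 1" using F by (simp add: card_image)
  finally have 1: "pmf_entropy ?Q \<le> log 2 (card F + 1)" by simp
  have cond: "pmf_entropy (?cond b) \<le> (n choose 2) * (B + (if b = None then 1 else 0))" if b: "b \<in> ?S" for b
  proof (cases b)
    case None
    have "pmf_entropy (?cond b) \<le> n choose 2"
      using cset[OF b] R by (intro pmf_entropy_le_choose_2 n) auto
    also have "\<dots> \<le> (n choose 2) * (B + 1)" using B by (simp add: distrib_left)
    finally show ?thesis using None by simp
  next
    case (Some \<Gamma>)
    obtain g where "label g = Some \<Gamma>" using b Some by auto
    then have \<Gamma>: "\<Gamma> \<in> F" using label by blast
    have "pmf_entropy (?cond b) \<le> (n choose 2) * B"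
    proof (rule pmf_entropy_in_box[where k = "k \<Gamma>" and \<epsilon> = "\<epsilon> \<Gamma>" and \<Gamma> = \<Gamma>])
      show "set_pmf (?cond b) \<subseteq> unlabelled_graphs n" using cset[OF b] R by auto
      fix g assume "g \<in> set_pmf (?cond b)"
      then show "bump (k \<Gamma>) (\<epsilon> \<Gamma>) \<Gamma> (Graph g) > 0" using cset[OF b] Some label[of g \<Gamma>] by auto
    qed (use k[OF \<Gamma>] \<epsilon>[OF \<Gamma>] box[OF \<Gamma>] in auto)
    then show ?thesis using Some by simp
  qed
  have None: "pmf ?Q None \<le> \<delta>"
  proof -
    have "label -` {None} = UNIV - {g. \<exists>\<Gamma>\<in>F. bump (k \<Gamma>) (\<epsilon> \<Gamma>) \<Gamma> (Graph g) > 0}"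
    proof -
      have "label g = None \<longleftrightarrow> \<not> (\<exists>\<Gamma>\<in>F. bump (k \<Gamma>) (\<epsilon> \<Gamma>) \<Gamma> (Graph g) > 0)" for g
        unfolding label_def Bex_def by simp
      then show ?thesis by auto
    qed
    then have "pmf ?Q None = 1 - measure_pmf.prob R {g. \<exists>\<Gamma>\<in>F. bump (k \<Gamma>) (\<epsilon> \<Gamma>) \<Gamma> (Graph g) > 0}"
      using measure_pmf.prob_compl[of "{g. \<exists>\<Gamma>\<in>F. bump (k \<Gamma>) (\<epsilon> \<Gamma>) \<Gamma> (Graph g) > 0}" R] by (simp add: pmf_map)
    then show ?thesis using prob by simp
  qed
  have "(\<Sum>b\<in>?S. pmf ?Q b * pmf_entropy (?cond b)) \<le> (\<Sum>b\<in>?S. pmf ?Q b * ((n choose 2) * (B + (if b = None then 1 else 0))))"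
    using cond by (intro sum_mono mult_left_mono) auto
  also have "\<dots> = (n choose 2) * (B * (\<Sum>b\<in>?S. pmf ?Q b) + (\<Sum>b\<in>?S. if b = None then pmf ?Q b else 0))"
    unfolding sum_distrib_left distrib_left sum.distrib[symmetric] by (intro sum.cong) (auto simp: algebra_simps)
  also have "(\<Sum>b\<in>?S. pmf ?Q b) = 1" using fin by (intro sum_pmf_eq_1) auto
  also have "(\<Sum>b\<in>?S. if b = None then pmf ?Q b else 0) \<le> pmf ?Q None"
    using fin by (simp add: sum.delta)
  also note None
  finally have 2: "(\<Sum>b\<in>?S. pmf ?Q b * pmf_entropy (?cond b)) \<le> (n choose 2) * (B + \<delta>)"
    by (simp add: mult_left_mono)
  show ?thesis using pmf_entropy_chain[OF fin, of label] 1 2 by linarith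
qed

lemma set_ignore_labels:
  assumes "random_graph_on n R"
  shows "set_pmf (ignore_labels R) \<subseteq> unlabelled_graphs n"
  using assms
  by (cases R) (auto simp: unlabelled_graphs_def labelled_graphs_def unlabel_def ugraph_order.abs_eq)

lemma random_graph_entropy_le:
  assumes "random_graph_on n R" "1 \<le> n"
  shows "random_graph_entropy R \<le> pmf_entropy (ignore_labels R) + n * log 2 n"
proof (cases R)
  case (Labelled p)
  then show ?thesis using assms pmf_entropy_labelled_le[of p n] by simp
next
  case (Unlabelled p)
  then show ?thesis using assms by simp
qed

lemma integral_graph_distr:
  assumes "continuous_on UNIV (f :: graph_or_limit \<Rightarrow> real)"
  shows "(\<integral>x. f x \<partial>graph_distr R) = measure_pmf.expectation (ignore_labels R) (\<lambda>g. f (Graph g))"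
  unfolding graph_distr_def
  by (rule integral_distr) (simp, rule borel_measurable_continuous_onI[OF assms])

lemma integral_limit_distr:
  assumes "continuous_on UNIV (f :: graph_or_limit \<Rightarrow> real)" "sets \<mu> = sets borel"
  shows "(\<integral>x. f x \<partial>limit_distr \<mu>) = (\<integral>\<Gamma>. f (Limit \<Gamma>) \<partial>\<mu>)"
proof -
  have "Limit \<in> \<mu> \<rightarrow>\<^sub>M borel" using measurable_Limit measurable_cong_sets[OF assms(2) refl] by blast
  then show ?thesis unfolding limit_distr_def
    by (rule integral_distr) (rule borel_measurable_continuous_onI[OF assms(1)])
qed

text \<open>One \<delta> is lost by the box around each \<Gamma>, one by the mass outside the
  neighbourhoods, and one by the labels together with the choice of a neighbourhood, which is
  o(n^2); 4 \<delta> leaves room.\<close>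

lemma entropy_eventually_le:
  fixes G :: "nat \<Rightarrow> random_graph" and \<mu> :: "graph_limit measure"
  assumes G: "\<And>n. n \<ge> 1 \<Longrightarrow> random_graph_on n (G n)"
    and \<mu>: "prob_space \<mu>" "sets \<mu> = sets borel"
    and conv: "weakly_converges (\<lambda>n. graph_distr (G n)) (limit_distr \<mu>)"
    and M: "\<And>\<Gamma>. \<Gamma> \<in> measure_support \<mu> \<Longrightarrow> limit_entropy \<Gamma> \<le> M" "0 \<le> M" and \<delta>: "\<delta> > 0"
  shows "\<forall>\<^sub>F n in sequentially. random_graph_entropy (G n) / (n choose 2) \<le> M + 4 * \<delta>"
proof -
  interpret prob_space \<mu> by fact
  have "\<exists>k \<epsilon>. 2 \<le> k \<and> \<epsilon> > 0 \<and> (\<forall>x. (\<forall>H\<in>labelled_graphs k. 0 \<le> x H \<and> \<bar>x H - limit_density H \<Gamma>\<bar> \<le> \<epsilon>) \<longrightarrow>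
      (\<Sum>H\<in>labelled_graphs k. eta (x H)) / (k choose 2) < M + \<delta>)" if \<Gamma>: "\<Gamma> \<in> measure_support \<mu>" for \<Gamma>
  proof -
    obtain k where k: "k \<ge> 2" "sample_entropy k \<Gamma> / (k choose 2) < limit_entropy \<Gamma> + \<delta>"
      using sample_entropy_less_limit_entropy[OF \<delta>] by blast
    have pos: "real (k choose 2) > 0" using k by (simp add: zero_less_binomial)
    \<comment> \<open>The gap between the sample entropy at \<Gamma> and its target, before division
      by k choose 2; positive by the choice of k.\<close>
    define \<eta> where "\<eta> = (M + \<delta>) * (k choose 2) - sample_entropy k \<Gamma>"
    have "sample_entropy k \<Gamma> / (k choose 2) < M + \<delta>" using k(2) M(1)[OF \<Gamma>] by simp
    then have "\<eta> > 0" using pos by (simp add: \<eta>_def pos_divide_less_eq)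
    then obtain \<epsilon> where "\<epsilon> > 0" "\<forall>x. (\<forall>H\<in>labelled_graphs k. 0 \<le> x H \<and> \<bar>x H - limit_density H \<Gamma>\<bar> \<le> \<epsilon>) \<longrightarrow>
       (\<Sum>H\<in>labelled_graphs k. eta (x H)) < (\<Sum>H\<in>labelled_graphs k. eta (limit_density H \<Gamma>)) + \<eta>"
      using eta_sum_nhd[OF finite_labelled_graphs limit_density_nonneg] by meson
    then show ?thesis using k(1) pos
      by (intro exI[of _ k] exI[of _ \<epsilon>]) (auto simp: \<eta>_def sample_entropy_def pos_divide_less_eq)
  qed
  then obtain k \<epsilon> where k: "\<And>\<Gamma>. \<Gamma> \<in> measure_support \<mu> \<Longrightarrow> 2 \<le> k \<Gamma>"
    and \<epsilon>: "\<And>\<Gamma>. \<Gamma> \<in> measure_support \<mu> \<Longrightarrow> \<epsilon> \<Gamma> > 0"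
    and box: "\<And>\<Gamma> x. \<Gamma> \<in> measure_support \<mu> \<Longrightarrow> (\<And>H. H \<in> labelled_graphs (k \<Gamma>) \<Longrightarrow> 0 \<le> x H \<and> \<bar>x H - limit_density H \<Gamma>\<bar> \<le> \<epsilon> \<Gamma>) \<Longrightarrow>
       (\<Sum>H\<in>labelled_graphs (k \<Gamma>). eta (x H)) / (k \<Gamma> choose 2) < M + \<delta>"
    by metis
  define \<phi> where "\<phi> \<Gamma> = bump (k \<Gamma>) (\<epsilon> \<Gamma>) \<Gamma>" for \<Gamma>
  have cont\<phi>: "continuous_on UNIV (\<phi> \<Gamma>)" if "\<Gamma> \<in> measure_support \<mu>" for \<Gamma>
    unfolding \<phi>_def by (rule continuous_bump[OF \<epsilon>[OF that]])
  \<comment> \<open>The level 1/2 lies strictly between 0 and the value 1 at \<Gamma>, which leaves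
    room for a continuous f between two indicators.\<close>
  define N where "N \<Gamma> = Limit -` (\<phi> \<Gamma> -` {1/2<..})" for \<Gamma>
  have N: "open (N \<Gamma>) \<and> \<Gamma> \<in> N \<Gamma>" if "\<Gamma> \<in> measure_support \<mu>" for \<Gamma>
  proof
    have "open (\<phi> \<Gamma> -` {1/2<..})" by (rule open_vimage[OF open_greaterThan cont\<phi>[OF that]])
    then show "open (N \<Gamma>)" unfolding N_def by (rule open_vimage[OF _ continuous_Limit])
    show "\<Gamma> \<in> N \<Gamma>" by (simp add: N_def \<phi>_def bump_self)
  qed
  obtain F where F: "finite F" "F \<subseteq> measure_support \<mu>" "measure \<mu> (\<Union>\<Gamma>\<in>F. N \<Gamma>) > 1 - \<delta>"
    using measure_support_finite_cover[OF \<mu> N \<delta>] by blast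
  \<comment> \<open>f is 1 on every \<open>N \<Gamma>\<close> and 0 where all bumps vanish. Its
    integral is thus above 1 - \<delta> for \<mu>, hence eventually for \<open>G n\<close>, and
    there it bounds the probability of a positive bump from below.\<close>
  define f where "f x = min 1 (2 * (\<Sum>\<Gamma>\<in>F. \<phi> \<Gamma> x))" for x
  have contf: "continuous_on UNIV f"
    unfolding f_def[abs_def] using cont\<phi> F(2) by (intro continuous_intros) auto
  have \<phi>0: "0 \<le> \<phi> \<Gamma> x" for \<Gamma> x by (simp add: \<phi>_def bump_def)
  have f01: "0 \<le> f x" "f x \<le> 1" for x by (auto simp: f_def intro!: sum_nonneg \<phi>0)
  have Nm: "(\<Union>\<Gamma>\<in>F. N \<Gamma>) \<in> sets \<mu>"
  proof -
    have "open (\<Union>\<Gamma>\<in>F. N \<Gamma>)" using N F(2) by blast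
    then show ?thesis using \<mu>(2) by simp
  qed
  have "1 - \<delta> < (\<integral>\<Gamma>. f (Limit \<Gamma>) \<partial>\<mu>)"
  proof -
    have "measure \<mu> (\<Union>\<Gamma>\<in>F. N \<Gamma>) = (\<integral>\<Gamma>. indicator (\<Union>\<Gamma>\<in>F. N \<Gamma>) \<Gamma> \<partial>\<mu>)"
      using Nm by (simp add: Int_absorb1 sets.sets_into_space)
    also have "\<dots> \<le> (\<integral>\<Gamma>. f (Limit \<Gamma>) \<partial>\<mu>)"
    proof (rule integral_mono)
      show "integrable \<mu> (indicator (\<Union>\<Gamma>\<in>F. N \<Gamma>) :: _ \<Rightarrow> real)"
        using Nm by (intro integrable_real_indicator) (auto simp: emeasure_eq_measure)
      have "(\<lambda>\<Gamma>. f (Limit \<Gamma>)) \<in> borel_measurable borel"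
        by (rule measurable_compose[OF measurable_Limit borel_measurable_continuous_onI[OF contf]])
      then have "(\<lambda>\<Gamma>. f (Limit \<Gamma>)) \<in> borel_measurable \<mu>" using measurable_cong_sets[OF \<mu>(2) refl] by blast
      then show "integrable \<mu> (\<lambda>\<Gamma>. f (Limit \<Gamma>))"
        using f01 by (intro integrable_bounded_real[of _ 1]) auto
      fix \<Gamma>
      show "indicator (\<Union>\<Gamma>\<in>F. N \<Gamma>) \<Gamma> \<le> f (Limit \<Gamma>)"
      proof (cases "\<Gamma> \<in> (\<Union>\<Gamma>\<in>F. N \<Gamma>)")
        case True
        then obtain \<Gamma>' where \<Gamma>': "\<Gamma>' \<in> F" "1/2 < \<phi> \<Gamma>' (Limit \<Gamma>)" by (auto simp: N_def)
        have "\<phi> \<Gamma>' (Limit \<Gamma>) \<le> (\<Sum>\<Gamma>'\<in>F. \<phi> \<Gamma>' (Limit \<Gamma>))"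
          by (rule member_le_sum[OF \<Gamma>'(1)]) (use \<phi>0 F(1) in auto)
        then have "f (Limit \<Gamma>) = 1" using \<Gamma>'(2) by (simp add: f_def)
        then show ?thesis by (simp add: indicator_def)
      qed (simp add: f01)
    qed
    finally show ?thesis using F(3) by linarith
  qed
  moreover have "(\<lambda>n. \<integral>x. f x \<partial>graph_distr (G n)) \<longlonglongrightarrow> (\<integral>x. f x \<partial>limit_distr \<mu>)"
  proof -
    have "bounded (range f)" using f01 by (intro boundedI[of _ 1]) auto
    then show ?thesis using conv contf unfolding weakly_converges_def by blast
  qed
  ultimately have ev1: "\<forall>\<^sub>F n in sequentially. 1 - \<delta> < measure_pmf.expectation (ignore_labels (G n)) (\<lambda>g. f (Graph g))"
    unfolding integral_graph_distr[OF contf] integral_limit_distr[OF contf \<mu>(2)] by (rule order_tendstoD(1)[rotated])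
  define L where "L = log 2 (real (card F + 1))"
  have "(\<lambda>n. (L + n * log 2 n) / (real n * (real n - 1) / 2)) \<longlonglongrightarrow> 0" by real_asymp
  then have ev2: "\<forall>\<^sub>F n in sequentially. (L + n * log 2 n) / (real n * (real n - 1) / 2) < \<delta>"
    using \<delta> by (intro order_tendstoD) auto
  have ev3: "\<forall>\<^sub>F n in sequentially. \<forall>\<Gamma>\<in>F. k \<Gamma> \<le> n"
    using F(1) by (intro eventually_ball_finite) (auto intro: eventually_ge_at_top)
  show ?thesis
    using ev1 ev2 ev3 eventually_ge_at_top[of 2]
  proof eventually_elim
    fix n :: nat
    assume 1: "1 - \<delta> < measure_pmf.expectation (ignore_labels (G n)) (\<lambda>g. f (Graph g))"
      and 2: "(L + n * log 2 n) / (real n * (real n - 1) / 2) < \<delta>" and 3: "\<forall>\<Gamma>\<in>F. k \<Gamma> \<le> n" and n: "2 \<le> n"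
    let ?R = "ignore_labels (G n)" and ?A = "{g. \<exists>\<Gamma>\<in>F. bump (k \<Gamma>) (\<epsilon> \<Gamma>) \<Gamma> (Graph g) > 0}"
    have rg: "random_graph_on n (G n)" using G n by simp
    have "measure_pmf.expectation ?R (\<lambda>g. f (Graph g)) \<le> measure_pmf.expectation ?R (indicator ?A)"
    proof (rule integral_mono)
      show "integrable (measure_pmf ?R) (\<lambda>g. f (Graph g))"
        using f01 by (intro measure_pmf.integrable_bounded_real[where B = 1]) auto
      show "integrable (measure_pmf ?R) (indicator ?A :: _ \<Rightarrow> real)"
        by (intro measure_pmf.integrable_bounded_real[where B = 1]) auto
      fix g
      show "f (Graph g) \<le> indicator ?A g"
      proof (cases "g \<in> ?A")
        case False
        then have "\<phi> \<Gamma> (Graph g) = 0" if "\<Gamma> \<in> F" for \<Gamma>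
          using that \<phi>0[of \<Gamma> "Graph g"] by (force simp: \<phi>_def)
        then show ?thesis using False by (simp add: f_def)
      qed (simp add: f01)
    qed
    then have prob: "measure_pmf.prob ?R ?A \<ge> 1 - \<delta>" using 1 by simp
    have "pmf_entropy ?R \<le> L + (n choose 2) * (M + \<delta> + \<delta>)"
      unfolding L_def
      using set_ignore_labels[OF rg] n F k \<epsilon> box prob 3 M(2) \<delta>
      by (intro pmf_entropy_near_support[where k = k and \<epsilon> = \<epsilon> and \<delta> = \<delta>]) (auto simp: subset_iff)
    also have "M + \<delta> + \<delta> = M + 2 * \<delta>" by simp
    finally have "random_graph_entropy (G n) \<le> (L + n * log 2 n) + (n choose 2) * (M + 2 * \<delta>)"
      using random_graph_entropy_le[OF rg] n by simp
    moreover have pos: "real (n choose 2) > 0" using n by (simp add: zero_less_binomial)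
    ultimately have "random_graph_entropy (G n) / (n choose 2) \<le> ((L + n * log 2 n) + (n choose 2) * (M + 2 * \<delta>)) / (n choose 2)"
      by (intro divide_right_mono) auto
    also have "\<dots> = (L + n * log 2 n) / (n choose 2) + (M + 2 * \<delta>)" using pos by (simp add: add_divide_distrib)
    also have "\<dots> \<le> M + 4 * \<delta>" using 2 \<delta> unfolding real_choose_2 by linarith
    finally show "random_graph_entropy (G n) / (n choose 2) \<le> M + 4 * \<delta>" .
  qed
qed

theorem theorem1p8:
  fixes G :: "nat \<Rightarrow> random_graph" and \<mu> :: "graph_limit measure"
  assumes "\<And>n. n \<ge> 1 \<Longrightarrow> random_graph_on n (G n)"
    and "prob_space \<mu>" and "sets \<mu> = sets borel"
    and "weakly_converges (\<lambda>n. graph_distr (G n)) (limit_distr \<mu>)"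
  shows "\<exists>\<Gamma>\<in>measure_support \<mu>.
           (\<forall>\<Gamma>'\<in>measure_support \<mu>. limit_entropy \<Gamma>' \<le> limit_entropy \<Gamma>) \<and>
           limsup (\<lambda>n. ereal (random_graph_entropy (G n) / real (n choose 2)))
             \<le> ereal (limit_entropy \<Gamma>)"
proof -
  \<comment> \<open>Were the support empty, the covering lemma would give an empty union measure
    above 1/2.\<close>
  have "measure_support \<mu> \<noteq> {}"
  proof
    assume "measure_support \<mu> = {}"
    then obtain F where "F \<subseteq> ({} :: graph_limit set)" "measure \<mu> (\<Union>\<Gamma>\<in>F. {}) > 1 - 1/2"
      using measure_support_finite_cover[OF assms(2,3), of "\<lambda>_. {}" "1/2"] by auto
    then show False by simp
  qed
  then obtain \<Gamma> where \<Gamma>: "\<Gamma> \<in> measure_support \<mu>"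
    "\<And>\<Gamma>'. \<Gamma>' \<in> measure_support \<mu> \<Longrightarrow> limit_entropy \<Gamma>' \<le> limit_entropy \<Gamma>"
    by (rule limit_entropy_attains_max) blast
  have "limsup (\<lambda>n. ereal (random_graph_entropy (G n) / real (n choose 2))) \<le> ereal (limit_entropy \<Gamma>)"
  proof (rule ereal_le_epsilon2)
    fix e :: real assume "e > 0"
    then have "\<forall>\<^sub>F n in sequentially. random_graph_entropy (G n) / (n choose 2) \<le> limit_entropy \<Gamma> + 4 * (e / 4)"
      by (intro entropy_eventually_le[OF assms \<Gamma>(2)] limit_entropy_bounds) auto
    then have "\<forall>\<^sub>F n in sequentially. ereal (random_graph_entropy (G n) / (n choose 2)) \<le> ereal (limit_entropy \<Gamma>) + ereal e"
      by (rule eventually_mono) simp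
    then show "limsup (\<lambda>n. ereal (random_graph_entropy (G n) / real (n choose 2))) \<le> ereal (limit_entropy \<Gamma>) + ereal e"
      by (rule Limsup_bounded)
  qed
  then show ?thesis using \<Gamma> by blast
qed

end
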